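(* Let $\mathcal{H}$ be a separable Hilbert space and $\mathcal{L}=\mathcal{L}(\mathcal{H})$ its space of bounded linear transformations. If $\phi:\mathbb{D}\to\mathcal{L}$ is an analytic function such that $$\left\|\phi\right\|_{\mathrm{BMOA}_{\mathcal{C}}}^2=\sup_{f\in\mathcal{O}_1(\mathcal{H})}\int_{\mathbb{D}} \left\| (D\phi)(z) f(\overline{z})\right\|_{\mathcal{H}}^2(1-|z|^2)\,dA(z)<\infty$$ and $$\left\|\phi^\#\right\|_{\mathrm{BMOA}_{\mathcal{C}}}^2=\sup_{f\in\mathcal{O}_1(\mathcal{H})}\int_{\mathbb{D}} \left\| (D\phi)(\overline{z})^* f(\overline{z})\right\|_{\mathcal{H}}^2(1-|z|^2)\,dA(z)<\infty,$$ then $$\left\|\Gamma_\phi\right\|_{H^2(\mathcal{H})\to H^2(\mathcal{H})}=\sup_{f\in\mathcal{O}_1(\mathcal{H})}\left\|\Gamma_\phi f\right\|_{H^2(\mathcal{H})}<\infty.$$ Moreover, there is a constant $C>0$, independent of $\phi$, such that $$\left\|\Gamma_\phi\right\|_{H^2(\mathcal{H})\to H^2(\mathcal{H})}\le C\left( \left\|\phi\right\|_{\mathrm{BMOA}_{\mathcal{C}}}+\left\|\phi^\#\right\|_{\mathrm{BMOA}_{\mathcal{C}}}\right).$$ If $\mathcal{H}$ is infinite-dimensional, then the converse statement does not hold, i.e. there exists an analytic $\phi:\mathbb{D}\to\mathcal{L}$ with $\left\|\Gamma_\phi\right\|_{H^2(\mathcal{H})\to H^2(\mathcal{H})}<\infty$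 for which $\left\|\phi\right\|_{\mathrm{BMOA}_{\mathcal{C}}}$ and $\left\|\phi^\#\right\|_{\mathrm{BMOA}_{\mathcal{C}}}$ are not both finite.
   Context: $\mathbb{D}$ is the open unit disc in $\mathbb{C}$ and $dA$ is area measure. $\mathrm{Hol}(\mathcal{Y})$ is the space of analytic functions on $\mathbb{D}$ with values in the Banach space $\mathcal{Y}$, $\hat f(n)$ is the $n$th Taylor coefficient of $f$ at the origin, and $\mathcal{O}(\mathcal{Y})$ is the set of $f\in\mathrm{Hol}(\mathcal{Y})$ that extend analytically to a larger disc centered at the origin. $H^2(\mathcal{H})$ is the Hardy space with $\|f\|_{H^2(\mathcal{H})}^2=\sum_{n\ge0}\|\hat f(n)\|_{\mathcal{H}}^2$ (value $\infty$ allowed), and $\mathcal{O}_1(\mathcal{H})=\{f\in\mathcal{O}(\mathcal{H}):\|f\|_{H^2(\mathcal{H})}=1\}$. $Df(z)=\sum_{n\ge 0}(1+n)\hat f(n)z^n=zf'(z)+f(z)$. For $\phi\in\mathrm{Hol}(\mathcal{L})$, $\phi^\#(z)=\phi(\overline z)^*$ (Hilbert space adjoint), and for $f\in\mathcal{O}(\mathcal{H})$ the Hankel operator is $\Gamma_\phi f(z)=\sum_{n\ge0}\left(\sum_{m\ge0}\hat\phi(m+n)\hat f(m)\right)z^n$, $z\in\mathbb{D}$. *)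

theory Defs
  imports "HOL-Analysis.Analysis"
begin

section \<open>Complex Banach and Hilbert spaces\<close>

class complex_vector = real_vector +
  fixes scaleC :: "complex \<Rightarrow> 'a \<Rightarrow> 'a" (infixr \<open>*\<^sub>C\<close> 75)
  assumes scaleC_add_right: "a *\<^sub>C (x + y) = a *\<^sub>C x + a *\<^sub>C y"
    and scaleC_add_left: "(a + b) *\<^sub>C x = a *\<^sub>C x + b *\<^sub>C x"
    and scaleC_scaleC [simp]: "a *\<^sub>C b *\<^sub>C x = (a * b) *\<^sub>C x"
    and scaleC_one [simp]: "1 *\<^sub>C x = x"
    and scaleR_scaleC: "r *\<^sub>R x = of_real r *\<^sub>C x"

lemma vector_space_scaleC: "vector_space (scaleC :: complex \<Rightarrow> 'a \<Rightarrow> 'a::complex_vector)"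
  by unfold_locales (simp_all add: scaleC_add_right scaleC_add_left)

class complex_normed_vector = complex_vector + real_normed_vector +
  assumes norm_scaleC [simp]: "norm (a *\<^sub>C x) = cmod a * norm x"

text \<open>The inner product is linear in the first and conjugate-linear in the second argument.\<close>

class complex_inner = complex_normed_vector +
  fixes cinner :: "'a \<Rightarrow> 'a \<Rightarrow> complex"
  assumes cinner_commute: "cinner x y = cnj (cinner y x)"
    and cinner_add_left: "cinner (x + y) z = cinner x z + cinner y z"
    and cinner_scaleC_left [simp]: "cinner (a *\<^sub>C x) y = a * cinner x y"
    and norm_eq_sqrt_cinner: "norm x = sqrt (Re (cinner x x))"

class chilbert_space = complex_inner + complete_space

instance chilbert_space \<subseteq> banach ..

instantiation complex :: chilbert_space
begin

definition scaleC_complex :: "complex \<Rightarrow> complex \<Rightarrow> complex" where "scaleC_complex = (*)"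
definition cinner_complex :: "complex \<Rightarrow> complex \<Rightarrow> complex" where "cinner_complex x y = x * cnj y"

instance
proof
  fix x :: complex
  show "norm x = sqrt (Re (cinner x x))"
    by (simp add: cinner_complex_def cmod_def power2_eq_square)
qed (simp_all add: scaleC_complex_def cinner_complex_def distrib_left distrib_right
    scaleR_conv_of_real norm_mult mult.assoc)

end

lemma bounded_bilinear_scaleC:
  "bounded_bilinear (scaleC :: complex \<Rightarrow> 'a \<Rightarrow> 'a::complex_normed_vector)"
  by standard (auto simp: scaleC_add_left scaleC_add_right scaleR_scaleC scaleC_complex_def ac_simps
      intro!: exI[of _ 1])

interpretation scaleC: bounded_bilinear
  "scaleC :: complex \<Rightarrow> 'a \<Rightarrow> 'a::complex_normed_vector"
  by (rule bounded_bilinear_scaleC)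

lemma cinner_add_right: "cinner x (y + z) = cinner x y + cinner x (z::'a::complex_inner)"
  by (metis cinner_commute cinner_add_left complex_cnj_add)

lemma cinner_scaleC_right [simp]: "cinner x (a *\<^sub>C y) = cnj a * cinner x (y::'a::complex_inner)"
  by (metis cinner_commute cinner_scaleC_left complex_cnj_mult)

lemma cinner_scaleR_left [simp]: "cinner (r *\<^sub>R x) y = of_real r * cinner x (y::'a::complex_inner)"
  by (simp add: scaleR_scaleC)

lemma cinner_scaleR_right [simp]: "cinner x (r *\<^sub>R y) = of_real r * cinner x (y::'a::complex_inner)"
  by (simp add: scaleR_scaleC)

lemma cinner_minus_left [simp]: "cinner (- x) y = - cinner x (y::'a::complex_inner)"
  using cinner_scaleR_left[of "-1" x y] by simp

lemma cinner_minus_right [simp]: "cinner x (- y) = - cinner x (y::'a::complex_inner)"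
  using cinner_scaleR_right[of x "-1" y] by simp

lemma cinner_diff_left: "cinner (x - y) z = cinner x z - cinner y (z::'a::complex_inner)"
  using cinner_add_left[of x "- y" z] by simp

lemma cinner_diff_right: "cinner x (y - z) = cinner x y - cinner x (z::'a::complex_inner)"
  using cinner_add_right[of x y "- z"] by simp

lemma Re_cinner_self: "Re (cinner x x) = (norm (x::'a::complex_inner))\<^sup>2"
proof -
  have "0 \<le> Re (cinner x x)"
    using norm_ge_zero[of x] norm_eq_sqrt_cinner[of x] by (metis real_sqrt_ge_0_iff)
  then show ?thesis by (simp add: norm_eq_sqrt_cinner)
qed

lemma cinner_self: "cinner x x = of_real ((norm (x::'a::complex_inner))\<^sup>2)"
proof (rule complex_eqI)
  have "Im (cinner x x) = - Im (cinner x x)" by (metis cinner_commute cnj.simps(2))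
  then show "Im (cinner x x) = Im (of_real ((norm x)\<^sup>2))" by simp
qed (simp only: Re_cinner_self Re_complex_of_real)

lemma Re_cinner_commute: "Re (cinner x y) = Re (cinner y (x::'a::complex_inner))"
  by (metis cinner_commute cnj.simps(1))

lemma norm_add_sq:
  "(norm (x + y))\<^sup>2 = (norm x)\<^sup>2 + (norm y)\<^sup>2 + 2 * Re (cinner x (y::'a::complex_inner))"
  unfolding Re_cinner_self[symmetric]
  using Re_cinner_commute[of x y] by (simp add: cinner_add_left cinner_add_right)

lemma norm_diff_sq:
  "(norm (x - y))\<^sup>2 = (norm x)\<^sup>2 + (norm y)\<^sup>2 - 2 * Re (cinner x (y::'a::complex_inner))"
  using norm_add_sq[of x "- y"] by simp

lemma Cauchy_Schwarz_cinner: "cmod (cinner x y) \<le> norm x * norm (y::'a::complex_inner)"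
proof -
  have *: "Re (cinner x y) \<le> norm x * norm y" for x y :: 'a
  proof -
    have "(norm (x + y))\<^sup>2 \<le> (norm x + norm y)\<^sup>2"
      by (intro power_mono norm_triangle_ineq norm_ge_zero)
    then show ?thesis unfolding norm_add_sq by (simp add: power2_sum)
  qed
  define a where "a = cnj (sgn (cinner x y))"
  have "a * cinner x y = of_real (cmod (cinner x y))"
  proof (cases "cinner x y = 0")
    case False
    have "cnj (cinner x y) * cinner x y = of_real ((cmod (cinner x y))\<^sup>2)"
      by (metis complex_norm_square mult.commute of_real_power)
    with False show ?thesis
      by (simp add: a_def sgn_eq field_simps power2_eq_square)
  qed simp
  then have "cmod (cinner x y) = Re (cinner (a *\<^sub>C x) y)" by simp
  also have "\<dots> \<le> norm (a *\<^sub>C x) * norm y" by (rule *)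
  also have "\<dots> \<le> norm x * norm y"
    by (intro mult_right_mono) (auto simp: a_def norm_sgn)
  finally show ?thesis .
qed

lemma cinner_eqI: "(\<And>x. cinner x y = cinner x z) \<Longrightarrow> y = (z::'a::complex_inner)"
proof -
  assume "\<And>x. cinner x y = cinner x z"
  then have "cinner (y - z) (y - z) = 0" by (simp add: cinner_diff_right)
  then show "y = z" by (simp add: cinner_self)
qed

lemma riesz_representation:
  fixes f :: "'a::chilbert_space \<Rightarrow> complex"
  assumes bl: "bounded_linear f" and hom: "\<And>c x. f (c *\<^sub>C x) = c * f x"
  shows "\<exists>u. \<forall>x. f x = cinner x u"
proof -
  interpret bounded_linear f by (rule bl)
  obtain K where K: "\<And>x. cmod (f x) \<le> norm x * K" using bounded by blast
  define J where "J x = (norm x)\<^sup>2 - 2 * Re (f x)" for x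
  have Jlow: "- K\<^sup>2 \<le> J x" for x
  proof -
    have "Re (f x) \<le> norm x * K" using K[of x] complex_Re_le_cmod order_trans by blast
    moreover have "0 \<le> (norm x - K)\<^sup>2" by simp
    ultimately show ?thesis unfolding J_def power2_diff by linarith
  qed
  have bdd: "bdd_below (range J)" using Jlow by (auto intro!: bdd_belowI)
  define m where "m = (INF x. J x)"
  have mle: "m \<le> J x" for x unfolding m_def by (rule cINF_lower[OF bdd]) simp
  have "\<exists>x. J x < m + e" if "e > 0" for e
    using cInf_lessD[of "range J" "m + e"] that by (auto simp: m_def)
  then have "\<exists>x. J x < m + inverse (real (Suc n))" for n by simp
  then obtain X where X: "\<And>n. J (X n) < m + inverse (real (Suc n))" by metis
  have par: "(norm (x - y))\<^sup>2 \<le> 2 * (J x - m) + 2 * (J y - m)" for x y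
  proof -
    have "4 * J ((1/2) *\<^sub>R (x + y)) = (norm (x + y))\<^sup>2 - 4 * Re (f (x + y))"
      by (simp add: J_def scaleR power_divide)
    also have "\<dots> = 2 * J x + 2 * J y - (norm (x - y))\<^sup>2"
      unfolding norm_add_sq norm_diff_sq J_def add by simp
    finally show ?thesis using mle[of "(1/2) *\<^sub>R (x + y)"] by simp
  qed
  have "Cauchy X"
  proof (rule metric_CauchyI)
    fix e :: real assume "e > 0"
    then obtain N where N: "inverse (real (Suc N)) < e\<^sup>2 / 4"
      using reals_Archimedean[of "e\<^sup>2 / 4"] by auto
    then have N': "4 * inverse (real (Suc N)) < e\<^sup>2" by simp
    have "dist (X i) (X j) < e" if "i \<ge> N" "j \<ge> N" for i j
    proof -
      define s where "s = inverse (real (Suc N))"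
      have J: "J (X k) - m < s" if "k \<ge> N" for k
      proof -
        have "inverse (real (Suc k)) \<le> s" using that by (auto simp: s_def intro!: le_imp_inverse_le)
        with X[of k] show ?thesis by linarith
      qed
      have "(norm (X i - X j))\<^sup>2 < e\<^sup>2"
      proof -
        have "(norm (X i - X j))\<^sup>2 \<le> 2 * (J (X i) - m) + 2 * (J (X j) - m)" by (rule par)
        also have "\<dots> < 2 * s + 2 * s"
          by (intro add_strict_mono mult_strict_left_mono J that) simp_all
        also have "\<dots> < e\<^sup>2" using N' by (simp add: s_def)
        finally show ?thesis .
      qed
      then show ?thesis using \<open>e > 0\<close> by (auto simp only: dist_norm intro: power2_less_imp_less)
    qed
    then show "\<exists>M. \<forall>i\<ge>M. \<forall>j\<ge>M. dist (X i) (X j) < e" by blast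
  qed
  then obtain u where u: "X \<longlonglongrightarrow> u" by (auto simp: Cauchy_convergent_iff convergent_def)
  have "(\<lambda>n. J (X n)) \<longlonglongrightarrow> J u"
    unfolding J_def
    by (intro tendsto_diff tendsto_mult tendsto_power tendsto_norm tendsto_Re tendsto_const tendsto u)
  moreover have "(\<lambda>n. m + inverse (real (Suc n))) \<longlonglongrightarrow> m + 0"
    by (intro tendsto_add tendsto_const LIMSEQ_inverse_real_of_nat)
  ultimately have "J u \<le> m + 0"
    by (rule LIMSEQ_le) (intro exI[of _ 0] allI impI less_imp_le X)
  then have min: "J u \<le> J x" for x using mle[of x] by simp
  have Re: "Re (f v) = Re (cinner v u)" for v
  proof (rule ccontr)
    assume ne: "Re (f v) \<noteq> Re (cinner v u)"
    define d where "d = Re (f v) - Re (cinner v u)"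
    define s where "s = d / ((norm v)\<^sup>2 + 1)"
    have pos: "(norm v)\<^sup>2 + 1 > 0" using zero_le_power2[of "norm v"] by linarith
    have "J (u + s *\<^sub>R v) = J u + s\<^sup>2 * (norm v)\<^sup>2 - 2 * s * d"
      unfolding J_def norm_add_sq d_def
      using Re_cinner_commute[of u v]
      by (simp add: add scaleR algebra_simps power_mult_distrib)
    then have "0 \<le> s\<^sup>2 * (norm v)\<^sup>2 - 2 * s * d" using min[of "u + s *\<^sub>R v"] by simp
    moreover have "d = s * ((norm v)\<^sup>2 + 1)" using pos by (simp add: s_def)
    ultimately have "0 \<le> - (s\<^sup>2 * (norm v)\<^sup>2) - 2 * s\<^sup>2"
      by (simp add: algebra_simps power2_eq_square)
    moreover have "0 \<le> s\<^sup>2 * (norm v)\<^sup>2" by simp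
    ultimately have "s\<^sup>2 \<le> 0" by linarith
    then have "s = 0" by simp
    then show False using pos ne by (simp add: s_def d_def)
  qed
  have "f v = cinner v u" for v
  proof (rule complex_eqI)
    show "Re (f v) = Re (cinner v u)" by (rule Re)
    show "Im (f v) = Im (cinner v u)" using Re[of "\<i> *\<^sub>C v"] by (simp add: hom)
  qed
  then show ?thesis by blast
qed


section \<open>Bounded complex-linear operators\<close>

text \<open>A subtype of the real-linear type \<^typ>\<open>'a \<Rightarrow>\<^sub>L 'b\<close>, from which it inherits the operator norm.\<close>

typedef (overloaded) ('a, 'b) cblinfun =
  "{T :: 'a::complex_normed_vector \<Rightarrow>\<^sub>L 'b::complex_normed_vector.
      \<forall>c x. blinfun_apply T (c *\<^sub>C x) = c *\<^sub>C blinfun_apply T x}"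
  by (rule exI[of _ 0]) (simp add: scaleC.zero_right)

setup_lifting type_definition_cblinfun

lift_definition cblinfun_apply ::
  "('a::complex_normed_vector, 'b::complex_normed_vector) cblinfun \<Rightarrow> 'a \<Rightarrow> 'b" (infixr \<open>*\<^sub>V\<close> 75)
  is blinfun_apply .

instantiation cblinfun :: (complex_normed_vector, complex_normed_vector) complex_normed_vector
begin

lift_definition norm_cblinfun :: "('a, 'b) cblinfun \<Rightarrow> real" is norm .
lift_definition zero_cblinfun :: "('a, 'b) cblinfun" is 0 by (simp add: scaleC.zero_right)
lift_definition plus_cblinfun :: "('a, 'b) cblinfun \<Rightarrow> ('a, 'b) cblinfun \<Rightarrow> ('a, 'b) cblinfun"
  is "(+)" by (simp add: blinfun.add_left scaleC_add_right)
lift_definition minus_cblinfun :: "('a, 'b) cblinfun \<Rightarrow> ('a, 'b) cblinfun \<Rightarrow> ('a, 'b) cblinfun"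
  is "(-)" by (simp add: blinfun.diff_left scaleC.diff_right)
lift_definition uminus_cblinfun :: "('a, 'b) cblinfun \<Rightarrow> ('a, 'b) cblinfun"
  is uminus by (simp add: blinfun.minus_left scaleC.minus_right)
lift_definition scaleR_cblinfun :: "real \<Rightarrow> ('a, 'b) cblinfun \<Rightarrow> ('a, 'b) cblinfun"
  is "(*\<^sub>R)" by (simp add: blinfun.scaleR_left scaleR_scaleC mult.commute)
lift_definition scaleC_cblinfun :: "complex \<Rightarrow> ('a, 'b) cblinfun \<Rightarrow> ('a, 'b) cblinfun"
  is "\<lambda>c T. Blinfun (\<lambda>x. c *\<^sub>C blinfun_apply T x)"
  by (subst (1 2) bounded_linear_Blinfun_apply)
    (auto simp: mult.commute intro!: scaleC.bounded_linear_right[THEN bounded_linear_compose]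
      blinfun.bounded_linear_right)

definition dist_cblinfun :: "('a, 'b) cblinfun \<Rightarrow> ('a, 'b) cblinfun \<Rightarrow> real"
  where "dist_cblinfun S T = norm (S - T)"
definition sgn_cblinfun :: "('a, 'b) cblinfun \<Rightarrow> ('a, 'b) cblinfun"
  where "sgn_cblinfun T = scaleR (inverse (norm T)) T"
definition uniformity_cblinfun :: "(('a, 'b) cblinfun \<times> ('a, 'b) cblinfun) filter"
  where "uniformity_cblinfun = (INF e\<in>{0<..}. principal {(S, T). dist S T < e})"
definition open_cblinfun :: "('a, 'b) cblinfun set \<Rightarrow> bool"
  where "open_cblinfun U = (\<forall>S\<in>U. \<forall>\<^sub>F (S', T) in uniformity. S' = S \<longrightarrow> T \<in> U)"

lemma cblinfun_apply_scaleC: "(c *\<^sub>C T) *\<^sub>V x = c *\<^sub>C (T *\<^sub>V x)"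
  by transfer (subst bounded_linear_Blinfun_apply, auto intro!:
      scaleC.bounded_linear_right[THEN bounded_linear_compose] blinfun.bounded_linear_right)

lemma cblinfun_apply_eqI: "(\<And>x. S *\<^sub>V x = T *\<^sub>V x) \<Longrightarrow> S = (T::('a, 'b) cblinfun)"
  by transfer (rule blinfun_eqI)

instance
proof
  fix S T U :: "('a, 'b) cblinfun" and a b :: complex and r s :: real
  have add: "(S + T) *\<^sub>V x = S *\<^sub>V x + T *\<^sub>V x" for S T :: "('a, 'b) cblinfun" and x
    by transfer (simp add: blinfun.add_left)
  have scR: "(r *\<^sub>R S) *\<^sub>V x = r *\<^sub>R (S *\<^sub>V x)" for S :: "('a, 'b) cblinfun" and r x
    by transfer (simp add: blinfun.scaleR_left)
  show "S + T + U = S + (T + U)" "S + T = T + S" "0 + S = S" "- S + S = 0" "S - T = S + - T"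
    by (transfer, simp)+
  show "r *\<^sub>R (S + T) = r *\<^sub>R S + r *\<^sub>R T" "(r + s) *\<^sub>R S = r *\<^sub>R S + s *\<^sub>R S"
    "r *\<^sub>R s *\<^sub>R S = (r * s) *\<^sub>R S" "1 *\<^sub>R S = S"
    by (transfer, simp add: scaleR_add_right scaleR_add_left)+
  show "a *\<^sub>C (S + T) = a *\<^sub>C S + a *\<^sub>C T" "(a + b) *\<^sub>C S = a *\<^sub>C S + b *\<^sub>C S"
    "a *\<^sub>C b *\<^sub>C S = (a * b) *\<^sub>C S" "1 *\<^sub>C S = S" "r *\<^sub>R S = of_real r *\<^sub>C S"
    by (rule cblinfun_apply_eqI;
        simp add: add scR cblinfun_apply_scaleC scaleC_add_right scaleC_add_left scaleR_scaleC)+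
  show "dist S T = norm (S - T)" "sgn S = scaleR (inverse (norm S)) S"
    by (fact dist_cblinfun_def sgn_cblinfun_def)+
  show "uniformity = (INF e\<in>{0<..}. principal {(S, T :: ('a, 'b) cblinfun). dist S T < e})"
    by (fact uniformity_cblinfun_def)
  show "open U = (\<forall>S\<in>U. \<forall>\<^sub>F (S', T) in uniformity. S' = S \<longrightarrow> T \<in> U)"
    for U :: "('a, 'b) cblinfun set" by (fact open_cblinfun_def)
  show "(norm S = 0) = (S = 0)" "norm (S + T) \<le> norm S + norm T" "norm (r *\<^sub>R S) = \<bar>r\<bar> * norm S"
    by (transfer, simp add: norm_triangle_ineq)+
  have nn: "0 \<le> norm S" for S :: "('a, 'b) cblinfun" by transfer simp
  have le: "norm (a *\<^sub>C S) \<le> cmod a * norm S" for a and S :: "('a, 'b) cblinfun"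
  proof -
    have n: "norm (T *\<^sub>V x) \<le> norm T * norm x" for T :: "('a, 'b) cblinfun" and x
      by transfer (rule norm_blinfun)
    have b: "norm T \<le> c" if "0 \<le> c" "\<And>x. norm (T *\<^sub>V x) \<le> c * norm x"
      for T :: "('a, 'b) cblinfun" and c
      using that by transfer (rule norm_blinfun_bound)
    show ?thesis
      by (rule b) (auto simp: cblinfun_apply_scaleC mult.assoc intro!: mult_left_mono n
          mult_nonneg_nonneg nn)
  qed
  show "norm (a *\<^sub>C S) = cmod a * norm S"
  proof (cases "a = 0")
    case True
    then show ?thesis using le[of a S] nn[of "a *\<^sub>C S"] by simp
  next
    case False
    have "inverse a *\<^sub>C a *\<^sub>C S = S"
      by (rule cblinfun_apply_eqI) (simp add: cblinfun_apply_scaleC False)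
    then have "norm S = norm (inverse a *\<^sub>C a *\<^sub>C S)" by simp
    also have "\<dots> \<le> inverse (cmod a) * norm (a *\<^sub>C S)"
      using le[of "inverse a" "a *\<^sub>C S"] by (simp add: norm_inverse)
    finally have "cmod a * norm S \<le> norm (a *\<^sub>C S)" using False by (simp add: field_simps)
    then show ?thesis using le[of a S] by simp
  qed
qed

end

text \<open>The Hilbert space adjoint; it exists and is unique by \<open>adj_works\<close> below.\<close>

definition adj :: "('a::chilbert_space, 'b::chilbert_space) cblinfun \<Rightarrow> ('b, 'a) cblinfun" where
  "adj T = (THE S. \<forall>x y. cinner (T *\<^sub>V x) y = cinner x (S *\<^sub>V y))"


section \<open>Vector-valued analytic functions\<close>

text \<open>Complex differentiability with respect to the norm of the complex Banach space \<open>'a\<close>;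
  functions on the disc are total functions of which only the values on the disc matter.\<close>

definition has_cderiv :: "(complex \<Rightarrow> 'a::complex_normed_vector) \<Rightarrow> 'a \<Rightarrow> complex filter \<Rightarrow> bool" where
  "has_cderiv f d F \<longleftrightarrow> (f has_derivative (\<lambda>h. h *\<^sub>C d)) F"

definition cholomorphic_on :: "(complex \<Rightarrow> 'a::complex_normed_vector) \<Rightarrow> complex set \<Rightarrow> bool" where
  "cholomorphic_on f S \<longleftrightarrow> (\<forall>z\<in>S. \<exists>d. has_cderiv f d (at z within S))"

definition cderiv :: "(complex \<Rightarrow> 'a::complex_normed_vector) \<Rightarrow> complex \<Rightarrow> 'a" where
  "cderiv f z = (THE d. has_cderiv f d (at z))"

definition Hol :: "(complex \<Rightarrow> 'a::complex_normed_vector) set" where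
  "Hol = {f. cholomorphic_on f (ball 0 1)}"

definition taylor_coeff :: "(complex \<Rightarrow> 'a::complex_normed_vector) \<Rightarrow> nat \<Rightarrow> 'a" where
  "taylor_coeff f n = (1 / fact n) *\<^sub>C (cderiv ^^ n) f 0"

definition Oext :: "(complex \<Rightarrow> 'a::complex_normed_vector) set" where
  "Oext = {f \<in> Hol. \<exists>R>1. \<exists>g. cholomorphic_on g (ball 0 R) \<and> (\<forall>z\<in>ball 0 1. g z = f z)}"

definition Dop :: "(complex \<Rightarrow> 'a::complex_normed_vector) \<Rightarrow> complex \<Rightarrow> 'a" where
  "Dop f z = z *\<^sub>C cderiv f z + f z"

lemma cderiv_eqI:
  assumes "has_cderiv f d (at z)" shows "cderiv f z = d"
  unfolding cderiv_def
proof (rule the_equality)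
  fix d' assume "has_cderiv f d' (at z)"
  with assms have "(\<lambda>h. h *\<^sub>C d') = (\<lambda>h. h *\<^sub>C d)"
    unfolding has_cderiv_def by (rule has_derivative_unique[rotated])
  then show "d' = d" by (metis scaleC_one)
qed (fact assms)


section \<open>Hardy space, BMOA and Hankel operators\<close>

definition ennsqrt :: "ennreal \<Rightarrow> ennreal" where
  "ennsqrt x = (if x = \<infinity> then \<infinity> else ennreal (sqrt (enn2real x)))"

definition H2_norm :: "(complex \<Rightarrow> 'h::chilbert_space) \<Rightarrow> ennreal" where
  "H2_norm f = ennsqrt (\<Sum>n. ennreal ((norm (taylor_coeff f n))\<^sup>2))"

definition O1 :: "(complex \<Rightarrow> 'h::chilbert_space) set" where
  "O1 = {f \<in> Oext. H2_norm f = 1}"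

definition BMOA_C_norm :: "(complex \<Rightarrow> ('h::chilbert_space, 'h) cblinfun) \<Rightarrow> ennreal" where
  "BMOA_C_norm \<phi> = ennsqrt (SUP f\<in>O1.
     \<integral>\<^sup>+z\<in>ball 0 1. ennreal ((norm (Dop \<phi> z *\<^sub>V f (cnj z)))\<^sup>2 * (1 - (cmod z)\<^sup>2)) \<partial>lborel)"

definition sharp :: "(complex \<Rightarrow> ('h::chilbert_space, 'h) cblinfun) \<Rightarrow> complex \<Rightarrow> ('h, 'h) cblinfun" where
  "sharp \<phi> z = adj (\<phi> (cnj z))"

definition hankel ::
  "(complex \<Rightarrow> ('h::chilbert_space, 'h) cblinfun) \<Rightarrow> (complex \<Rightarrow> 'h) \<Rightarrow> complex \<Rightarrow> 'h" where
  "hankel \<phi> f z = (\<Sum>n. z ^ n *\<^sub>C (\<Sum>m. taylor_coeff \<phi> (m + n) *\<^sub>V taylor_coeff f m))"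

definition hankel_norm :: "(complex \<Rightarrow> ('h::chilbert_space, 'h) cblinfun) \<Rightarrow> ennreal" where
  "hankel_norm \<phi> = (SUP f\<in>O1. H2_norm (hankel \<phi> f))"


section \<open>The adjoint and the integral formula for \<open>\<phi>\<^sup>#\<close>\<close>

lemma cblinfun_add: "T *\<^sub>V (x + y) = T *\<^sub>V x + T *\<^sub>V y"
  by transfer (simp add: blinfun.add_right)

lemma cblinfun_scaleC: "T *\<^sub>V (c *\<^sub>C x) = c *\<^sub>C (T *\<^sub>V x)"
  by transfer simp

lemma cblinfun_scaleR: "T *\<^sub>V (r *\<^sub>R x) = r *\<^sub>R (T *\<^sub>V x)"
  by transfer (simp add: blinfun.scaleR_right)

lemma cblinfun_plus_apply: "(S + T) *\<^sub>V x = S *\<^sub>V x + T *\<^sub>V x"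
  by transfer (simp add: blinfun.add_left)

lemma norm_cblinfun: "norm (T *\<^sub>V x) \<le> norm T * norm x"
  by transfer (rule norm_blinfun)

lemma norm_cblinfun_bound: "0 \<le> b \<Longrightarrow> (\<And>x. norm (T *\<^sub>V x) \<le> b * norm x) \<Longrightarrow> norm T \<le> b"
  by transfer (rule norm_blinfun_bound)

lemma bounded_clinear_cblinfunE:
  assumes "\<And>x y. f (x + y) = f x + f y" "\<And>c x. f (c *\<^sub>C x) = c *\<^sub>C f x"
    "\<And>x. norm (f x) \<le> norm x * K"
  obtains T :: "('a::complex_normed_vector, 'b::complex_normed_vector) cblinfun"
  where "\<And>x. T *\<^sub>V x = f x"
proof -
  have bl: "bounded_linear f"
    by (rule bounded_linear_intro[OF assms(1) _ assms(3)]) (simp add: assms(2) scaleR_scaleC)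
  have "Abs_cblinfun (Blinfun f) *\<^sub>V x = f x" for x
    unfolding cblinfun_apply.rep_eq
    by (subst Abs_cblinfun_inverse) (auto simp: bounded_linear_Blinfun_apply[OF bl] assms(2))
  then show thesis by (rule that)
qed

lemma adj_ex:
  fixes T :: "('a::chilbert_space, 'b::chilbert_space) cblinfun"
  shows "\<exists>S. \<forall>x y. cinner (T *\<^sub>V x) y = cinner x (S *\<^sub>V y)"
proof -
  have "\<exists>u. \<forall>x. cinner (T *\<^sub>V x) y = cinner x u" for y
  proof (rule riesz_representation)
    show "bounded_linear (\<lambda>x. cinner (T *\<^sub>V x) y)"
    proof (rule bounded_linear_intro)
      show "norm (cinner (T *\<^sub>V x) y) \<le> norm x * (norm T * norm y)" for x
        using Cauchy_Schwarz_cinner[of "T *\<^sub>V x" y]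
          mult_right_mono[OF norm_cblinfun[of T x], of "norm y"] by (simp add: ac_simps)
    qed (simp_all add: cblinfun_add cblinfun_scaleR cinner_add_left scaleR_conv_of_real)
  qed (simp add: cblinfun_scaleC)
  then obtain g where g: "\<And>x y. cinner (T *\<^sub>V x) y = cinner x (g y)"
    using choice[of "\<lambda>y u. \<forall>x. cinner (T *\<^sub>V x) y = cinner x u"] by auto
  have "\<exists>S. \<forall>y. S *\<^sub>V y = g y"
  proof (rule bounded_clinear_cblinfunE[of g "norm T"])
    show "g (x + y) = g x + g y" for x y
      by (rule cinner_eqI) (simp add: g[symmetric] cinner_add_right)
    show "g (c *\<^sub>C x) = c *\<^sub>C g x" for c x
      by (rule cinner_eqI) (simp add: g[symmetric])
    show "norm (g y) \<le> norm y * norm T" for y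
    proof (cases "g y = 0")
      case False
      have "norm (g y) * norm (g y) = cmod (cinner (T *\<^sub>V g y) y)"
        by (simp only: g cinner_self norm_of_real power2_eq_square) simp
      also have "\<dots> \<le> norm (T *\<^sub>V g y) * norm y" by (rule Cauchy_Schwarz_cinner)
      also have "\<dots> \<le> norm (g y) * (norm y * norm T)"
        using mult_right_mono[OF norm_cblinfun[of T "g y"], of "norm y"] by (simp add: ac_simps)
      finally show ?thesis using False by simp
    qed simp
  qed (intro exI allI)
  then obtain S where S: "\<And>y. S *\<^sub>V y = g y" by blast
  show ?thesis by (intro exI[of _ S] allI) (simp add: S g)
qed

lemma adj_unique:
  assumes "\<And>x y. cinner (T *\<^sub>V x) y = cinner x (S *\<^sub>V y)" shows "adj T = S"
  unfolding adj_def
proof (rule the_equality)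
  fix S' assume "\<forall>x y. cinner (T *\<^sub>V x) y = cinner x (S' *\<^sub>V y)"
  with assms have "cinner x (S' *\<^sub>V y) = cinner x (S *\<^sub>V y)" for x y by simp
  then show "S' = S" by (rule cblinfun_apply_eqI[OF cinner_eqI])
qed (use assms in blast)

lemma adj_works: "cinner (T *\<^sub>V x) y = cinner x (adj T *\<^sub>V y)"
proof -
  obtain S where S: "\<forall>x y. cinner (T *\<^sub>V x) y = cinner x (S *\<^sub>V y)" using adj_ex by blast
  then have "adj T = S" by (intro adj_unique) blast
  with S show ?thesis by blast
qed

lemma adj_add: "adj (S + T) = adj S + adj T"
  by (rule adj_unique) (simp add: cblinfun_plus_apply cinner_add_left cinner_add_right adj_works)

lemma adj_scaleC: "adj (c *\<^sub>C T) = cnj c *\<^sub>C adj T"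
  by (rule adj_unique) (simp add: cblinfun_apply_scaleC adj_works)

lemma norm_adj_le: "norm (adj T) \<le> norm T"
proof (rule norm_cblinfun_bound)
  fix y
  show "norm (adj T *\<^sub>V y) \<le> norm T * norm y"
  proof (cases "adj T *\<^sub>V y = 0")
    case False
    let ?g = "adj T *\<^sub>V y"
    have "norm ?g * norm ?g = cmod (cinner (T *\<^sub>V ?g) y)"
      by (simp only: adj_works cinner_self norm_of_real power2_eq_square) simp
    also have "\<dots> \<le> norm (T *\<^sub>V ?g) * norm y" by (rule Cauchy_Schwarz_cinner)
    also have "\<dots> \<le> norm ?g * (norm T * norm y)"
      using mult_right_mono[OF norm_cblinfun[of T ?g], of "norm y"] by (simp add: ac_simps)
    finally show ?thesis using False by simp
  qed simp
qed simp

lemma bounded_linear_adj: "bounded_linear adj"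
  by (rule bounded_linear_intro[where K=1])
    (simp_all add: adj_add adj_scaleC scaleR_scaleC norm_adj_le)

lemma Dop_sharp:
  assumes "\<phi> \<in> Hol" and z: "z \<in> ball 0 1"
  shows "Dop (sharp \<phi>) z = adj (Dop \<phi> (cnj z))"
proof -
  have cz: "cnj z \<in> ball 0 1" using z by simp
  then obtain d where d: "has_cderiv \<phi> d (at (cnj z))"
    using assms(1) cz at_within_open[OF cz open_ball]
    unfolding Hol_def cholomorphic_on_def by fastforce
  have "(\<phi> has_derivative (\<lambda>h. h *\<^sub>C d)) (at (cnj z))"
    using d by (simp add: has_cderiv_def)
  then have "((\<lambda>w. \<phi> (cnj w)) has_derivative (\<lambda>h. cnj h *\<^sub>C d)) (at z)"
    by (rule has_derivative_compose[rotated]) (rule bounded_linear_imp_has_derivative[OF bounded_linear_cnj])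
  then have "((\<lambda>w. adj (\<phi> (cnj w))) has_derivative (\<lambda>h. adj (cnj h *\<^sub>C d))) (at z)"
    by (rule bounded_linear.has_derivative[OF bounded_linear_adj])
  then have "has_cderiv (sharp \<phi>) (adj d) (at z)"
    by (simp add: has_cderiv_def sharp_def[abs_def] adj_scaleC)
  then show ?thesis
    using cderiv_eqI[OF d] by (simp add: Dop_def cderiv_eqI adj_add adj_scaleC sharp_def)
qed

lemma BMOA_C_norm_sharp:
  assumes "\<phi> \<in> Hol"
  shows "BMOA_C_norm (sharp \<phi>) = ennsqrt (SUP f\<in>O1.
     \<integral>\<^sup>+z\<in>ball 0 1. ennreal ((norm (adj (Dop \<phi> (cnj z)) *\<^sub>V f (cnj z)))\<^sup>2 * (1 - (cmod z)\<^sup>2)) \<partial>lborel)"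
  unfolding BMOA_C_norm_def
  by (intro arg_cong[of _ _ ennsqrt] SUP_cong refl nn_integral_cong)
    (auto simp: Dop_sharp[OF assms] split: split_indicator)

end

theory Submission
  imports Defs "HOL-Complex_Analysis.Cauchy_Integral_Formula"
begin

text \<open>
  Pair \<open>z \<mapsto> (D\<phi>)(z) f(cnj z)\<close> with the polynomial \<open>\<Sum>n. (n + 1) z\<^sup>n g\<^sub>n\<close> in
  \<open>L\<^sup>2((1 - |z|\<^sup>2) dA)\<close>. Since \<open>z\<^sup>k\<close> and \<open>z\<^sup>l\<close> are orthogonal for \<open>k \<noteq> l\<close> and the \<open>k\<close>-th moment is
  \<open>pi / ((k + 1) (k + 2))\<close>, Cauchy-Schwarz bounds the form
  \<open>\<Sum>m n. (n + 1) / (m + n + 2) \<langle>\<phi>\<^sub>m\<^sub>+\<^sub>n f\<^sub>m, g\<^sub>n\<rangle>\<close> by the norm of \<open>\<phi>\<close>. The function \<open>\<phi>\<^sup>#\<close> gives the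
  same form with \<open>m + 1\<close> in place of \<open>n + 1\<close>, and the sum of the two is the form of \<open>\<Gamma>\<^sub>\<phi>\<close>.

  For the failure of the converse let \<open>\<phi>(z) = U(z) A U(z)\<close>, where \<open>U(z)\<close> is diagonal with entries
  \<open>z\<close> to the power \<open>2^i\<close> on an orthonormal sequence and \<open>A\<close> is the Hilbert matrix \<open>1 / (i - j)\<close>. On the
  unit circle \<open>\<phi>\<close> is bounded by the norm of \<open>A\<close>, so \<open>\<Gamma>\<^sub>\<phi>\<close> is bounded, whereas at \<open>m = 2^i\<close>,
  \<open>n = 2^j\<close> the weight \<open>(n + 1) / (m + n + 2)\<close> acts as a triangular truncation, which is unbounded on
  the Hilbert matrix.
\<close>

section \<open>Vector-valued power series\<close>

text \<open>The factor n + 1 in the test polynomial is forced by the moments: \<open>Dop\<close>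
  supplies m + n + 1, which cancels one factor of the moment of order m + n, and the squared norm of
  the polynomial is still at most pi times the sum of the squared norms of the \<open>g n\<close>.
  Dividing sqrt pi by pi gives the constant 1 / sqrt pi. The symbol need not have boundary values.
  Integral identities are therefore proved for polynomials on discs of radius r < 1, and r tends to
  1 only in finite sums; \<open>hankel_norm_le\<close> then passes from finite sections to all of
  \<open>O1\<close>. The obstacle behind the converse is that the norm of \<phi> alone controls only
  a weighted form. For degrees 2^i and 2^j the weight is near 1 or 0 once i and j are far apart,
  according to which is larger, so it cuts the matrix along the diagonal. The Hilbert matrix owes
  its norm bound pi to cancellation between the two sides of the diagonal; either side alone has row
  sums as large as harmonic numbers, and this costs a logarithm.\<close>

lemma bounded_bilinear_cinner: "bounded_bilinear (cinner :: 'a::complex_inner \<Rightarrow> 'a \<Rightarrow> complex)"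
  by standard (auto simp: cinner_add_left cinner_add_right scaleR_conv_of_real
      intro!: exI[of _ 1] Cauchy_Schwarz_cinner)

interpretation cinner: bounded_bilinear "cinner :: 'a::complex_inner \<Rightarrow> 'a \<Rightarrow> complex"
  by (rule bounded_bilinear_cinner)

lemma bounded_bilinear_cblinfun_apply: "bounded_bilinear cblinfun_apply"
  by standard (auto simp: cblinfun_add cblinfun_plus_apply cblinfun_scaleR scaleR_scaleC
      cblinfun_apply_scaleC cblinfun_scaleC intro!: exI[of _ 1] norm_cblinfun)

interpretation cblinfun: bounded_bilinear cblinfun_apply
  by (rule bounded_bilinear_cblinfun_apply)

text \<open>The limit is taken among the real-linear operators, where completeness is known;
  homogeneity over complex scalars survives because it is a pointwise condition.\<close>

instance cblinfun :: (complex_normed_vector, "{banach,complex_normed_vector}") banach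
proof
  fix X :: "nat \<Rightarrow> ('a, 'b) cblinfun"
  assume X: "Cauchy X"
  have "Cauchy (\<lambda>n. Rep_cblinfun (X n))"
  proof (rule CauchyI)
    fix e :: real assume "0 < e"
    then obtain M where "\<forall>m\<ge>M. \<forall>n\<ge>M. norm (X m - X n) < e"
      using CauchyD[OF X] by blast
    then show "\<exists>M. \<forall>m\<ge>M. \<forall>n\<ge>M. norm (Rep_cblinfun (X m) - Rep_cblinfun (X n)) < e"
      by (auto simp: norm_cblinfun.rep_eq minus_cblinfun.rep_eq)
  qed
  then obtain L where L: "(\<lambda>n. Rep_cblinfun (X n)) \<longlonglongrightarrow> L"
    by (auto simp: Cauchy_convergent_iff convergent_def)
  have Lx: "(\<lambda>n. blinfun_apply (Rep_cblinfun (X n)) x) \<longlonglongrightarrow> blinfun_apply L x" for x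
    by (intro blinfun.tendsto L tendsto_const)
  have "blinfun_apply L (c *\<^sub>C x) = c *\<^sub>C blinfun_apply L x" for c x
  proof (rule LIMSEQ_unique[OF Lx])
    have "blinfun_apply (Rep_cblinfun (X n)) (c *\<^sub>C x) = c *\<^sub>C blinfun_apply (Rep_cblinfun (X n)) x" for n
      using Rep_cblinfun[of "X n"] by simp
    then show "(\<lambda>n. blinfun_apply (Rep_cblinfun (X n)) (c *\<^sub>C x)) \<longlonglongrightarrow> c *\<^sub>C blinfun_apply L x"
      using scaleC.tendsto[OF tendsto_const Lx] by simp
  qed
  then have rep: "Rep_cblinfun (Abs_cblinfun L) = L"
    by (simp add: Abs_cblinfun_inverse)
  have "X \<longlonglongrightarrow> Abs_cblinfun L"
  proof (rule metric_LIMSEQ_I)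
    fix e :: real assume "0 < e"
    then show "\<exists>no. \<forall>n\<ge>no. dist (X n) (Abs_cblinfun L) < e"
      using metric_LIMSEQ_D[OF L] by (simp add: dist_norm norm_cblinfun.rep_eq minus_cblinfun.rep_eq rep)
  qed
  then show "convergent X" by (auto simp: convergent_def)
qed

text \<open>Absolute convergence at every radius below \<open>R\<close> is built in, since termwise
  differentiation and integration are justified by majorants. \<open>f\<close> is constrained only
  on the ball, so a function and its analytic extension can share the same \<open>c\<close>.\<close>

definition has_powser :: "(complex \<Rightarrow> 'a::complex_normed_vector) \<Rightarrow> (nat \<Rightarrow> 'a) \<Rightarrow> real \<Rightarrow> bool" where
  "has_powser f c R \<longleftrightarrow> (\<forall>r. 0 \<le> r \<and> r < R \<longrightarrow> summable (\<lambda>n. norm (c n) * r ^ n))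
     \<and> (\<forall>z\<in>ball 0 R. f z = (\<Sum>n. z ^ n *\<^sub>C c n))"

lemma has_powser_summable:
  assumes "has_powser f c R" "0 \<le> r" "r < R" shows "summable (\<lambda>n. norm (c n) * r ^ n)"
  using assms by (auto simp: has_powser_def)

lemma has_powser_sums:
  fixes c :: "nat \<Rightarrow> 'a::{complex_normed_vector,banach}"
  assumes "has_powser f c R" "z \<in> ball 0 R" shows "(\<lambda>n. z ^ n *\<^sub>C c n) sums f z"
proof -
  have "summable (\<lambda>n. norm (c n) * cmod z ^ n)"
    using assms by (auto simp: has_powser_def)
  then have "summable (\<lambda>n. z ^ n *\<^sub>C c n)"
    by (intro summable_norm_cancel[of "\<lambda>n. z ^ n *\<^sub>C c n"]) (simp add: norm_power mult.commute)
  then show ?thesis using assms by (simp add: has_powser_def summable_sums)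
qed

text \<open>The loss from \<rho> to \<open>r\<close> absorbs the factor \<open>Suc n\<close>. Stated
  for real majorants, it serves both for derivatives of power series and for coefficients of
  polynomial growth.\<close>

lemma summable_deriv_coeffs:
  fixes a :: "nat \<Rightarrow> real"
  assumes a: "\<And>n. 0 \<le> a n" and s: "summable (\<lambda>n. a n * \<rho> ^ n)" and r: "0 \<le> r" "r < \<rho>"
  shows "summable (\<lambda>n. real (Suc n) * a (Suc n) * r ^ n)"
proof -
  have "summable (\<lambda>n. diffs a n * r ^ n)"
    by (rule termdiff_converges[where K = \<rho>])
      (use r s in \<open>auto intro!: powser_inside[OF s]\<close>)
  then show ?thesis by (simp add: diffs_def)
qed

lemma has_powser_deriv_summable:
  assumes "has_powser f c R" "0 \<le> r" "r < R"
  shows "summable (\<lambda>n. norm (of_nat (Suc n) *\<^sub>C c (Suc n)) * r ^ n)"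
proof -
  obtain \<rho> where \<rho>: "r < \<rho>" "\<rho> < R" using dense assms by blast
  have "summable (\<lambda>n. real (Suc n) * norm (c (Suc n)) * r ^ n)"
    by (rule summable_deriv_coeffs[of "\<lambda>n. norm (c n)" \<rho>])
      (use assms \<rho> has_powser_summable[OF assms(1), of \<rho>] in auto)
  then show ?thesis by (simp add: norm_of_nat del: of_nat_Suc)
qed

lemma has_cderiv_power_scaleC:
  fixes c :: "'a::complex_normed_vector"
  shows "((\<lambda>z. z ^ n *\<^sub>C c) has_derivative (\<lambda>h. h *\<^sub>C (of_nat n * z ^ (n - 1)) *\<^sub>C c)) (at z within S)"
proof -
  have D: "((\<lambda>z. z ^ n) has_derivative (\<lambda>h. of_nat n * h * z ^ (n - 1))) (at z within S)"
    by (auto intro!: derivative_eq_intros)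
  have "((\<lambda>z. z ^ n *\<^sub>C c) has_derivative (\<lambda>h. (of_nat n * h * z ^ (n - 1)) *\<^sub>C c)) (at z within S)"
    using bounded_linear.has_derivative[OF scaleC.bounded_linear_left D, of c] .
  then show ?thesis by (simp add: ac_simps)
qed

text \<open>Termwise differentiation on a ball of radius strictly between |z| and \<open>R\<close>,
  where the derived series converges uniformly by the Weierstrass M-test.\<close>

lemma has_powser_has_cderiv:
  fixes c :: "nat \<Rightarrow> 'a::{complex_normed_vector,banach}"
  assumes P: "has_powser f c R" and z: "z \<in> ball 0 R"
  shows "has_cderiv f (\<Sum>n. z ^ n *\<^sub>C (of_nat (Suc n) *\<^sub>C c (Suc n))) (at z)"
proof -
  define d where "d z = (\<Sum>n. z ^ n *\<^sub>C (of_nat (Suc n) *\<^sub>C c (Suc n)))" for z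
  define u where "u n z = (of_nat n * z ^ (n - 1)) *\<^sub>C c n" for n and z :: complex
  obtain r where r: "cmod z < r" "r < R" using z dense by auto
  have r0: "0 \<le> r" using r norm_ge_zero[of z] by linarith
  let ?S = "ball 0 r :: complex set"
  define m where "m n = norm (of_nat n *\<^sub>C c n) * r ^ (n - 1)" for n
  have "summable (\<lambda>n. m (Suc n))"
    using has_powser_deriv_summable[OF P r0 r(2)] by (simp add: m_def)
  then have m: "summable m" by (simp only: summable_Suc_iff)
  have um: "norm (u n w) \<le> m n" if "w \<in> ?S" for n w
  proof -
    have "cmod w ^ (n - 1) \<le> r ^ (n - 1)" using that by (intro power_mono) auto
    from mult_left_mono[OF this, of "real n * norm (c n)"]
    show ?thesis by (simp add: u_def m_def norm_mult norm_power ac_simps)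
  qed
  have us: "summable (\<lambda>n. u n w)" if "w \<in> ?S" for w
    by (rule summable_comparison_test'[OF m, of 0]) (use um that in auto)
  have ul: "uniform_limit ?S (\<lambda>n w. \<Sum>i<n. u i w) (\<lambda>w. \<Sum>i. u i w) sequentially"
    by (rule Weierstrass_m_test[OF um m])
  \<comment> \<open>\<open>u 0\<close> vanishes through the factor \<open>of_nat 0\<close>, whatever
    the truncated exponent \<open>0 - 1\<close> is, so the series may start at index 1.\<close>
  have dsum: "(\<Sum>i. u i w) = d w" if "w \<in> ?S" for w
  proof -
    have "(\<Sum>i. u i w) = (\<Sum>i. u (Suc i) w) + u 0 w"
      using suminf_split_head[OF us[OF that]] by simp
    then show ?thesis by (simp add: u_def d_def scaleC.zero_left mult.commute)
  qed
  have "\<exists>g. \<forall>x\<in>?S. (\<lambda>n. x ^ n *\<^sub>C c n) sums (g x) \<and> (g has_derivative (\<lambda>h. h *\<^sub>C d x)) (at x within ?S)"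
  proof (rule has_derivative_series[where x = 0 and l = "c 0" and f' = "\<lambda>n x h. h *\<^sub>C u n x"])
    show "convex ?S" by simp
    show "((\<lambda>z. z ^ n *\<^sub>C c n) has_derivative (\<lambda>h. h *\<^sub>C u n x)) (at x within ?S)" for n x
      unfolding u_def by (rule has_cderiv_power_scaleC)
    show "0 \<in> ?S" using le_less_trans[OF norm_ge_zero r(1)] by simp
    show "(\<lambda>n. 0 ^ n *\<^sub>C c n) sums c 0"
    proof -
      have "(\<lambda>n. 0 ^ n *\<^sub>C c n) sums (\<Sum>n\<in>{0}. 0 ^ n *\<^sub>C c n)"
        by (rule sums_finite) (auto simp: scaleC.zero_left zero_power)
      then show ?thesis by simp
    qed
    fix e :: real assume e: "e > 0"
    have "\<forall>\<^sub>F n in sequentially. \<forall>x\<in>?S. dist (\<Sum>i<n. u i x) (\<Sum>i. u i x) < e"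
      using ul e by (auto simp: uniform_limit_iff)
    then show "\<forall>\<^sub>F n in sequentially. \<forall>x\<in>?S. \<forall>h. norm ((\<Sum>i<n. h *\<^sub>C u i x) - h *\<^sub>C d x) \<le> e * norm h"
    proof eventually_elim
      case (elim n)
      show ?case
      proof (intro ballI allI)
        fix x h assume x: "x \<in> ?S"
        have "(\<Sum>i<n. h *\<^sub>C u i x) - h *\<^sub>C d x = h *\<^sub>C ((\<Sum>i<n. u i x) - d x)"
          by (simp add: scaleC.sum_right scaleC.diff_right)
        moreover have "norm ((\<Sum>i<n. u i x) - d x) \<le> e"
          using less_imp_le[OF bspec[OF elim x]] dsum[OF x] by (simp add: dist_norm)
        ultimately show "norm ((\<Sum>i<n. h *\<^sub>C u i x) - h *\<^sub>C d x) \<le> e * norm h"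
          by (simp add: mult.commute[of e] mult_left_mono)
      qed
    qed
  qed
  then obtain g where g: "\<And>x. x \<in> ?S \<Longrightarrow> (\<lambda>n. x ^ n *\<^sub>C c n) sums (g x)"
    "\<And>x. x \<in> ?S \<Longrightarrow> (g has_derivative (\<lambda>h. h *\<^sub>C d x)) (at x within ?S)" by blast
  have zS: "z \<in> ?S" using r by simp
  have fg: "f w = g w" if "w \<in> ?S" for w
    using P that r g(1)[OF that] by (auto simp: has_powser_def sums_iff)
  have "(g has_derivative (\<lambda>h. h *\<^sub>C d z)) (at z)"
    using g(2)[OF zS] at_within_open[OF zS] by simp
  then have "(f has_derivative (\<lambda>h. h *\<^sub>C d z)) (at z)"
    by (rule has_derivative_transform_within_open[of _ _ _ _ ?S]) (use zS fg in auto)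
  then show ?thesis by (simp add: has_cderiv_def d_def)
qed

lemma has_powser_cderiv:
  fixes c :: "nat \<Rightarrow> 'a::{complex_normed_vector,banach}"
  assumes P: "has_powser f c R"
  shows "has_powser (cderiv f) (\<lambda>n. of_nat (Suc n) *\<^sub>C c (Suc n)) R"
  unfolding has_powser_def
proof (intro conjI allI impI ballI)
  show "summable (\<lambda>n. norm (of_nat (Suc n) *\<^sub>C c (Suc n)) * r ^ n)" if "0 \<le> r \<and> r < R" for r
    using has_powser_deriv_summable[OF P] that by blast
  show "cderiv f z = (\<Sum>n. z ^ n *\<^sub>C of_nat (Suc n) *\<^sub>C c (Suc n))" if "z \<in> ball 0 R" for z
    by (rule cderiv_eqI[OF has_powser_has_cderiv[OF P that]])
qed

lemma has_powser_cholomorphic_on: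
  fixes c :: "nat \<Rightarrow> 'a::{complex_normed_vector,banach}"
  assumes P: "has_powser f c R" and "S \<subseteq> ball 0 R"
  shows "cholomorphic_on f S"
  unfolding cholomorphic_on_def
proof
  fix z assume "z \<in> S"
  with assms(2) have "z \<in> ball 0 R" by blast
  from has_powser_has_cderiv[OF P this] show "\<exists>d. has_cderiv f d (at z within S)"
    unfolding has_cderiv_def by (blast intro: has_derivative_at_withinI)
qed

text \<open>The induction follows the whole series of the n-th derivative, with coefficients (k +
  n)! / k! times \<open>c (k + n)\<close>; only afterwards is it evaluated at 0, where the term k =
  0 alone survives.\<close>

lemma has_powser_taylor_coeff:
  fixes c :: "nat \<Rightarrow> 'a::{complex_normed_vector,banach}"
  assumes P: "has_powser f c R" and R: "0 < R"
  shows "taylor_coeff f n = c n"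
proof -
  have "has_powser ((cderiv ^^ n) f) (\<lambda>k. (fact (k + n) / fact k) *\<^sub>C c (k + n)) R"
  proof (induction n)
    case 0
    then show ?case using P by simp
  next
    case (Suc n)
    have "of_nat (Suc k) * (fact (Suc k + n) / fact (Suc k)) = (fact (k + Suc n) / fact k :: complex)" for k
      by (simp add: field_simps del: of_nat_Suc)
    then show ?case using has_powser_cderiv[OF Suc.IH] by simp
  qed
  then have "(\<lambda>k. 0 ^ k *\<^sub>C (fact (k + n) / fact k) *\<^sub>C c (k + n)) sums ((cderiv ^^ n) f 0)"
    by (rule has_powser_sums) (use R in simp)
  moreover have "(\<lambda>k. 0 ^ k *\<^sub>C (fact (k + n) / fact k) *\<^sub>C c (k + n)) sums
      (\<Sum>k\<in>{0}. 0 ^ k *\<^sub>C (fact (k + n) / fact k) *\<^sub>C c (k + n))"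
    by (rule sums_finite) (auto simp: scaleC.zero_left zero_power)
  ultimately have "(cderiv ^^ n) f 0 = fact n *\<^sub>C c n" by (simp add: sums_iff)
  then show ?thesis by (simp add: taylor_coeff_def)
qed

lemma has_powser_Dop:
  fixes c :: "nat \<Rightarrow> 'a::{complex_normed_vector,banach}"
  assumes P: "has_powser f c R"
  shows "has_powser (Dop f) (\<lambda>n. of_nat (Suc n) *\<^sub>C c n) R"
  unfolding has_powser_def
proof (intro conjI allI impI ballI)
  fix r assume r: "0 \<le> r \<and> r < R"
  have "summable (\<lambda>n. r * (norm (of_nat (Suc n) *\<^sub>C c (Suc n)) * r ^ n))"
    by (intro summable_mult has_powser_deriv_summable[OF P]) (use r in auto)
  then have "summable (\<lambda>n. norm (of_nat (Suc n) *\<^sub>C c (Suc n)) * r ^ Suc n)" by (simp add: mult_ac)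
  then have "summable (\<lambda>n. norm (of_nat n *\<^sub>C c n) * r ^ n)"
    by (rule summable_Suc_iff[THEN iffD1])
  then have "summable (\<lambda>n. norm (of_nat n *\<^sub>C c n) * r ^ n + norm (c n) * r ^ n)"
    using has_powser_summable[OF P] r by (intro summable_add) auto
  then show "summable (\<lambda>n. norm (of_nat (Suc n) *\<^sub>C c n) * r ^ n)"
    by (simp add: norm_of_nat algebra_simps del: of_nat_Suc) (simp add: algebra_simps)
next
  fix z :: complex assume z: "z \<in> ball 0 R"
  have 1: "(\<lambda>n. z *\<^sub>C z ^ n *\<^sub>C of_nat (Suc n) *\<^sub>C c (Suc n)) sums (z *\<^sub>C cderiv f z)"
    by (rule bounded_linear.sums[OF scaleC.bounded_linear_right])
      (rule has_powser_sums[OF has_powser_cderiv[OF P] z])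
  then have "(\<lambda>n. z ^ Suc n *\<^sub>C of_nat (Suc n) *\<^sub>C c (Suc n)) sums (z *\<^sub>C cderiv f z)"
    by (simp add: mult.assoc)
  then have "(\<lambda>n. z ^ n *\<^sub>C of_nat n *\<^sub>C c n) sums (z *\<^sub>C cderiv f z)"
    by (subst (asm) sums_Suc_iff) (simp add: scaleC.zero_left scaleC.zero_right)
  from sums_add[OF this has_powser_sums[OF P z]]
  have "(\<lambda>n. z ^ n *\<^sub>C of_nat (Suc n) *\<^sub>C c n) sums Dop f z"
    by (simp add: Dop_def scaleC_add_left[symmetric] algebra_simps)
  then show "Dop f z = (\<Sum>n. z ^ n *\<^sub>C of_nat (Suc n) *\<^sub>C c n)" by (simp add: sums_iff)
qed

section \<open>Taylor expansion of vector-valued holomorphic functions\<close>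

lemma has_powser_mono_cong:
  assumes "has_powser g c R'" "R \<le> R'" "\<And>z. z \<in> ball 0 R \<Longrightarrow> f z = g z"
  shows "has_powser f c R"
  using assms by (auto simp: has_powser_def)

text \<open>The coefficients are vector-valued Cauchy integrals. Each functional in \<Lambda>
  reduces their identification, and the value of the series, to the scalar Taylor theorem, and a
  separating family lifts this back to vectors. Leaving \<Lambda> abstract covers Hilbert space
  vectors and operators by one proof.\<close>

lemma cholomorphic_has_powser:
  fixes f :: "complex \<Rightarrow> 'a::{complex_normed_vector,banach}" and \<Lambda> :: "('a \<Rightarrow> complex) set"
  assumes hol: "cholomorphic_on f (ball 0 R)" and R: "0 < R"
    and lin: "\<And>L. L \<in> \<Lambda> \<Longrightarrow> bounded_linear L" "\<And>L c x. L \<in> \<Lambda> \<Longrightarrow> L (c *\<^sub>C x) = c * L x"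
    and separating: "\<And>x y. (\<And>L. L \<in> \<Lambda> \<Longrightarrow> L x = L y) \<Longrightarrow> x = y"
  shows "has_powser f (taylor_coeff f) R"
proof -
  define \<gamma> where "\<gamma> r t = of_real r * exp (2 * of_real pi * \<i> * of_real t)" for r t :: real
  \<comment> \<open>On the circle dz is 2 pi i \<gamma> dt, which cancels the prefactor of Cauchy's
    formula and one power of the denominator; hence the exponent is \<open>n\<close> and not
    \<open>n + 1\<close>.\<close>
  define c where "c r n = integral {0..1} (\<lambda>t. inverse (\<gamma> r t ^ n) *\<^sub>C f (\<gamma> r t))" for r n
  define a where "a L n = (deriv ^^ n) (\<lambda>z. L (f z)) 0 / fact n" for L :: "'a \<Rightarrow> complex" and n
  have circ: "circlepath 0 r = \<gamma> r" for r by (auto simp: circlepath \<gamma>_def)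
  have norm_\<gamma>: "cmod (\<gamma> r t) = \<bar>r\<bar>" for r t by (simp add: \<gamma>_def norm_mult norm_exp_eq_Re)
  have nz: "\<gamma> r t \<noteq> 0" if "0 < r" for r t using norm_\<gamma>[of r t] that by auto
  have der: "\<exists>d. (f has_derivative (\<lambda>h. h *\<^sub>C d)) (at z)" if "z \<in> ball 0 R" for z
  proof -
    obtain d where "has_cderiv f d (at z within ball 0 R)"
      using hol \<open>z \<in> ball 0 R\<close> unfolding cholomorphic_on_def by blast
    then show ?thesis using at_within_open[OF \<open>z \<in> ball 0 R\<close> open_ball] by (auto simp: has_cderiv_def)
  qed
  have contf: "continuous_on (ball 0 R) f"
    by (metis continuous_at_imp_continuous_on der has_derivative_continuous)
  have cont\<gamma>: "continuous_on {0..1} (\<gamma> r)" for r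
    unfolding \<gamma>_def by (intro continuous_intros)
  have cont: "continuous_on {0..1} (\<lambda>t. inverse (\<gamma> r t ^ n) *\<^sub>C f (\<gamma> r t))" if "0 < r" "r < R" for r n
  proof -
    have "continuous_on {0..1} (\<lambda>t. inverse (\<gamma> r t ^ n))"
      by (intro continuous_intros cont\<gamma>) (use nz that in auto)
    moreover have "continuous_on {0..1} (\<lambda>t. f (\<gamma> r t))"
      by (rule continuous_on_compose2[OF contf cont\<gamma>]) (use that norm_\<gamma> in auto)
    ultimately show ?thesis by (rule scaleC.continuous_on)
  qed
  have holL: "(\<lambda>z. L (f z)) holomorphic_on ball 0 R" if "L \<in> \<Lambda>" for L
    unfolding holomorphic_on_def field_differentiable_def has_field_derivative_def
  proof
    fix z assume "z \<in> ball (0::complex) R"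
    then obtain d where d: "(f has_derivative (\<lambda>h. h *\<^sub>C d)) (at z)" using der by blast
    have "((\<lambda>z. L (f z)) has_derivative (\<lambda>h. L (h *\<^sub>C d))) (at z)"
      by (rule bounded_linear.has_derivative[OF lin(1)[OF that] d])
    moreover have "(\<lambda>h. L (h *\<^sub>C d)) = (*) (L d)" by (rule ext) (simp add: lin(2)[OF that])
    ultimately have "((\<lambda>z. L (f z)) has_derivative (*) (L d)) (at z within ball 0 R)"
      by (simp only: has_derivative_at_withinI)
    then show "\<exists>f'. ((\<lambda>z. L (f z)) has_derivative (*) f') (at z within ball 0 R)" by blast
  qed
  have Lc: "L (c r n) = a L n" if L: "L \<in> \<Lambda>" and r: "0 < r" "r < R" for L r n
  proof -
    have sub: "cball 0 r \<subseteq> ball (0::complex) R" using r by auto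
    have "((\<lambda>u. L (f u) / (u - 0) ^ Suc n) has_contour_integral
        2 * pi * \<i> / fact n * (deriv ^^ n) (\<lambda>z. L (f z)) 0) (circlepath 0 r)"
      using r sub by (intro Cauchy_has_contour_integral_higher_derivative_circlepath)
        (auto intro: holomorphic_on_imp_continuous_on holomorphic_on_subset[OF holL[OF L]])
    then have "((\<lambda>t. (2 * pi * \<i>) * (inverse (\<gamma> r t ^ n) * L (f (\<gamma> r t)))) has_integral (2 * pi * \<i>) * a L n) {0..1}"
      unfolding has_contour_integral_def circ[symmetric]
    proof (rule has_integral_eq[rotated, THEN has_integral_eq_rhs])
      fix t :: real assume t: "t \<in> {0..1}"
      show "L (f (circlepath 0 r t)) / (circlepath 0 r t - 0) ^ Suc n *
          vector_derivative (circlepath 0 r) (at t within {0..1}) =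
          2 * pi * \<i> * (inverse (circlepath 0 r t ^ n) * L (f (circlepath 0 r t)))"
        using t nz[OF r(1), of t]
        by (simp add: vector_derivative_circlepath01 circ[symmetric] field_simps) (simp add: circlepath mult_ac)
    qed (simp add: a_def)
    then have "((\<lambda>t. inverse (\<gamma> r t ^ n) * L (f (\<gamma> r t))) has_integral a L n) {0..1}"
      by (rule has_integral_mult_right[where c = "inverse (2 * pi * \<i>)", THEN has_integral_eq[rotated], THEN has_integral_eq_rhs])
        (simp_all add: field_simps)
    moreover have "integral {0..1} (L \<circ> (\<lambda>t. inverse (\<gamma> r t ^ n) *\<^sub>C f (\<gamma> r t))) = L (c r n)"
      unfolding c_def by (intro integral_linear integrable_continuous_real cont r lin(1) L)
    ultimately show ?thesis by (simp add: o_def lin(2)[OF L] integral_unique)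
  qed
  \<comment> \<open>Every functional in \<Lambda> gives the same value \<open>a L n\<close> at all
    radii, so \<open>c r n\<close> does not depend on \<open>r\<close>; the reference radius
    \<open>R / 2\<close> is arbitrary.\<close>
  define C where "C = c (R / 2)"
  have cC: "c r n = C n" if "0 < r" "r < R" for r n
    by (rule separating) (use R in \<open>simp add: C_def Lc that\<close>)
  \<comment> \<open>Cauchy estimate at a radius \<open>r\<close> strictly above \<open>s\<close>:
    the norm of \<open>C n\<close> is at most B / r^n, and s / r < 1 gives a geometric
    majorant.\<close>
  have sm: "summable (\<lambda>n. norm (C n) * s ^ n)" if s: "0 \<le> s" "s < R" for s
  proof -
    obtain r where r: "s < r" "r < R" using dense s by blast
    have r0: "0 < r" using r s by simp
    have "compact (f ` cball 0 r)"
      by (intro compact_continuous_image continuous_on_subset[OF contf]) (use r in auto)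
    then obtain B where B: "\<And>z. z \<in> cball 0 r \<Longrightarrow> norm (f z) \<le> B"
      by (meson bounded_iff compact_imp_bounded imageI)
    have B0: "0 \<le> B" using B[of 0] r0 norm_ge_zero[of "f 0"] by (simp del: norm_ge_zero)
    have le: "norm (C n) \<le> B * inverse (r ^ n)" for n
    proof -
      have "norm (c r n) \<le> B * inverse (r ^ n) * (1 - 0)"
        unfolding c_def
      proof (rule integral_bound)
        fix t
        have "norm (f (\<gamma> r t)) \<le> B" by (rule B) (use norm_\<gamma> r0 in simp)
        then show "norm (inverse (\<gamma> r t ^ n) *\<^sub>C f (\<gamma> r t)) \<le> B * inverse (r ^ n)"
          using r0 mult_right_mono[of "norm (f (\<gamma> r t))" B "inverse (r ^ n)"]
          by (simp add: norm_inverse norm_power norm_\<gamma> mult.commute)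
      qed (use cont r0 r in auto)
      then show ?thesis using cC[OF r0 r(2)] by simp
    qed
    show ?thesis
    proof (rule summable_comparison_test'[of "\<lambda>n. B * (s / r) ^ n"])
      show "summable (\<lambda>n. B * (s / r) ^ n)"
        using s r r0 by (intro summable_mult summable_geometric) simp
      show "norm (norm (C n) * s ^ n) \<le> B * (s / r) ^ n" for n
        using mult_right_mono[OF le[of n], of "s ^ n"] s by (simp add: power_mult_distrib power_inverse divide_inverse mult_ac)
    qed
  qed
  have P: "has_powser f C R"
    unfolding has_powser_def
  proof (intro conjI allI impI ballI)
    show "summable (\<lambda>n. norm (C n) * r ^ n)" if "0 \<le> r \<and> r < R" for r using sm that by blast
    fix z :: complex assume z: "z \<in> ball 0 R"
    have "summable (\<lambda>n. z ^ n *\<^sub>C C n)"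
      using sm[of "cmod z"] z by (intro summable_norm_cancel[of "\<lambda>n. z ^ n *\<^sub>C C n"]) (simp add: norm_power mult.commute)
    then have S: "(\<lambda>n. z ^ n *\<^sub>C C n) sums (\<Sum>n. z ^ n *\<^sub>C C n)" by (rule summable_sums)
    show "f z = (\<Sum>n. z ^ n *\<^sub>C C n)"
    proof (rule separating)
      fix L assume L: "L \<in> \<Lambda>"
      have "(\<lambda>n. a L n * (z - 0) ^ n) sums L (f z)"
        unfolding a_def by (rule holomorphic_power_series[OF holL[OF L] z])
      moreover have "(\<lambda>n. L (z ^ n *\<^sub>C C n)) sums L (\<Sum>n. z ^ n *\<^sub>C C n)"
        by (rule bounded_linear.sums[OF lin(1)[OF L] S])
      moreover have "L (C n) = a L n" for n using Lc[OF L, of "R / 2" n] R by (simp add: C_def)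
      ultimately show "L (f z) = L (\<Sum>n. z ^ n *\<^sub>C C n)"
        by (simp add: lin(2)[OF L] mult.commute sums_iff)
    qed
  qed
  moreover have "taylor_coeff f = C" by (rule ext) (rule has_powser_taylor_coeff[OF P R])
  ultimately show ?thesis by simp
qed

lemma cholomorphic_has_powser_chilbert:
  fixes f :: "complex \<Rightarrow> 'h::chilbert_space"
  assumes "cholomorphic_on f (ball 0 R)" "0 < R"
  shows "has_powser f (taylor_coeff f) R"
proof (rule cholomorphic_has_powser[OF assms, where \<Lambda> = "range (\<lambda>u x. cinner x u)"])
  fix x y :: 'h
  assume "\<And>L. L \<in> range (\<lambda>u x. cinner x u) \<Longrightarrow> L x = L y"
  then have "cinner (x - y) (x - y) = 0" by (auto simp: cinner_diff_left)
  then show "x = y" by (simp add: cinner_self)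
qed (auto intro: cinner.bounded_linear_left)

lemma cholomorphic_has_powser_cblinfun:
  fixes f :: "complex \<Rightarrow> ('a::complex_normed_vector, 'h::chilbert_space) cblinfun"
  assumes "cholomorphic_on f (ball 0 R)" "0 < R"
  shows "has_powser f (taylor_coeff f) R"
proof (rule cholomorphic_has_powser[OF assms, where \<Lambda> = "range (\<lambda>(x, u) T. cinner (T *\<^sub>V x) u)"])
  fix S T :: "('a, 'h) cblinfun"
  assume *: "\<And>L. L \<in> range (\<lambda>(x, u) T. cinner (T *\<^sub>V x) u) \<Longrightarrow> L S = L T"
  show "S = T"
  proof (rule cblinfun_apply_eqI)
    fix x
    have "cinner (S *\<^sub>V x) u = cinner (T *\<^sub>V x) u" for u
      using *[OF rangeI[of "\<lambda>(x, u) T. cinner (T *\<^sub>V x) u" "(x, u)"]] by simp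
    then have "cinner (S *\<^sub>V x - T *\<^sub>V x) (S *\<^sub>V x - T *\<^sub>V x) = 0"
      by (simp add: cinner_diff_left)
    then show "S *\<^sub>V x = T *\<^sub>V x" by (simp add: cinner_self)
  qed
next
  fix L :: "('a, 'h) cblinfun \<Rightarrow> complex"
  assume "L \<in> range (\<lambda>(x, u) T. cinner (T *\<^sub>V x) u)"
  then obtain x u where L: "L = (\<lambda>T. cinner (T *\<^sub>V x) u)" by auto
  show "bounded_linear L"
    unfolding L by (rule bounded_linear_compose[OF cinner.bounded_linear_left cblinfun.bounded_linear_left])
  show "L (c *\<^sub>C T) = c * L T" for c T by (simp add: L cblinfun_apply_scaleC)
qed

text \<open>The coefficients are read off from \<open>f\<close>, the decay comes from its extension;
  both have the same expansion on the unit disc. This decay later makes the inner sums of the Hankel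
  operator converge.\<close>

lemma Oext_summable:
  fixes f :: "complex \<Rightarrow> 'h::chilbert_space"
  assumes "f \<in> Oext"
  shows "\<exists>R>1. summable (\<lambda>n. norm (taylor_coeff f n) * R ^ n)"
proof -
  obtain R g where R: "R > 1" and g: "cholomorphic_on g (ball 0 R)" "\<forall>z\<in>ball 0 1. g z = f z"
    using assms by (auto simp: Oext_def)
  have pg: "has_powser g (taylor_coeff g) R"
    by (rule cholomorphic_has_powser_chilbert[OF g(1)]) (use R in simp)
  have "has_powser f (taylor_coeff g) 1"
    by (rule has_powser_mono_cong[OF pg]) (use R g in auto)
  then have "taylor_coeff f = taylor_coeff g" by (intro ext has_powser_taylor_coeff[of f _ 1]) auto
  moreover obtain r where "1 < r" "r < R" using dense R by blast
  ultimately show ?thesis using has_powser_summable[OF pg, of r] by auto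
qed

section \<open>Moments of the disc\<close>

lemma distr_lborel_shear_fst:
  "distr lborel borel (\<lambda>(x::real, y::real). (x + a * y, y)) = lborel"
proof (rule measure_eqI)
  fix A :: "(real \<times> real) set"
  assume "A \<in> sets (distr lborel borel (\<lambda>(x, y). (x + a * y, y)))"
  then have Ab: "A \<in> sets borel" by simp
  then have A: "A \<in> sets (borel \<Otimes>\<^sub>M borel)" by (simp only: borel_prod)
  have m: "(\<lambda>(x, y). (x + a * y, y)) \<in> lborel \<rightarrow>\<^sub>M borel"
    unfolding borel_prod[symmetric] lborel_prod[symmetric] by measurable
  have "emeasure (distr lborel borel (\<lambda>(x, y). (x + a * y, y))) A
      = (\<integral>\<^sup>+p. indicator A p \<partial>distr lborel borel (\<lambda>(x, y). (x + a * y, y)))"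
    using Ab by simp
  also have "\<dots> = (\<integral>\<^sup>+p. indicator A (fst p + a * snd p, snd p) \<partial>lborel)"
    using Ab by (subst nn_integral_distr[OF m]) (auto simp: split_beta')
  also have "\<dots> = (\<integral>\<^sup>+p. indicator A (fst p + a * snd p, snd p) \<partial>(lborel \<Otimes>\<^sub>M lborel))"
    by (simp only: lborel_prod)
  also have "\<dots> = (\<integral>\<^sup>+y. \<integral>\<^sup>+x. indicator A (x + a * y, y) \<partial>lborel \<partial>lborel)"
    using A by (subst lborel_pair.nn_integral_snd[symmetric]) (auto simp: split_beta')
  \<comment> \<open>For fixed \<open>y\<close> the shear is a translation in
    \<open>x\<close>.\<close>
  also have "\<dots> = (\<integral>\<^sup>+y. \<integral>\<^sup>+x. indicator A (x, y) \<partial>lborel \<partial>lborel)"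
  proof (rule nn_integral_cong)
    fix y
    have "(\<lambda>x. indicator A (x, y)) \<in> borel_measurable borel" using A by measurable
    from nn_integral_real_affine[OF this, of 1 "a * y"]
    show "(\<integral>\<^sup>+x. indicator A (x + a * y, y) \<partial>lborel) = (\<integral>\<^sup>+x. indicator A (x, y) \<partial>lborel)"
      by (simp add: add.commute)
  qed
  also have "\<dots> = (\<integral>\<^sup>+p. indicator A p \<partial>(lborel \<Otimes>\<^sub>M lborel))"
    using A by (subst lborel_pair.nn_integral_snd[symmetric]) auto
  also have "\<dots> = emeasure lborel A" using Ab by (simp add: lborel_prod)
  finally show "emeasure (distr lborel borel (\<lambda>(x, y). (x + a * y, y))) A = emeasure lborel A" .
qed simp

lemma distr_lborel_swap: "distr lborel borel prod.swap = (lborel :: (real \<times> real) measure)"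
proof -
  have "distr (lborel \<Otimes>\<^sub>M lborel) (lborel \<Otimes>\<^sub>M lborel) (\<lambda>(x, y). (y, x)) = (lborel \<Otimes>\<^sub>M lborel :: (real \<times> real) measure)"
    by (rule lborel_pair.distr_pair_swap[symmetric])
  then have "distr lborel lborel (\<lambda>(x, y). (y, x)) = (lborel :: (real \<times> real) measure)" by (simp add: lborel_prod)
  moreover have "distr lborel lborel (\<lambda>(x, y). (y, x)) = distr lborel borel (prod.swap :: real \<times> real \<Rightarrow> _)"
    by (rule distr_cong) auto
  ultimately show ?thesis by simp
qed

text \<open>This carries measure-preserving maps of the real plane over to the complex plane;
  agreement on boxes identifies the measure.\<close>

lemma distr_lborel_Complex:
  "distr lborel borel (\<lambda>(x, y). Complex x y) = lborel"
proof (rule lborel_eqI[symmetric])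
  have m: "(\<lambda>(x, y). Complex x y) \<in> borel \<rightarrow>\<^sub>M borel"
    by (rule borel_measurable_continuous_onI) (auto simp: split_beta' Complex_eq intro!: continuous_intros)
  fix l u :: complex
  assume le: "\<And>b. b \<in> Basis \<Longrightarrow> l \<bullet> b \<le> u \<bullet> b"
  have "(\<lambda>(x, y). Complex x y) -` box l u = box (Re l, Im l) (Re u, Im u)"
    by (auto simp: box_def Basis_complex_def Basis_prod_def)
  then have "emeasure (distr lborel borel (\<lambda>(x, y). Complex x y)) (box l u) = emeasure lborel (box (Re l, Im l) (Re u, Im u))"
    using m by (subst emeasure_distr) auto
  also have "\<dots> = ennreal ((Re u - Re l) * (Im u - Im l))"
    using le[of 1] le[of \<i>] by (subst emeasure_lborel_box)
      (auto simp: Basis_complex_def Basis_prod_def)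
  also have "\<dots> = (\<Prod>b\<in>Basis. (u - l) \<bullet> b)"
    by (simp add: Basis_complex_def)
  finally show "emeasure (distr lborel borel (\<lambda>(x, y). Complex x y)) (box l u) = ennreal (\<Prod>b\<in>Basis. (u - l) \<bullet> b)" .
qed simp

text \<open>A rotation is a product of three shears.\<close>

lemma distr_lborel_rotation:
  assumes "0 < \<theta>" "\<theta> < pi"
  shows "distr lborel borel (\<lambda>z. cis \<theta> * z) = lborel"
proof -
  define S where "S a = (\<lambda>(x::real, y::real). (x + a * y, y))" for a
  define s where "s = sin \<theta>"
  \<comment> \<open>\<open>a\<close> is -tan (\<theta> / 2), the coefficient of the two outer
    shears. Conjugating \<open>S s\<close> by the swap gives the middle shear, in the other
    coordinate; the range of \<theta> keeps \<open>s\<close> nonzero.\<close>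
  define a where "a = (cos \<theta> - 1) / s"
  have s: "s \<noteq> 0" using sin_gt_zero[OF assms] by (simp add: s_def)
  have cs: "cos \<theta> * cos \<theta> = 1 - s * s"
    using cos_squared_eq[of \<theta>] by (simp add: s_def power2_eq_square)
  let ?C = "\<lambda>(x, y). Complex x y"
  let ?R = "?C \<circ> S a \<circ> prod.swap \<circ> S s \<circ> prod.swap \<circ> S a"
  have mS [measurable]: "S a \<in> borel \<rightarrow>\<^sub>M borel" for a
    unfolding S_def by (rule borel_measurable_continuous_onI) (auto simp: split_beta' intro!: continuous_intros)
  have mC [measurable]: "?C \<in> borel \<rightarrow>\<^sub>M borel"
    by (rule borel_measurable_continuous_onI) (auto simp: split_beta' Complex_eq intro!: continuous_intros)
  have msw [measurable]: "(prod.swap :: real \<times> real \<Rightarrow> _) \<in> borel \<rightarrow>\<^sub>M borel"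
    by (rule borel_measurable_continuous_onI) (auto simp: prod.swap_def intro!: continuous_intros)
  have dS: "distr lborel borel (S a) = lborel" for a
    unfolding S_def by (rule distr_lborel_shear_fst)
  have step: "distr lborel borel (f \<circ> g) = distr lborel borel f"
    if [measurable]: "f \<in> borel \<rightarrow>\<^sub>M borel" "g \<in> borel \<rightarrow>\<^sub>M borel" and "distr lborel borel g = lborel"
    for f :: "real \<times> real \<Rightarrow> complex" and g :: "real \<times> real \<Rightarrow> real \<times> real"
    using distr_distr[of f borel borel g lborel] that by simp
  have "distr lborel borel ?R = lborel"
    by (subst step, measurable, simp add: dS distr_lborel_swap)+ (rule distr_lborel_Complex)
  moreover have "?R = (\<lambda>z. cis \<theta> * z) \<circ> ?C"
  proof (rule ext)
    fix p :: "real \<times> real"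
    obtain x y where p: "p = (x, y)" by (cases p)
    have as: "a * s = cos \<theta> - 1" using s by (simp add: a_def)
    have a2:  "a * (2 + a * s) = - s"
    proof -
      have "s * (a * (2 + a * s)) = (a * s) * (2 + a * s)" by simp
      also have "\<dots> = s * - s"
        unfolding as using cs by (simp add: algebra_simps)
      finally show ?thesis using s by (simp only: mult_cancel_left) simp
    qed
    have "x + a * y + a * (y + s * (x + a * y)) = (1 + a * s) * x + a * (2 + a * s) * y"
      by (simp add: algebra_simps)
    moreover have "y + s * (x + a * y) = (1 + a * s) * y + s * x" by (simp add: algebra_simps)
    ultimately show "?R p = ((\<lambda>z. cis \<theta> * z) \<circ> ?C) p"
      unfolding p by (simp add: S_def complex_eq_iff s_def[symmetric] as a2[unfolded as, simplified])
  qed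
  ultimately have "distr lborel borel ((\<lambda>z. cis \<theta> * z) \<circ> ?C) = lborel" by simp
  moreover have "distr lborel borel ((\<lambda>z. cis \<theta> * z) \<circ> ?C) = distr (distr lborel borel ?C) borel (\<lambda>z. cis \<theta> * z)"
    by (subst distr_distr) auto
  ultimately show ?thesis by (simp add: distr_lborel_Complex)
qed

text \<open>The integral of |z|^(2k) (1 - |z|^2) over the disc of radius \<open>r\<close>, evaluated
  in the variable |z|^2; at \<open>r = 1\<close> it is pi / ((k + 1) (k + 2)).\<close>

definition disc_moment :: "real \<Rightarrow> nat \<Rightarrow> real" where
  "disc_moment r k = pi * (r\<^sup>2 ^ Suc k / real (Suc k) - r\<^sup>2 ^ Suc (Suc k) / real (Suc (Suc k)))"

text \<open>A substitute for polar coordinates: a disc of squared radius s has area pi s, so area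
  becomes a multiple of length in the variable |z|^2. It suffices to compare the measures of rays,
  whose preimages in the nontrivial case are annuli.\<close>

lemma distr_cball_norm_power2:
  assumes r: "0 \<le> r"
  shows "distr (restrict_space lborel (cball 0 r :: complex set)) borel (\<lambda>z. (cmod z)\<^sup>2)
    = density lborel (\<lambda>s. ennreal pi * indicator {0..r\<^sup>2} s)" (is "?M = ?N")
proof (rule measure_eqI_lessThan)
  fix x :: real
  let ?A = "{z \<in> cball 0 r. x < (cmod z)\<^sup>2}"
  have vol: "emeasure lborel (cball 0 t :: complex set) = ennreal (pi * t\<^sup>2)" if "0 \<le> t" for t
    using that by (simp add: emeasure_cball unit_ball_vol_2)
  have "emeasure ?M {x<..} = emeasure (restrict_space lborel (cball 0 r)) ?A"
    by (subst emeasure_distr) (auto simp: space_restrict_space intro!: arg_cong[of _ _ "emeasure _"] measurable_restrict_space1)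
  also have "\<dots> = emeasure lborel ?A"
    by (intro emeasure_restrict_space) auto
  finally have M: "emeasure ?M {x<..} = emeasure lborel ?A" .
  have N: "emeasure ?N {x<..} = ennreal pi * emeasure lborel ({0..r\<^sup>2} \<inter> {x<..})"
    by (subst emeasure_density) (auto simp: mult.assoc indicator_inter_arith[symmetric] nn_integral_cmult)
  show "emeasure ?M {x<..} = emeasure ?N {x<..}"
  proof -
    consider "x < 0" | "0 \<le> x" "x \<le> r\<^sup>2" | "r\<^sup>2 < x" by linarith
    then show ?thesis
    proof cases
      case 1
      then have "x < (cmod z)\<^sup>2" for z using zero_le_power2[of "cmod z"] by linarith
      then have "?A = cball 0 r" "{0..r\<^sup>2} \<inter> {x<..} = {0..r\<^sup>2}"
        using 1 by auto
      then show ?thesis unfolding M N by (simp add: vol r ennreal_mult)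
    next
      case 2
      have le: "sqrt x \<le> r" using 2 r real_le_lsqrt by blast
      have "?A = cball 0 r - cball 0 (sqrt x)"
      proof -
        have "x < (cmod z)\<^sup>2 \<longleftrightarrow> \<not> cmod z \<le> sqrt x" for z
          using real_sqrt_less_iff[of x "(cmod z)\<^sup>2"] by (simp only: real_sqrt_abs abs_norm_cancel not_le)
        then have "?A = {z. cmod z \<le> r} - {z. cmod z \<le> sqrt x}" by (simp only: mem_cball_0) blast
        then show ?thesis by (simp add: cball_def)
      qed
      moreover have "emeasure lborel (cball 0 r - cball 0 (sqrt x) :: complex set) = ennreal (pi * r\<^sup>2) - ennreal (pi * (sqrt x)\<^sup>2)"
        using le 2 by (subst emeasure_Diff) (auto simp: vol r)
      moreover have "{0..r\<^sup>2} \<inter> {x<..} = {x<..r\<^sup>2}" using 2 by auto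
      moreover have "ennreal (pi * r\<^sup>2) - ennreal (pi * (sqrt x)\<^sup>2) = ennreal pi * ennreal (r\<^sup>2 - x)"
        using 2 by (simp add: ennreal_minus ennreal_mult'[symmetric] right_diff_distrib)
      ultimately show ?thesis unfolding M N using 2 by simp
    next
      case 3
      have "?A = {}"
      proof -
        have "(cmod z)\<^sup>2 \<le> r\<^sup>2" if "cmod z \<le> r" for z using that by (intro power_mono) auto
        with 3 show ?thesis by force
      qed
      moreover have "{0..r\<^sup>2} \<inter> {x<..} = {}" using 3 by auto
      ultimately show ?thesis unfolding M N by (simp only: emeasure_empty mult_zero_right)
    qed
  qed
  have "emeasure lborel ?A \<le> emeasure lborel (cball 0 r :: complex set)"
    by (intro emeasure_mono) auto
  then show "emeasure ?M {x<..} < \<infinity>" unfolding M using vol[OF r] by (simp add: le_less_trans)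
qed auto

lemma disc_moment_integral:
  assumes r: "0 \<le> r"
  shows "(LINT z:cball 0 r|lborel. ((cmod z)\<^sup>2) ^ k * (1 - (cmod z)\<^sup>2)) = disc_moment r k"
proof -
  define F where "F s = s ^ Suc k / real (Suc k) - s ^ Suc (Suc k) / real (Suc (Suc k))" for s :: real
  have F: "DERIV F s :> s ^ k * (1 - s)" for s
  proof -
    have D: "DERIV (\<lambda>s. s ^ Suc n / real (Suc n)) s :> s ^ n" for n
      using DERIV_cdivide[OF DERIV_pow[of "Suc n" s UNIV], of "real (Suc n)"] by (simp del: of_nat_Suc)
    show ?thesis
      unfolding F_def using DERIV_diff[OF D[of k] D[of "Suc k"]] by (simp add: algebra_simps)
  qed
  have "(LINT z:cball 0 r|lborel. ((cmod z)\<^sup>2) ^ k * (1 - (cmod z)\<^sup>2)) =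
      (LINT z|restrict_space lborel (cball 0 r). ((cmod z)\<^sup>2) ^ k * (1 - (cmod z)\<^sup>2))"
    unfolding set_lebesgue_integral_def by (subst integral_restrict_space) auto
  also have "\<dots> = (LINT s|density lborel (\<lambda>s. ennreal pi * indicator {0..r\<^sup>2} s). s ^ k * (1 - s))"
    unfolding distr_cball_norm_power2[OF r, symmetric]
    by (subst integral_distr) (auto intro!: measurable_restrict_space1)
  also have "(\<lambda>s. ennreal pi * indicator {0..r\<^sup>2} s) = (\<lambda>s. ennreal (pi * indicator {0..r\<^sup>2} s))"
    by (auto split: split_indicator)
  also have "(LINT s|density lborel (\<lambda>s. ennreal (pi * indicator {0..r\<^sup>2} s)). s ^ k * (1 - s)) =
      (LINT s|lborel. pi * indicator {0..r\<^sup>2} s * (s ^ k * (1 - s)))"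
    by (subst integral_real_density) auto
  also have "\<dots> = pi * (LINT s|lborel. s ^ k * (1 - s) * indicator {0..r\<^sup>2} s)"
    by (simp add: mult_ac)
  also have "(LINT s|lborel. s ^ k * (1 - s) * indicator {0..r\<^sup>2} s) = F (r\<^sup>2) - F 0"
    by (intro integral_FTC_Icc_real F) auto
  finally show ?thesis by (simp add: F_def disc_moment_def)
qed

text \<open>For \<open>k = l\<close> only |z| enters. Otherwise a rotation multiplies the integrand
  by a unimodular constant other than 1 while leaving the integral unchanged, so the integral is
  0.\<close>

lemma disc_monomial_integral:
  assumes r: "0 \<le> r"
  shows "(LINT z:cball 0 r|lborel. z ^ k * cnj z ^ l * of_real (1 - (cmod z)\<^sup>2)) = (if k = l then of_real (disc_moment r k) else 0)"
proof (cases "k = l")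
  case True
  have "z ^ k * cnj z ^ k * of_real (1 - (cmod z)\<^sup>2) = of_real (((cmod z)\<^sup>2) ^ k * (1 - (cmod z)\<^sup>2))" for z
    by (simp add: power_mult_distrib[symmetric] complex_norm_square[symmetric])
  then show ?thesis
    using True disc_moment_integral[OF r, of k] by (simp only: set_integral_complex_of_real simp_thms if_True)
next
  case False
  define g where "g z = indicat_real (cball 0 r) z *\<^sub>R (z ^ k * cnj z ^ l * of_real (1 - (cmod z)\<^sup>2))" for z
  define d where "d = real k - real l"
  \<comment> \<open>This angle makes \<open>cis (d * \<theta>)\<close> equal to i or -i; it lies
    below pi because |d| is at least 1.\<close>
  define \<theta> where "\<theta> = pi / (2 * \<bar>d\<bar>)"
  have d: "1 \<le> \<bar>d\<bar>" using False by (auto simp: d_def)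
  have \<theta>: "0 < \<theta>" "\<theta> < pi" using d by (auto simp: \<theta>_def field_simps)
  have "g (cis \<theta> * z) = cis (d * \<theta>) * g z" for z
  proof -
    have "cis \<theta> ^ k * cnj (cis \<theta>) ^ l = cis (d * \<theta>)"
      unfolding cis_cnj Complex.DeMoivre cis_mult d_def by (simp add: algebra_simps)
    then have "(cis \<theta> * z) ^ k * cnj (cis \<theta> * z) ^ l = cis (d * \<theta>) * (z ^ k * cnj z ^ l)"
      by (simp add: power_mult_distrib mult_ac)
    moreover have "indicat_real (cball 0 r) (cis \<theta> * z) = indicat_real (cball 0 r) z"
      by (auto simp: norm_mult split: split_indicator)
    ultimately show ?thesis by (simp add: g_def norm_mult mult.assoc)
  qed
  have "integral\<^sup>L lborel g = integral\<^sup>L (distr lborel borel (\<lambda>z. cis \<theta> * z)) g"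
    by (simp add: distr_lborel_rotation \<theta>)
  also have "\<dots> = (LINT z|lborel. g (cis \<theta> * z))"
  proof (rule integral_distr)
    have "(\<lambda>z. z ^ k * cnj z ^ l * of_real (1 - (cmod z)\<^sup>2)) \<in> borel_measurable borel"
      by (intro borel_measurable_continuous_onI continuous_intros)
    then show "g \<in> borel_measurable borel" unfolding g_def[abs_def] by (intro borel_measurable_scaleR borel_measurable_indicator) auto
  qed simp
  also have "\<dots> = cis (d * \<theta>) * integral\<^sup>L lborel g"
    by (simp add: \<open>\<And>z. g (cis \<theta> * z) = cis (d * \<theta>) * g z\<close>)
  finally have "integral\<^sup>L lborel g = 0 \<or> cis (d * \<theta>) = 1" by simp
  moreover have "Re (cis (d * \<theta>)) = 0"
    using d by (cases "0 \<le> d") (auto simp: \<theta>_def)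
  then have "cis (d * \<theta>) \<noteq> 1" by (metis one_complex.sel(1) zero_neq_one)
  ultimately have "integral\<^sup>L lborel g = 0" by blast
  then show ?thesis using False unfolding set_lebesgue_integral_def g_def[abs_def] by simp
qed

section \<open>The Hilbert matrix\<close>

text \<open>For nonzero \<open>n\<close> this is integration by parts. For \<open>n = 0\<close> both
  sides vanish because \<open>inverse 0 = 0\<close>, which is also how the Hilbert matrix gets its
  zero diagonal.\<close>

lemma has_integral_sin_sawtooth:
  "((\<lambda>t. (pi - t) * sin (of_int n * t)) has_integral 2 * pi * inverse (of_int n)) {0..2 * pi}"
proof (cases "n = 0")
  case False
  define F where "F t = - (pi - t) * cos (of_int n * t) / of_int n - sin (of_int n * t) / (of_int n)\<^sup>2" for t :: real
  have "((\<lambda>t. (pi - t) * sin (of_int n * t)) has_integral F (2 * pi) - F 0) {0..2 * pi}"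
  proof (rule fundamental_theorem_of_calculus)
    fix t
    show "(F has_vector_derivative (pi - t) * sin (of_int n * t)) (at t within {0..2 * pi})"
      unfolding F_def has_real_derivative_iff_has_vector_derivative[symmetric] using False
      by (auto intro!: derivative_eq_intros simp: field_simps power2_eq_square)
  qed simp
  moreover have "F (2 * pi) - F 0 = 2 * pi * inverse (of_int n)"
    using cos_int_2pin[of n] sin_int_2pin[of n] False by (simp add: F_def field_simps)
  ultimately show ?thesis by simp
qed simp

lemma has_integral_cos_int:
  "((\<lambda>t. cos (of_int n * t)) has_integral (if n = 0 then 2 * pi else 0)) {0..2 * pi}"
proof (cases "n = 0")
  case True
  then show ?thesis using has_integral_const_real[of "1::real" 0 "2 * pi"] by simp
next
  case False
  have "((\<lambda>t. cos (of_int n * t)) has_integral sin (of_int n * (2 * pi)) / of_int n - sin (of_int n * 0) / of_int n) {0..2 * pi}"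
  proof (rule fundamental_theorem_of_calculus)
    fix t
    show "((\<lambda>t. sin (of_int n * t) / of_int n) has_vector_derivative cos (of_int n * t)) (at t within {0..2 * pi})"
      unfolding has_real_derivative_iff_has_vector_derivative[symmetric] using False
      by (auto intro!: derivative_eq_intros)
  qed simp
  then show ?thesis using False sin_int_2pin[of n] by (simp add: mult.commute)
qed

text \<open>Parseval for the trigonometric polynomial with coefficients \<open>x j\<close>, split
  into real and imaginary parts: expanding the squared modulus leaves cosines of the differences i -
  j.\<close>

lemma has_integral_trig_poly_square:
  fixes x :: "nat \<Rightarrow> real"
  shows "((\<lambda>t. (\<Sum>j<I. x j * cos (real j * t))\<^sup>2 + (\<Sum>j<I. x j * sin (real j * t))\<^sup>2)
    has_integral 2 * pi * (\<Sum>j<I. (x j)\<^sup>2)) {0..2 * pi}"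
proof -
  have "((\<lambda>t. \<Sum>i<I. \<Sum>j<I. x i * x j * cos (of_int (int i - int j) * t)) has_integral
      (\<Sum>i<I. \<Sum>j<I. x i * x j * (if int i - int j = 0 then 2 * pi else 0))) {0..2 * pi}"
    by (intro has_integral_sum has_integral_mult_right has_integral_cos_int) auto
  moreover have "(\<Sum>i<I. \<Sum>j<I. x i * x j * (if int i - int j = 0 then 2 * pi else 0)) = 2 * pi * (\<Sum>j<I. (x j)\<^sup>2)"
    by (simp add: if_distrib[of "\<lambda>a. _ * a"] sum_distrib_left power2_eq_square mult_ac cong: if_cong)
  moreover have "(\<Sum>i<I. \<Sum>j<I. x i * x j * cos (of_int (int i - int j) * t)) =
      (\<Sum>j<I. x j * cos (real j * t))\<^sup>2 + (\<Sum>j<I. x j * sin (real j * t))\<^sup>2" for t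
  proof -
    have eq: "of_int (int i - int j) * t = real i * t - real j * t" for i j
      by (simp add: left_diff_distrib)
    show ?thesis
      unfolding eq by (simp add: cos_diff distrib_left sum.distrib power2_eq_square sum_product mult_ac)
  qed
  ultimately show ?thesis by simp
qed

text \<open>The entries \<open>1 / (i - j)\<close> are the Fourier coefficients of a sawtooth bounded by \<open>pi\<close>.\<close>

lemma hilbert_matrix_form_le:
  fixes x y :: "nat \<Rightarrow> real"
  shows "(\<Sum>i<I. \<Sum>j<I. y i * x j * inverse (real i - real j)) \<le> pi / 2 * ((\<Sum>j<I. (x j)\<^sup>2) + (\<Sum>j<I. (y j)\<^sup>2))"
proof -
  let ?P = "\<lambda>x t. \<Sum>j<I. x j * cos (real j * t)" and ?Q = "\<lambda>x t. \<Sum>j<I. x j * sin (real j * t)"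
  have "((\<lambda>t. \<Sum>i<I. \<Sum>j<I. y i * x j * ((pi - t) * sin (of_int (int i - int j) * t))) has_integral
      (\<Sum>i<I. \<Sum>j<I. y i * x j * (2 * pi * inverse (of_int (int i - int j))))) {0..2 * pi}"
    by (intro has_integral_sum has_integral_mult_right has_integral_sin_sawtooth) auto
  moreover have "(\<Sum>i<I. \<Sum>j<I. y i * x j * ((pi - t) * sin (of_int (int i - int j) * t))) =
      (pi - t) * (?Q y t * ?P x t - ?P y t * ?Q x t)" for t
  proof -
    have eq: "of_int (int i - int j) * t = real i * t - real j * t" for i j
      by (simp add: left_diff_distrib)
    have "(\<Sum>i<I. \<Sum>j<I. y i * x j * ((pi - t) * sin (of_int (int i - int j) * t))) =
      (pi - t) * (\<Sum>i<I. \<Sum>j<I. y i * x j * sin (real i * t - real j * t))"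
      unfolding eq by (simp add: sum_distrib_left mult.assoc mult.left_commute)
    also have "(\<Sum>i<I. \<Sum>j<I. y i * x j * sin (real i * t - real j * t)) =
      ?Q y t * ?P x t - ?P y t * ?Q x t"
      unfolding sum_product sum_subtractf[symmetric]
      by (simp add: sin_diff right_diff_distrib mult_ac)
    finally show ?thesis .
  qed
  ultimately have 1: "((\<lambda>t. (pi - t) * (?Q y t * ?P x t - ?P y t * ?Q x t)) has_integral
      2 * pi * (\<Sum>i<I. \<Sum>j<I. y i * x j * inverse (real i - real j))) {0..2 * pi}"
    by (simp add: sum_distrib_left mult_ac)
  have 2: "((\<lambda>t. pi / 2 * (((?P x t)\<^sup>2 + (?Q x t)\<^sup>2) + ((?P y t)\<^sup>2 + (?Q y t)\<^sup>2))) has_integral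
      pi / 2 * (2 * pi * (\<Sum>j<I. (x j)\<^sup>2) + 2 * pi * (\<Sum>j<I. (y j)\<^sup>2))) {0..2 * pi}"
    by (intro has_integral_mult_right has_integral_add has_integral_trig_poly_square)
  have "2 * pi * (\<Sum>i<I. \<Sum>j<I. y i * x j * inverse (real i - real j)) \<le>
      pi / 2 * (2 * pi * (\<Sum>j<I. (x j)\<^sup>2) + 2 * pi * (\<Sum>j<I. (y j)\<^sup>2))"
  proof (rule has_integral_le[OF 1 2])
    fix t :: real assume t: "t \<in> {0..2 * pi}"
    \<comment> \<open>If p + iq and r + is are the values of the polynomials of \<open>x\<close> and
      \<open>y\<close>, then \<open>s * p - r * q\<close> is the imaginary part of the second times
      the conjugate of the first. Half the sum of squares bounds it in a form that Parseval can
      integrate.\<close>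
    have ineq: "\<bar>s * p - r * q\<bar> \<le> ((p\<^sup>2 + q\<^sup>2) + (r\<^sup>2 + s\<^sup>2)) / 2" for p q r s :: real
    proof -
      have le: "\<bar>a * b\<bar> \<le> (a\<^sup>2 + b\<^sup>2) / 2" for a b :: real
        using sum_squares_bound[of a b] sum_squares_bound[of "- a" b] by (simp add: abs_le_iff)
      show ?thesis
        using abs_triangle_ineq4[of "s * p" "r * q"] le[of s p] le[of r q]
        by (simp add: add_divide_distrib)
    qed
    have "(pi - t) * (?Q y t * ?P x t - ?P y t * ?Q x t) \<le> \<bar>pi - t\<bar> * \<bar>?Q y t * ?P x t - ?P y t * ?Q x t\<bar>"
      unfolding abs_mult[symmetric] by (rule abs_ge_self)
    also have "\<dots> \<le> pi * ((((?P x t)\<^sup>2 + (?Q x t)\<^sup>2) + ((?P y t)\<^sup>2 + (?Q y t)\<^sup>2)) / 2)"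
      by (rule mult_mono[OF _ ineq]) (use t in auto)
    finally show "(pi - t) * (?Q y t * ?P x t - ?P y t * ?Q x t)
      \<le> pi / 2 * (((?P x t)\<^sup>2 + (?Q x t)\<^sup>2) + ((?P y t)\<^sup>2 + (?Q y t)\<^sup>2))" by simp
  qed
  moreover have "L \<le> pi / 2 * (a + b)" if "2 * pi * L \<le> pi / 2 * (2 * pi * a + 2 * pi * b)" for L a b :: real
  proof -
    have "2 * pi * L \<le> 2 * pi * (pi / 2 * (a + b))" using that by (simp add: distrib_left mult_ac)
    then show ?thesis by (rule mult_left_le_imp_le) simp
  qed
  ultimately show ?thesis by blast
qed

text \<open>Test the bilinear form against the image of \<open>x\<close> divided by pi. At this
  scale half of the left side is absorbed, and what remains is the operator norm bound pi.\<close>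

lemma hilbert_matrix_bound_real:
  fixes x :: "nat \<Rightarrow> real"
  shows "(\<Sum>i<I. (\<Sum>j<I. inverse (real i - real j) * x j)\<^sup>2) \<le> pi\<^sup>2 * (\<Sum>j<I. (x j)\<^sup>2)"
proof -
  define y where "y i = (\<Sum>j<I. inverse (real i - real j) * x j)" for i
  define Y where "Y = (\<Sum>i<I. (y i)\<^sup>2)"
  have "(\<Sum>i<I. \<Sum>j<I. (y i / pi) * x j * inverse (real i - real j)) = Y / pi"
    by (simp add: Y_def y_def sum_divide_distrib power2_eq_square sum_distrib_left mult_ac)
  moreover have "(\<Sum>j<I. (y j / pi)\<^sup>2) = Y / pi\<^sup>2"
    by (simp add: Y_def sum_divide_distrib power_divide)
  ultimately have "Y / pi \<le> pi / 2 * ((\<Sum>j<I. (x j)\<^sup>2) + Y / pi\<^sup>2)"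
    using hilbert_matrix_form_le[of "\<lambda>i. y i / pi" x I] by simp
  then have "Y \<le> pi\<^sup>2 * (\<Sum>j<I. (x j)\<^sup>2)"
    by (simp add: field_simps power2_eq_square)
  then show ?thesis by (simp add: Y_def y_def)
qed

lemma hilbert_matrix_bound:
  fixes x :: "nat \<Rightarrow> complex"
  shows "(\<Sum>i<I. (cmod (\<Sum>j<I. of_real (inverse (real i - real j)) * x j))\<^sup>2) \<le> pi\<^sup>2 * (\<Sum>j<I. (cmod (x j))\<^sup>2)"
proof -
  have "(\<Sum>i<I. (cmod (\<Sum>j<I. of_real (inverse (real i - real j)) * x j))\<^sup>2) =
     (\<Sum>i<I. (\<Sum>j<I. inverse (real i - real j) * Re (x j))\<^sup>2) + (\<Sum>i<I. (\<Sum>j<I. inverse (real i - real j) * Im (x j))\<^sup>2)"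
    by (simp add: cmod_power2 sum.distrib del: of_real_inverse of_real_diff)
  also have "\<dots> \<le> pi\<^sup>2 * (\<Sum>j<I. (Re (x j))\<^sup>2) + pi\<^sup>2 * (\<Sum>j<I. (Im (x j))\<^sup>2)"
    by (intro add_mono hilbert_matrix_bound_real)
  finally show ?thesis by (simp add: cmod_power2 sum.distrib distrib_left)
qed

section \<open>Pairings over the disc\<close>

abbreviation (input) disc_weight :: "complex \<Rightarrow> real" where
  "disc_weight z \<equiv> 1 - (cmod z)\<^sup>2"

lemma continuous_set_integrable_cball:
  fixes f :: "complex \<Rightarrow> 'b::{banach,second_countable_topology}"
  assumes "continuous_on (cball 0 r) f"
  shows "set_integrable lborel (cball 0 r) f"
  unfolding set_integrable_def by (rule borel_integrable_compact[OF compact_cball assms])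

lemma
  fixes f :: "'i \<Rightarrow> 'a \<Rightarrow> 'b::{banach,second_countable_topology}"
  assumes "\<And>i. i \<in> I \<Longrightarrow> set_integrable M A (f i)"
  shows set_integrable_sum: "set_integrable M A (\<lambda>x. \<Sum>i\<in>I. f i x)"
    and set_integral_sum: "(LINT x:A|M. \<Sum>i\<in>I. f i x) = (\<Sum>i\<in>I. LINT x:A|M. f i x)"
  using assms unfolding set_integrable_def set_lebesgue_integral_def
  by (simp_all add: scaleR_sum_right Bochner_Integration.integral_sum Bochner_Integration.integrable_sum)

text \<open>Below radius 1 the series has a summable majorant and may be integrated termwise;
  orthogonality of the monomials then picks out one coefficient.\<close>

lemma powser_disc_integral:
  assumes r: "0 \<le> r" "r < 1" and sm: "summable (\<lambda>k. cmod (a k) * r ^ k)"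
    and q: "\<And>z. z \<in> cball 0 r \<Longrightarrow> (\<lambda>k. z ^ k * a k) sums q z"
  shows "(LINT z:cball 0 r|lborel. q z * cnj z ^ l * of_real (disc_weight z)) = a l * of_real (disc_moment r l)"
proof -
  define f where "f k z = indicat_real (cball 0 r) z *\<^sub>R (z ^ k * a k * cnj z ^ l * of_real (disc_weight z))" for k z
  have int: "integrable lborel (f k)" for k
    unfolding f_def[abs_def] by (intro borel_integrable_compact continuous_intros compact_cball)
  have intf: "integral\<^sup>L lborel (f k) = (if k = l then a l * of_real (disc_moment r l) else 0)" for k
  proof -
    have "integral\<^sup>L lborel (f k) = (LINT z:cball 0 r|lborel. a k * (z ^ k * cnj z ^ l * of_real (disc_weight z)))"
      unfolding set_lebesgue_integral_def f_def[abs_def] by (simp add: mult_ac)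
    also have "\<dots> = a k * (LINT z:cball 0 r|lborel. z ^ k * cnj z ^ l * of_real (disc_weight z))"
      by (rule set_integral_mult_right)
    finally show ?thesis by (simp only: disc_monomial_integral[OF r(1)]) simp
  qed
  have bound: "norm (f k z) \<le> cmod (a k) * r ^ k * indicat_real (cball 0 r) z" for k z
  proof (cases "z \<in> cball 0 r")
    case True
    then have z: "cmod z \<le> r" by simp
    then have z1: "cmod z \<le> 1" using r by simp
    have w: "\<bar>disc_weight z\<bar> \<le> 1" using z1 power_le_one[of "cmod z" 2] by simp
    have "norm (f k z) = cmod (a k) * cmod z ^ k * (cmod z ^ l * \<bar>disc_weight z\<bar>)"
      using True by (simp add: f_def norm_mult norm_power mult_ac del: of_real_diff of_real_power)
    also have "\<dots> \<le> cmod (a k) * r ^ k * (1 * 1)"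
      by (intro mult_mono power_mono power_le_one z z1 w mult_nonneg_nonneg) (use r in auto)
    finally show ?thesis using True by simp
  qed (simp add: f_def)
  have "(\<lambda>k. integral\<^sup>L lborel (f k)) sums (LINT z|lborel. (\<Sum>k. f k z))"
  proof (rule sums_integral)
    show "AE z in lborel. summable (\<lambda>k. norm (f k z))"
    proof (rule AE_I2)
      fix z
      show "summable (\<lambda>k. norm (f k z))"
        by (rule summable_comparison_test'[OF summable_mult2[OF sm, of "indicat_real (cball 0 r) z"], of 0])
          (use bound in simp)
    qed
    define V where "V = (LINT z|lborel. indicat_real (cball 0 r) (z :: complex))"
    have iI: "integrable lborel (\<lambda>z :: complex. c * indicat_real (cball 0 r) z)" for c
      using emeasure_compact_finite[OF compact_cball, of "0::complex" r] by (intro integrable_mult_right) auto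
    have "(LINT z|lborel. norm (f k z)) \<le> cmod (a k) * r ^ k * V" for k
    proof -
      have "(LINT z|lborel. norm (f k z)) \<le> (LINT z|lborel. cmod (a k) * r ^ k * indicat_real (cball 0 r) (z :: complex))"
        by (rule integral_mono'[OF iI]) (use bound r in simp_all)
      then show ?thesis by (simp only: integral_mult_right_zero V_def)
    qed
    then show "summable (\<lambda>k. LINT z|lborel. norm (f k z))"
      by (intro summable_comparison_test'[OF summable_mult2[OF sm, of V], of 0]) simp
  qed (rule int)
  moreover have "(\<Sum>k. f k z) = indicat_real (cball 0 r) z *\<^sub>R (q z * cnj z ^ l * of_real (disc_weight z))" for z
  proof (cases "z \<in> cball 0 r")
    case True
    have "(\<lambda>k. z ^ k * a k * (cnj z ^ l * of_real (disc_weight z))) sums (q z * (cnj z ^ l * of_real (disc_weight z)))"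
      by (rule sums_mult2[OF q[OF True]])
    then show ?thesis using True by (simp add: f_def sums_iff mult.assoc)
  qed (simp add: f_def)
  moreover have "(\<lambda>k. integral\<^sup>L lborel (f k)) sums (a l * of_real (disc_moment r l))"
    unfolding intf using sums_single[of l "\<lambda>_. a l * of_real (disc_moment r l)"] by simp
  ultimately show ?thesis
    unfolding set_lebesgue_integral_def using sums_unique2 by fastforce
qed

lemma disc_moment_tendsto:
  "((\<lambda>r. disc_moment r k) \<longlongrightarrow> pi / (real (k + 1) * real (k + 2))) (at_left 1)"
proof -
  have "((\<lambda>r. disc_moment r k) \<longlongrightarrow> disc_moment 1 k) (at_left 1)"
    unfolding disc_moment_def by (intro tendsto_intros) auto
  then show ?thesis by (simp add: disc_moment_def field_simps)
qed

lemma has_powser_apply_cinner_sums: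
  fixes c :: "nat \<Rightarrow> ('a::complex_normed_vector, 'h::chilbert_space) cblinfun"
  assumes "has_powser \<Phi> c R" "z \<in> ball 0 R"
  shows "(\<lambda>k. z ^ k * cinner (c k *\<^sub>V x) y) sums cinner (\<Phi> z *\<^sub>V x) y"
proof -
  have "(\<lambda>k. cinner ((z ^ k *\<^sub>C c k) *\<^sub>V x) y) sums cinner (\<Phi> z *\<^sub>V x) y"
    by (intro bounded_linear.sums[OF cinner.bounded_linear_left] bounded_linear.sums[OF cblinfun.bounded_linear_left]
        has_powser_sums[OF assms])
  then show ?thesis by (simp add: cblinfun_apply_scaleC)
qed

lemma has_powser_continuous_on:
  fixes c :: "nat \<Rightarrow> 'a::{complex_normed_vector,banach}"
  assumes "has_powser f c R"
  shows "continuous_on (ball 0 R) f"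
  using has_powser_has_cderiv[OF assms] unfolding has_cderiv_def
  by (auto intro!: continuous_at_imp_continuous_on has_derivative_continuous)

text \<open>The reflected argument of the test function produces the Hankel structure:
  \<open>cnj z ^ m\<close> from the first polynomial and \<open>cnj z ^ n\<close> from the
  conjugate-linear slot combine to \<open>cnj z ^ (m + n)\<close>, which selects
  \<open>c (m + n)\<close>.\<close>

lemma disc_integral_pairing:
  fixes c :: "nat \<Rightarrow> ('h::chilbert_space, 'h) cblinfun" and f g :: "nat \<Rightarrow> 'h"
  assumes P: "has_powser \<Phi> c 1" and r: "0 \<le> r" "r < 1"
  shows "(LINT z:cball 0 r|lborel. cinner (\<Phi> z *\<^sub>V (\<Sum>m<M. cnj z ^ m *\<^sub>C f m)) (\<Sum>n<N. z ^ n *\<^sub>C g n) * of_real (disc_weight z))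
    = (\<Sum>m<M. \<Sum>n<N. cinner (c (m + n) *\<^sub>V f m) (g n) * of_real (disc_moment r (m + n)))"
proof -
  have sub: "cball 0 r \<subseteq> ball (0::complex) 1" using r by auto
  have cont: "continuous_on (cball 0 r) (\<lambda>z. cinner (\<Phi> z *\<^sub>V x) y)" for x y
    by (intro continuous_on_subset[OF _ sub] cinner.continuous_on cblinfun.continuous_on
        has_powser_continuous_on[OF P] continuous_on_const)
  have "(LINT z:cball 0 r|lborel. cinner (\<Phi> z *\<^sub>V (\<Sum>m<M. cnj z ^ m *\<^sub>C f m)) (\<Sum>n<N. z ^ n *\<^sub>C g n) * of_real (disc_weight z))
    = (LINT z:cball 0 r|lborel. \<Sum>m<M. \<Sum>n<N. cinner (\<Phi> z *\<^sub>V f m) (g n) * cnj z ^ (m + n) * of_real (disc_weight z))"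
    unfolding cblinfun.sum_right cinner.sum_left unfolding cinner.sum_right sum_distrib_right
    by (simp add: cblinfun_scaleC power_add mult_ac)
  also have "\<dots> = (\<Sum>m<M. \<Sum>n<N. LINT z:cball 0 r|lborel. cinner (\<Phi> z *\<^sub>V f m) (g n) * cnj z ^ (m + n) * of_real (disc_weight z))"
    by (simp add: set_integral_sum set_integrable_sum continuous_set_integrable_cball cont continuous_intros)
  also have "\<dots> = (\<Sum>m<M. \<Sum>n<N. cinner (c (m + n) *\<^sub>V f m) (g n) * of_real (disc_moment r (m + n)))"
  proof (intro sum.cong refl powser_disc_integral r)
    fix m n
    show "(\<lambda>k. z ^ k * cinner (c k *\<^sub>V f m) (g n)) sums cinner (\<Phi> z *\<^sub>V f m) (g n)" if "z \<in> cball 0 r" for z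
      by (rule has_powser_apply_cinner_sums[OF P]) (use sub that in blast)
    show "summable (\<lambda>k. cmod (cinner (c k *\<^sub>V f m) (g n)) * r ^ k)"
    proof (rule summable_comparison_test'[OF summable_mult[OF has_powser_summable[OF P r], of "norm (f m) * norm (g n)"], of 0])
      fix k
      have "cmod (cinner (c k *\<^sub>V f m) (g n)) \<le> norm (c k *\<^sub>V f m) * norm (g n)" by (rule Cauchy_Schwarz_cinner)
      also have "\<dots> \<le> norm (c k) * norm (f m) * norm (g n)" by (intro mult_right_mono norm_cblinfun) simp
      finally have "cmod (cinner (c k *\<^sub>V f m) (g n)) * r ^ k \<le> norm (c k) * norm (f m) * norm (g n) * r ^ k"
        by (rule mult_right_mono) (use r in simp)
      then show "norm (cmod (cinner (c k *\<^sub>V f m) (g n)) * r ^ k) \<le> norm (f m) * norm (g n) * (norm (c k) * r ^ k)"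
        using r by (simp add: mult_ac)
    qed
  qed
  finally show ?thesis .
qed

lemma disc_integral_poly_norm:
  fixes g :: "nat \<Rightarrow> 'h::chilbert_space"
  assumes r: "0 \<le> r"
  shows "(LINT z:cball 0 r|lborel. (norm (\<Sum>n<N. z ^ n *\<^sub>C g n))\<^sup>2 * disc_weight z) = (\<Sum>n<N. (norm (g n))\<^sup>2 * disc_moment r n)"
proof -
  have "complex_of_real (LINT z:cball 0 r|lborel. (norm (\<Sum>n<N. z ^ n *\<^sub>C g n))\<^sup>2 * disc_weight z) =
      (LINT z:cball 0 r|lborel. of_real ((norm (\<Sum>n<N. z ^ n *\<^sub>C g n))\<^sup>2 * disc_weight z))"
    by (rule set_integral_complex_of_real[symmetric])
  also have "\<dots> = (LINT z:cball 0 r|lborel. \<Sum>m<N. \<Sum>n<N. cinner (g m) (g n) * (z ^ m * cnj z ^ n * of_real (disc_weight z)))"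
    unfolding of_real_mult cinner_self[symmetric] cinner.sum_left
    unfolding cinner.sum_right sum_distrib_right by (simp add: mult_ac)
  also have "\<dots> = (\<Sum>m<N. \<Sum>n<N. LINT z:cball 0 r|lborel. cinner (g m) (g n) * (z ^ m * cnj z ^ n * of_real (disc_weight z)))"
    by (simp add: set_integral_sum set_integrable_sum continuous_set_integrable_cball continuous_intros)
  also have "\<dots> = (\<Sum>m<N. \<Sum>n<N. cinner (g m) (g n) * (if m = n then of_real (disc_moment r m) else 0))"
    by (simp only: set_integral_mult_right disc_monomial_integral[OF r])
  also have "\<dots> = (\<Sum>m<N. cinner (g m) (g m) * of_real (disc_moment r m))"
    by (simp add: if_distrib[of "\<lambda>a. _ * a"] cong: if_cong)
  also have "\<dots> = of_real (\<Sum>n<N. (norm (g n))\<^sup>2 * disc_moment r n)"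
    by (simp add: cinner_self)
  finally show ?thesis by (simp only: of_real_eq_iff)
qed

text \<open>Cauchy-Schwarz enters in the additive form 2 Re <F, G> \<le> |F|^2 + |G|^2, which can be
  integrated pointwise; scaling \<open>g\<close> later recovers the product form. The integrals over
  radius r < 1 stay below the one over the whole disc because the weight is nonnegative.\<close>

lemma disc_pairing_le:
  fixes c :: "nat \<Rightarrow> ('h::chilbert_space, 'h) cblinfun" and f g :: "nat \<Rightarrow> 'h"
  assumes P: "has_powser \<Phi> c 1" and A: "0 \<le> A"
    and le: "(\<integral>\<^sup>+z\<in>ball 0 1. ennreal ((norm (\<Phi> z *\<^sub>V (\<Sum>m<M. cnj z ^ m *\<^sub>C f m)))\<^sup>2 * disc_weight z) \<partial>lborel) \<le> ennreal A"
  shows "2 * (\<Sum>m<M. \<Sum>n<N. Re (cinner (c (m + n) *\<^sub>V f m) (g n)) * (pi / (real (m + n + 1) * real (m + n + 2))))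
    \<le> A + (\<Sum>n<N. (norm (g n))\<^sup>2 * (pi / (real (n + 1) * real (n + 2))))"
proof -
  let ?F = "\<lambda>z. \<Phi> z *\<^sub>V (\<Sum>m<M. cnj z ^ m *\<^sub>C f m)" and ?G = "\<lambda>z. \<Sum>n<N. z ^ n *\<^sub>C g n"
  have main: "2 * (\<Sum>m<M. \<Sum>n<N. Re (cinner (c (m + n) *\<^sub>V f m) (g n)) * disc_moment r (m + n))
      \<le> A + (\<Sum>n<N. (norm (g n))\<^sup>2 * disc_moment r n)" if r: "0 \<le> r" "r < 1" for r
  proof -
    have sub: "cball 0 r \<subseteq> ball (0::complex) 1" using r by auto
    have w: "0 \<le> disc_weight z" if "z \<in> ball 0 1" for z using that by (simp add: power_le_one)
    have contF: "continuous_on (cball 0 r) ?F"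
      by (intro continuous_on_subset[OF _ sub] cblinfun.continuous_on has_powser_continuous_on[OF P]
          continuous_on_sum scaleC.continuous_on continuous_intros)
    have contG: "continuous_on (cball 0 r) ?G"
      by (intro continuous_on_sum scaleC.continuous_on continuous_intros)
    have iF: "set_integrable lborel (cball 0 r) (\<lambda>z. (norm (?F z))\<^sup>2 * disc_weight z)"
      by (intro continuous_set_integrable_cball continuous_intros contF)
    have iG: "set_integrable lborel (cball 0 r) (\<lambda>z. (norm (?G z))\<^sup>2 * disc_weight z)"
      by (intro continuous_set_integrable_cball continuous_intros contG)
    have iFG: "set_integrable lborel (cball 0 r) (\<lambda>z. cinner (?F z) (?G z) * of_real (disc_weight z))"
      by (intro continuous_set_integrable_cball continuous_intros cinner.continuous_on contF contG)
    have "ennreal (LINT z:cball 0 r|lborel. (norm (?F z))\<^sup>2 * disc_weight z)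
        = (\<integral>\<^sup>+z. ennreal (indicat_real (cball 0 r) z *\<^sub>R ((norm (?F z))\<^sup>2 * disc_weight z)) \<partial>lborel)"
      unfolding set_lebesgue_integral_def
      using iF[unfolded set_integrable_def] w sub
      by (intro nn_integral_eq_integral[symmetric] AE_I2) (auto split: split_indicator)
    also have "\<dots> \<le> (\<integral>\<^sup>+z\<in>ball 0 1. ennreal ((norm (?F z))\<^sup>2 * disc_weight z) \<partial>lborel)"
      using sub by (intro nn_integral_mono) (auto split: split_indicator)
    also note le
    finally have F: "(LINT z:cball 0 r|lborel. (norm (?F z))\<^sup>2 * disc_weight z) \<le> A"
      using A by simp
    have "2 * (\<Sum>m<M. \<Sum>n<N. Re (cinner (c (m + n) *\<^sub>V f m) (g n)) * disc_moment r (m + n)) =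
       2 * Re (LINT z:cball 0 r|lborel. cinner (?F z) (?G z) * of_real (disc_weight z))"
      unfolding disc_integral_pairing[OF P r] by simp
    also have "\<dots> = 2 * (LINT z:cball 0 r|lborel. Re (cinner (?F z) (?G z)) * disc_weight z)"
      using integral_Re[OF iFG[unfolded set_integrable_def]] by (simp add: set_lebesgue_integral_def)
    also have "\<dots> = (LINT z:cball 0 r|lborel. 2 * (Re (cinner (?F z) (?G z)) * disc_weight z))"
      by simp
    also have "\<dots> \<le> (LINT z:cball 0 r|lborel. (norm (?F z))\<^sup>2 * disc_weight z + (norm (?G z))\<^sup>2 * disc_weight z)"
    proof (rule set_integral_mono)
      show "set_integrable lborel (cball 0 r) (\<lambda>z. 2 * (Re (cinner (?F z) (?G z)) * disc_weight z))"
        by (intro continuous_set_integrable_cball continuous_intros cinner.continuous_on contF contG)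
      show "set_integrable lborel (cball 0 r) (\<lambda>z. (norm (?F z))\<^sup>2 * disc_weight z + (norm (?G z))\<^sup>2 * disc_weight z)"
        by (intro set_integral_add iF iG)
      fix z :: complex assume "z \<in> cball 0 r"
      then have "0 \<le> disc_weight z" using w sub by blast
      moreover have "2 * Re (cinner (?F z) (?G z)) \<le> (norm (?F z))\<^sup>2 + (norm (?G z))\<^sup>2"
        using norm_diff_sq[of "?F z" "?G z"] zero_le_power2[of "norm (?F z - ?G z)"] by linarith
      ultimately have "2 * Re (cinner (?F z) (?G z)) * disc_weight z \<le> ((norm (?F z))\<^sup>2 + (norm (?G z))\<^sup>2) * disc_weight z"
        by (intro mult_right_mono)
      then show "2 * (Re (cinner (?F z) (?G z)) * disc_weight z) \<le> (norm (?F z))\<^sup>2 * disc_weight z + (norm (?G z))\<^sup>2 * disc_weight z"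
        by (simp only: distrib_right mult.assoc)
    qed
    also have "\<dots> \<le> A + (\<Sum>n<N. (norm (g n))\<^sup>2 * disc_moment r n)"
      using F by (simp add: set_integral_add iF iG disc_integral_poly_norm[OF r(1)])
    finally show ?thesis .
  qed
  have ev: "\<forall>\<^sub>F r in at_left 1. 0 \<le> r \<and> r < (1::real)"
    using eventually_at_left_real[of 0 "1::real"] by (auto elim: eventually_mono)
  show ?thesis
  proof (rule tendsto_le[OF trivial_limit_at_left_real _ _ eventually_mono[OF ev]])
    show "((\<lambda>r. A + (\<Sum>n<N. (norm (g n))\<^sup>2 * disc_moment r n)) \<longlongrightarrow>
        A + (\<Sum>n<N. (norm (g n))\<^sup>2 * (pi / (real (n + 1) * real (n + 2))))) (at_left 1)"
      by (intro tendsto_intros disc_moment_tendsto)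
    show "((\<lambda>r. 2 * (\<Sum>m<M. \<Sum>n<N. Re (cinner (c (m + n) *\<^sub>V f m) (g n)) * disc_moment r (m + n))) \<longlongrightarrow>
        2 * (\<Sum>m<M. \<Sum>n<N. Re (cinner (c (m + n) *\<^sub>V f m) (g n)) * (pi / (real (m + n + 1) * real (m + n + 2))))) (at_left 1)"
      by (intro tendsto_intros disc_moment_tendsto)
  qed (use main in blast)
qed

section \<open>Power series in the Hardy space\<close>

lemma ennsqrt_ennreal: "0 \<le> x \<Longrightarrow> ennsqrt (ennreal x) = ennreal (sqrt x)"
  by (simp add: ennsqrt_def)

lemma ennsqrt_eq_ennreal:
  assumes "ennsqrt x = ennreal a" "0 \<le> a" shows "x = ennreal (a\<^sup>2)"
proof (cases x)
  case (real y)
  then have "sqrt y = a" using assms by (simp add: ennsqrt_ennreal)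
  then show ?thesis using real by auto
qed (use assms in \<open>simp add: ennsqrt_def\<close>)

lemma ennsqrt_le:
  assumes "x \<le> ennreal (a\<^sup>2)" "0 \<le> a" shows "ennsqrt x \<le> ennreal a"
proof (cases x)
  case (real y)
  then have "y \<le> a\<^sup>2" using assms by (simp add: ennreal_le_iff)
  then have "sqrt y \<le> a" using assms(2) real_le_lsqrt real by blast
  then show ?thesis using real assms by (simp add: ennsqrt_ennreal ennreal_le_iff)
qed (use assms in \<open>simp add: top_unique\<close>)

lemma has_powser_polynomial:
  fixes f :: "nat \<Rightarrow> 'a::{complex_normed_vector,banach}"
  shows "has_powser (\<lambda>z. \<Sum>m<M. z ^ m *\<^sub>C f m) (\<lambda>m. if m < M then f m else 0) R"
  unfolding has_powser_def
proof (intro conjI allI impI ballI)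
  show "summable (\<lambda>n. norm (if n < M then f n else 0) * r ^ n)" for r
    by (rule summable_finite[of "{..<M}"]) auto
  fix z
  have "(\<Sum>n. z ^ n *\<^sub>C (if n < M then f n else 0)) = (\<Sum>n<M. z ^ n *\<^sub>C (if n < M then f n else 0))"
    by (rule suminf_finite) (auto simp: scaleC.zero_right)
  then show "(\<Sum>m<M. z ^ m *\<^sub>C f m) = (\<Sum>n. z ^ n *\<^sub>C (if n < M then f n else 0))" by simp
qed

lemma has_powser_Hol:
  fixes c :: "nat \<Rightarrow> 'a::{complex_normed_vector,banach}"
  assumes "has_powser f c 1" shows "f \<in> Hol"
  using has_powser_cholomorphic_on[OF assms] by (auto simp: Hol_def)

text \<open>This makes a finite BMOA norm usable on finite sections: the hypothesis on the symbol is
  only ever tested on polynomials.\<close>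

lemma polynomial_O1:
  fixes f :: "nat \<Rightarrow> 'h::chilbert_space"
  assumes "(\<Sum>m<M. (norm (f m))\<^sup>2) = 1"
  shows "(\<lambda>z. \<Sum>m<M. z ^ m *\<^sub>C f m) \<in> O1"
proof -
  let ?p = "\<lambda>z. \<Sum>m<M. z ^ m *\<^sub>C f m"
  have "cholomorphic_on ?p (ball 0 2)"
    by (rule has_powser_cholomorphic_on[OF has_powser_polynomial]) (rule order.refl)
  then have "?p \<in> Oext"
    using has_powser_Hol[OF has_powser_polynomial] by (auto simp: Oext_def intro!: exI[of _ "2::real"])
  moreover have "H2_norm ?p = 1"
  proof -
    have "taylor_coeff ?p n = (if n < M then f n else 0)" for n
      by (rule has_powser_taylor_coeff[OF has_powser_polynomial zero_less_one])
    then have "H2_norm ?p = ennsqrt (\<Sum>n. ennreal ((norm (if n < M then f n else 0))\<^sup>2))"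
      by (simp add: H2_norm_def)
    also have "(\<Sum>n. ennreal ((norm (if n < M then f n else 0))\<^sup>2)) = (\<Sum>n<M. ennreal ((norm (if n < M then f n else 0))\<^sup>2))"
      by (rule suminf_finite) auto
    also have "\<dots> = ennreal (\<Sum>m<M. (norm (f m))\<^sup>2)" by (simp add: sum_ennreal)
    finally show ?thesis by (simp add: assms ennsqrt_ennreal del: ennreal_1)
  qed
  ultimately show ?thesis by (simp add: O1_def)
qed

lemma sharp_has_powser:
  fixes c :: "nat \<Rightarrow> ('h::chilbert_space, 'h) cblinfun"
  assumes P: "has_powser \<phi> c R"
  shows "has_powser (sharp \<phi>) (\<lambda>k. adj (c k)) R"
  unfolding has_powser_def
proof (intro conjI allI impI ballI)
  fix r assume r: "0 \<le> r \<and> r < R"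
  show "summable (\<lambda>n. norm (adj (c n)) * r ^ n)"
    by (rule summable_comparison_test'[OF has_powser_summable[OF P, of r], of 0])
      (use r in \<open>auto intro!: mult_right_mono norm_adj_le\<close>)
next
  fix z :: complex assume z: "z \<in> ball 0 R"
  have "(\<lambda>n. adj (cnj z ^ n *\<^sub>C c n)) sums adj (\<phi> (cnj z))"
    by (rule bounded_linear.sums[OF bounded_linear_adj has_powser_sums[OF P]]) (use z in simp)
  then show "sharp \<phi> z = (\<Sum>n. z ^ n *\<^sub>C adj (c n))"
    by (simp add: sharp_def adj_scaleC sums_iff)
qed

text \<open>The bound itself comes from letting M and then N tend to infinity. The work lies in
  showing that \<open>hankel \<phi> f\<close> is given by a convergent power series with
  coefficients \<open>h n\<close>, since \<open>H2_norm\<close> is computed from derivatives at the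
  origin.\<close>

lemma hankel_norm_le:
  fixes c :: "nat \<Rightarrow> ('h::chilbert_space, 'h) cblinfun"
  assumes P: "has_powser \<phi> c 1" and K: "0 \<le> K"
    and sections: "\<And>M N f. (\<Sum>n<N. (norm (\<Sum>m<M. c (m + n) *\<^sub>V f m))\<^sup>2) \<le> K\<^sup>2 * (\<Sum>m<M. (norm (f m))\<^sup>2)"
  shows "hankel_norm \<phi> \<le> ennreal K"
  unfolding hankel_norm_def
proof (rule SUP_least)
  fix f :: "complex \<Rightarrow> 'h" assume f: "f \<in> O1"
  define u where "u = taylor_coeff f"
  obtain R where R: "R > 1" and sR: "summable (\<lambda>n. norm (u n) * R ^ n)"
    using Oext_summable[of f] f by (auto simp: O1_def u_def)
  have "H2_norm f = 1" using f by (simp add: O1_def)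
  then have "ennsqrt (\<Sum>n. ennreal ((norm (u n))\<^sup>2)) = ennreal 1"
    unfolding H2_norm_def u_def by (simp only: ennreal_1)
  then have u1: "(\<Sum>n. ennreal ((norm (u n))\<^sup>2)) = ennreal (1\<^sup>2)"
    by (rule ennsqrt_eq_ennreal) (rule zero_le_one)
  have uM: "(\<Sum>m<M. (norm (u m))\<^sup>2) \<le> 1" for M
  proof -
    have "ennreal (\<Sum>m<M. (norm (u m))\<^sup>2) = (\<Sum>m<M. ennreal ((norm (u m))\<^sup>2))" by (simp add: sum_ennreal)
    also have "\<dots> \<le> (\<Sum>n. ennreal ((norm (u n))\<^sup>2))" by (intro sum_le_suminf) auto
    finally have "ennreal (\<Sum>m<M. (norm (u m))\<^sup>2) \<le> ennreal (1\<^sup>2)" by (simp only: u1)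
    then show ?thesis by (subst (asm) ennreal_le_iff) simp_all
  qed
  define h where "h n = (\<Sum>m. c (m + n) *\<^sub>V u m)" for n
  have tc: "taylor_coeff \<phi> = c" by (rule ext) (rule has_powser_taylor_coeff[OF P zero_less_one])
  \<comment> \<open>The coefficients of \<phi> grow at most like s^k for any s > 1, those of
    \<open>f\<close> decay faster than R^(-m) in the summable sense. Bounding s^m by R^m makes the
    sum over m converge and leaves only the growth s^n.\<close>
  have key: "\<exists>B\<ge>0. \<forall>m n. norm (c (m + n) *\<^sub>V u m) \<le> B * s ^ n * (norm (u m) * R ^ m)" if s: "1 < s" "s \<le> R" for s
  proof -
    have "summable (\<lambda>k. norm (c k) * (inverse s) ^ k)"
      by (rule has_powser_summable[OF P]) (use s in \<open>auto simp: field_simps\<close>)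
    then have "Bseq (\<lambda>k. norm (c k) * (inverse s) ^ k)"
      by (rule summable_LIMSEQ_zero[THEN convergentI, THEN convergent_imp_Bseq])
    then obtain B where B: "\<And>k. norm (norm (c k) * (inverse s) ^ k) \<le> B"
      by (elim BseqE) blast
    have B0: "0 \<le> B" by (rule order_trans[OF norm_ge_zero B])
    have "norm (c (m + n) *\<^sub>V u m) \<le> B * s ^ n * (norm (u m) * R ^ m)" for m n
    proof -
      have "norm (c (m + n)) \<le> B * s ^ (m + n)"
        using B[of "m + n"] s by (simp add: power_inverse field_simps)
      also have "\<dots> \<le> B * (s ^ n * R ^ m)"
        using s B0 power_mono[of s R m] by (auto simp: power_add mult.commute intro!: mult_left_mono)
      finally have "norm (c (m + n)) * norm (u m) \<le> B * (s ^ n * R ^ m) * norm (u m)"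
        by (rule mult_right_mono) simp
      then show ?thesis using norm_cblinfun[of "c (m + n)" "u m"] by (simp add: mult_ac)
    qed
    then show ?thesis using B0 by blast
  qed
  have sm: "summable (\<lambda>m. c (m + n) *\<^sub>V u m)" for n
  proof -
    obtain B where "\<forall>m n. norm (c (m + n) *\<^sub>V u m) \<le> B * R ^ n * (norm (u m) * R ^ m)" using key[of R] R by auto
    then show ?thesis
      by (intro summable_comparison_test'[OF summable_mult[OF sR, of "B * R ^ n"], of 0]) simp
  qed
  have "has_powser (hankel \<phi> f) h 1"
    unfolding has_powser_def
  proof (intro conjI allI impI ballI)
    fix r :: real assume r: "0 \<le> r \<and> r < 1"
    obtain t where t: "r < t" "t < 1" using dense r by blast
    \<comment> \<open>\<open>s \<le> R\<close> is what \<open>key\<close> asks for, and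
      \<open>s \<le> inverse t\<close> with \<open>r < t\<close> gives \<open>s * r < 1\<close>, so
      the series of the \<open>h n\<close> converges at radius \<open>r\<close>.\<close>
    define s where "s = min R (inverse t)"
    have s: "1 < s" "s \<le> R" using R t r by (auto simp: s_def one_less_inverse)
    have "s * r \<le> inverse t * r" using r by (intro mult_right_mono) (auto simp: s_def)
    also have "\<dots> < 1" using t r by (simp add: field_simps)
    finally have sr: "s * r < 1" .
    obtain B where B: "B \<ge> 0" "\<forall>m n. norm (c (m + n) *\<^sub>V u m) \<le> B * s ^ n * (norm (u m) * R ^ m)"
      using key[OF s] by blast
    define U where "U = (\<Sum>m. norm (u m) * R ^ m)"
    have "norm (h n) \<le> B * s ^ n * U" for n
    proof -
      have "norm (h n) \<le> (\<Sum>m. B * s ^ n * (norm (u m) * R ^ m))"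
        unfolding h_def by (rule norm_suminf_le[OF _ summable_mult[OF sR]]) (use B in blast)
      then show ?thesis by (simp only: suminf_mult[OF sR] U_def)
    qed
    then have le: "norm (h n) * r ^ n \<le> B * U * (s * r) ^ n" for n
      using r mult_right_mono[of "norm (h n)" "B * s ^ n * U" "r ^ n"] by (simp add: power_mult_distrib mult_ac)
    have "summable (\<lambda>n. B * U * (s * r) ^ n)"
      by (intro summable_mult summable_geometric) (use r s sr in simp)
    then show "summable (\<lambda>n. norm (h n) * r ^ n)"
      by (rule summable_comparison_test'[of _ 0]) (use le r in simp)
  qed (simp add: hankel_def h_def tc u_def)
  then have th: "taylor_coeff (hankel \<phi> f) n = h n" for n by (rule has_powser_taylor_coeff) simp
  have "(\<Sum>n<N. (norm (h n))\<^sup>2) \<le> K\<^sup>2" for N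
  proof (rule LIMSEQ_le_const2)
    show "(\<lambda>M. \<Sum>n<N. (norm (\<Sum>m<M. c (m + n) *\<^sub>V u m))\<^sup>2) \<longlonglongrightarrow> (\<Sum>n<N. (norm (h n))\<^sup>2)"
      unfolding h_def by (intro tendsto_sum tendsto_power tendsto_norm summable_LIMSEQ sm)
    have "(\<Sum>n<N. (norm (\<Sum>m<M. c (m + n) *\<^sub>V u m))\<^sup>2) \<le> K\<^sup>2" for M
      using sections[where f = u and M = M and N = N] mult_left_le[OF uM[of M], of "K\<^sup>2"] by simp
    then show "\<exists>M0. \<forall>M\<ge>M0. (\<Sum>n<N. (norm (\<Sum>m<M. c (m + n) *\<^sub>V u m))\<^sup>2) \<le> K\<^sup>2" by blast
  qed
  then have "(\<Sum>n<N. ennreal ((norm (h n))\<^sup>2)) \<le> ennreal (K\<^sup>2)" for N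
    by (simp add: sum_ennreal ennreal_leI)
  then have "(\<Sum>n. ennreal ((norm (h n))\<^sup>2)) \<le> ennreal (K\<^sup>2)"
    by (intro suminf_le_const) auto
  then show "H2_norm (hankel \<phi> f) \<le> ennreal K"
    unfolding H2_norm_def th by (rule ennsqrt_le[OF _ K])
qed

section \<open>Boundedness of the Hankel operator\<close>

text \<open>The optimal scale is A / B. Adding \<open>e\<close> to both keeps it meaningful when one
  of them is 0; then \<open>e\<close> tends to 0.\<close>

lemma le_mult_of_scaled_AM_GM:
  fixes A B T :: real
  assumes "0 \<le> A" "0 \<le> B" and le: "\<And>t. 0 < t \<Longrightarrow> 2 * t * T \<le> A\<^sup>2 + t\<^sup>2 * B\<^sup>2"
  shows "T \<le> A * B"
proof -
  have T: "T \<le> (A + e) * (B + e)" if e: "0 < e" for e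
  proof -
    define t where "t = (A + e) / (B + e)"
    have pos: "0 < A + e" "0 < B + e" using assms e by auto
    then have t: "0 < t" by (simp add: t_def)
    have tB: "t * (B + e) = A + e" using pos by (simp add: t_def)
    have "2 * t * T \<le> A\<^sup>2 + t\<^sup>2 * B\<^sup>2" by (rule le[OF t])
    also have "\<dots> \<le> (A + e)\<^sup>2 + t\<^sup>2 * (B + e)\<^sup>2"
      using assms e by (intro add_mono mult_left_mono power_mono) auto
    also have "t\<^sup>2 * (B + e)\<^sup>2 = (A + e)\<^sup>2" by (simp only: power_mult_distrib[symmetric] tB)
    also have "(A + e)\<^sup>2 + (A + e)\<^sup>2 = 2 * ((t * (B + e)) * (A + e))"
      unfolding tB by (simp add: power2_eq_square)
    also have "\<dots> = 2 * t * ((A + e) * (B + e))" by (simp only: mult_ac)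
    finally show ?thesis using t by simp
  qed
  have "((\<lambda>e. (A + e) * (B + e)) \<longlongrightarrow> (A + 0) * (B + 0)) (at_right 0)"
    by (intro tendsto_intros)
  then have "T \<le> (A + 0) * (B + 0)"
    by (rule tendsto_lowerbound) (auto intro: T eventually_mono[OF eventually_at_right_less])
  then show ?thesis by simp
qed

definition bmoa_pairing ::
  "(nat \<Rightarrow> ('h::chilbert_space, 'h) cblinfun) \<Rightarrow> nat \<Rightarrow> nat \<Rightarrow> (nat \<Rightarrow> 'h) \<Rightarrow> (nat \<Rightarrow> 'h) \<Rightarrow> real" where
  "bmoa_pairing c M N f g =
     (\<Sum>m<M. \<Sum>n<N. Re (cinner (c (m + n) *\<^sub>V f m) (g n)) * (real (n + 1) / real (m + n + 2)))"

lemma bmoa_pairing_le_unit: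
  fixes c :: "nat \<Rightarrow> ('h::chilbert_space, 'h) cblinfun"
  assumes P: "has_powser \<phi> c 1" and a: "BMOA_C_norm \<phi> = ennreal a" "0 \<le> a"
    and f: "(\<Sum>m<M. (norm (f m))\<^sup>2) = 1"
  shows "bmoa_pairing c M N f g \<le> a / sqrt pi * sqrt (\<Sum>n<N. (norm (g n))\<^sup>2)"
proof -
  define G where "G = (\<Sum>n<N. (norm (g n))\<^sup>2)"
  define T where "T = bmoa_pairing c M N f g"
  have G0: "0 \<le> G" by (simp add: G_def sum_nonneg)
  let ?I = "\<lambda>f. \<integral>\<^sup>+z\<in>ball 0 1. ennreal ((norm (Dop \<phi> z *\<^sub>V f (cnj z)))\<^sup>2 * disc_weight z) \<partial>lborel"
  have "?I (\<lambda>z. \<Sum>m<M. z ^ m *\<^sub>C f m) \<le> (SUP f\<in>O1. ?I f)"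
    by (rule SUP_upper[OF polynomial_O1[OF f]])
  also have "\<dots> = ennreal (a\<^sup>2)"
    using a unfolding BMOA_C_norm_def by (intro ennsqrt_eq_ennreal)
  finally have I: "(\<integral>\<^sup>+z\<in>ball 0 1. ennreal ((norm (Dop \<phi> z *\<^sub>V (\<Sum>m<M. cnj z ^ m *\<^sub>C f m)))\<^sup>2 * disc_weight z) \<partial>lborel) \<le> ennreal (a\<^sup>2)" .
  have "pi * T \<le> a * sqrt (pi * G)"
  proof (rule le_mult_of_scaled_AM_GM)
    fix t :: real assume t: "0 < t"
    \<comment> \<open>\<open>t\<close> is the free scale of \<open>le_mult_of_scaled_AM_GM\<close>.
      The factor \<open>n + 1\<close> is what survives in the pairing once the m + n + 1 from
      \<open>has_powser_Dop\<close> has cancelled against the moment.\<close>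
    define g' where "g' n = of_real (t * real (n + 1)) *\<^sub>C g n" for n
    have "2 * (\<Sum>m<M. \<Sum>n<N. Re (cinner ((of_nat (Suc (m + n)) *\<^sub>C c (m + n)) *\<^sub>V f m) (g' n)) * (pi / (real (m + n + 1) * real (m + n + 2))))
      \<le> a\<^sup>2 + (\<Sum>n<N. (norm (g' n))\<^sup>2 * (pi / (real (n + 1) * real (n + 2))))"
      by (rule disc_pairing_le[OF has_powser_Dop[OF P] _ I]) simp
    also have "(\<Sum>m<M. \<Sum>n<N. Re (cinner ((of_nat (Suc (m + n)) *\<^sub>C c (m + n)) *\<^sub>V f m) (g' n)) * (pi / (real (m + n + 1) * real (m + n + 2))))
      = t * (pi * T)"
      unfolding T_def bmoa_pairing_def sum_distrib_left
    proof (intro sum.cong refl)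
      fix m n
      have "Re (cinner ((of_nat (Suc (m + n)) *\<^sub>C c (m + n)) *\<^sub>V f m) (g' n)) =
        real (m + n + 1) * (t * real (n + 1)) * Re (cinner (c (m + n) *\<^sub>V f m) (g n))"
      proof -
        have "Re (cnj (of_real x) * (of_nat p * w)) = real p * x * Re w" for p x w by simp
        then show ?thesis
          unfolding g'_def cblinfun_apply_scaleC cinner_scaleC_left cinner_scaleC_right by (simp only: Suc_eq_plus1)
      qed
      moreover have "x * (t * y) * R * (pi / (x * w)) = t * (pi * (R * (y / w)))" if "x \<noteq> 0" for x y w R :: real
        using that by (cases "w = 0") (simp_all add: field_simps)
      ultimately show "Re (cinner ((of_nat (Suc (m + n)) *\<^sub>C c (m + n)) *\<^sub>V f m) (g' n)) * (pi / (real (m + n + 1) * real (m + n + 2)))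
        = t * (pi * (Re (cinner (c (m + n) *\<^sub>V f m) (g n)) * (real (n + 1) / real (m + n + 2))))"
        by simp
    qed
    also have "(\<Sum>n<N. (norm (g' n))\<^sup>2 * (pi / (real (n + 1) * real (n + 2)))) \<le> (\<Sum>n<N. t\<^sup>2 * (pi * (norm (g n))\<^sup>2))"
    proof (intro sum_mono)
      fix n
      have ng: "norm (g' n) = t * real (n + 1) * norm (g n)"
        unfolding g'_def norm_scaleC norm_of_real using t by (simp add: abs_of_nonneg)
      have "(norm (g' n))\<^sup>2 * (pi / (real (n + 1) * real (n + 2))) = t\<^sup>2 * (pi * (norm (g n))\<^sup>2) * (real (n + 1) / real (n + 2))"
      proof -
        have "(t * x * v)\<^sup>2 * (pi / (x * w)) = t\<^sup>2 * (pi * v\<^sup>2) * (x / w)" if "x \<noteq> 0" for x v w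
          using that by (cases "w = 0") (simp_all add: field_simps power2_eq_square)
        then show ?thesis unfolding ng by simp
      qed
      also have "\<dots> \<le> t\<^sup>2 * (pi * (norm (g n))\<^sup>2) * 1"
        by (intro mult_left_mono) auto
      finally show "(norm (g' n))\<^sup>2 * (pi / (real (n + 1) * real (n + 2))) \<le> t\<^sup>2 * (pi * (norm (g n))\<^sup>2)" by simp
    qed
    also have "(\<Sum>n<N. t\<^sup>2 * (pi * (norm (g n))\<^sup>2)) = t\<^sup>2 * (sqrt (pi * G))\<^sup>2"
    proof -
      have "(sqrt (pi * G))\<^sup>2 = pi * G" using G0 by simp
      then show ?thesis by (simp only: G_def sum_distrib_left)
    qed
    finally show "2 * t * (pi * T) \<le> a\<^sup>2 + t\<^sup>2 * (sqrt (pi * G))\<^sup>2" by simp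
  qed (use a G0 in auto)
  also have "\<dots> = pi * (a / sqrt pi * sqrt G)"
    by (simp add: real_sqrt_mult field_simps)
  finally have "T \<le> a / sqrt pi * sqrt G" by (rule mult_left_le_imp_le) simp
  then show ?thesis by (simp only: T_def G_def)
qed

lemma bmoa_pairing_scale_left:
  "bmoa_pairing c M N (\<lambda>m. of_real s *\<^sub>C f m) g = s * bmoa_pairing c M N f g"
  by (simp add: bmoa_pairing_def cblinfun_scaleC sum_distrib_left mult.assoc)

text \<open>Homogeneity in \<open>f\<close>; the zero section is treated apart because test
  functions are normalized to norm 1.\<close>

lemma bmoa_pairing_le:
  fixes c :: "nat \<Rightarrow> ('h::chilbert_space, 'h) cblinfun"
  assumes P: "has_powser \<phi> c 1" and a: "BMOA_C_norm \<phi> = ennreal a" "0 \<le> a"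
  shows "bmoa_pairing c M N f g \<le> a / sqrt pi * sqrt (\<Sum>m<M. (norm (f m))\<^sup>2) * sqrt (\<Sum>n<N. (norm (g n))\<^sup>2)"
proof -
  define S where "S = sqrt (\<Sum>m<M. (norm (f m))\<^sup>2)"
  show ?thesis
  proof (cases "S = 0")
    case True
    then have "f m = 0" if "m < M" for m
      using that by (simp add: S_def sum_nonneg_eq_0_iff)
    then have "bmoa_pairing c M N f g = 0"
      by (simp add: bmoa_pairing_def cblinfun.zero_right cinner.zero_left)
    then show ?thesis using True by (simp add: S_def)
  next
    case False
    have S0: "0 < S" using False by (simp add: S_def sum_nonneg less_le)
    have S2: "(\<Sum>m<M. (norm (f m))\<^sup>2) = S\<^sup>2" by (simp add: S_def sum_nonneg)
    have "(\<Sum>m<M. (norm (of_real (inverse S) *\<^sub>C f m))\<^sup>2) = (inverse S)\<^sup>2 * S\<^sup>2"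
      unfolding S2[symmetric] sum_distrib_left norm_scaleC norm_of_real
      by (simp add: power_mult_distrib del: abs_inverse)
    also have "\<dots> = 1" using S0 by (simp add: power_mult_distrib[symmetric])
    finally have "bmoa_pairing c M N (\<lambda>m. of_real (inverse S) *\<^sub>C f m) g \<le> a / sqrt pi * sqrt (\<Sum>n<N. (norm (g n))\<^sup>2)"
      by (rule bmoa_pairing_le_unit[OF P a])
    then have "bmoa_pairing c M N f g \<le> S * (a / sqrt pi * sqrt (\<Sum>n<N. (norm (g n))\<^sup>2))"
      using S0 unfolding bmoa_pairing_scale_left by (simp add: field_simps)
    then show ?thesis by (simp only: S_def mult_ac)
  qed
qed

text \<open>The weights \<open>(n + 1) / (m + n + 2)\<close> and \<open>(m + 1) / (m + n + 2)\<close> coming from \<open>\<phi>\<close> and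
  \<open>\<phi>\<^sup>#\<close> add up to 1.\<close>

lemma hankel_section_le:
  fixes c :: "nat \<Rightarrow> ('h::chilbert_space, 'h) cblinfun"
  assumes P: "has_powser \<phi> c 1" and a: "BMOA_C_norm \<phi> = ennreal a" "0 \<le> a"
    and b: "BMOA_C_norm (sharp \<phi>) = ennreal b" "0 \<le> b"
  shows "(\<Sum>n<N. (norm (\<Sum>m<M. c (m + n) *\<^sub>V f m))\<^sup>2) \<le> ((a + b) / sqrt pi)\<^sup>2 * (\<Sum>m<M. (norm (f m))\<^sup>2)"
proof -
  \<comment> \<open>Duality with the output itself: testing the form against \<open>h\<close> gives
    \<open>H\<close>, and one factor \<open>sqrt H\<close> cancels at the end.\<close>
  define h where "h n = (\<Sum>m<M. c (m + n) *\<^sub>V f m)" for n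
  define H where "H = (\<Sum>n<N. (norm (h n))\<^sup>2)"
  define F where "F = (\<Sum>m<M. (norm (f m))\<^sup>2)"
  have H0: "0 \<le> H" and F0: "0 \<le> F" by (simp_all add: H_def F_def sum_nonneg)
  have "H = (\<Sum>n<N. \<Sum>m<M. Re (cinner (c (m + n) *\<^sub>V f m) (h n)))"
    unfolding H_def Re_cinner_self[symmetric] by (subst (1) h_def) (simp add: cinner.sum_left)
  also have "\<dots> = (\<Sum>m<M. \<Sum>n<N. Re (cinner (c (m + n) *\<^sub>V f m) (h n)))" by (rule sum.swap)
  also have "\<dots> = (\<Sum>m<M. \<Sum>n<N. Re (cinner (c (m + n) *\<^sub>V f m) (h n)) * (real (n + 1) / real (m + n + 2))
      + Re (cinner (c (m + n) *\<^sub>V f m) (h n)) * (real (m + 1) / real (m + n + 2)))"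
  proof (intro sum.cong refl)
    fix m n
    have "real (n + 1) / real (m + n + 2) + real (m + 1) / real (m + n + 2) = 1"
      by (simp add: add_divide_distrib[symmetric])
    then show "x = x * (real (n + 1) / real (m + n + 2)) + x * (real (m + 1) / real (m + n + 2))" for x
      by (simp only: distrib_left[symmetric] mult_1_right)
  qed
  also have "\<dots> = bmoa_pairing c M N f h + (\<Sum>m<M. \<Sum>n<N. Re (cinner (c (m + n) *\<^sub>V f m) (h n)) * (real (m + 1) / real (m + n + 2)))"
    by (simp only: sum.distrib bmoa_pairing_def)
  \<comment> \<open>Moving the coefficient across the inner product exchanges the roles of
    \<open>f\<close> and \<open>h\<close>, so \<open>m + 1\<close> becomes the weight of the second
    index in the pairing for the adjoint coefficients.\<close>
  also have "(\<Sum>m<M. \<Sum>n<N. Re (cinner (c (m + n) *\<^sub>V f m) (h n)) * (real (m + 1) / real (m + n + 2))) =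
      (\<Sum>n<N. \<Sum>m<M. Re (cinner (adj (c (n + m)) *\<^sub>V h n) (f m)) * (real (m + 1) / real (n + m + 2)))"
  proof (subst sum.swap, intro sum.cong refl)
    fix m n
    have "Re (cinner (c (m + n) *\<^sub>V f m) (h n)) = Re (cinner (adj (c (m + n)) *\<^sub>V h n) (f m))"
      by (subst adj_works) (rule Re_cinner_commute)
    then show "Re (cinner (c (m + n) *\<^sub>V f m) (h n)) * (real (m + 1) / real (m + n + 2)) =
      Re (cinner (adj (c (n + m)) *\<^sub>V h n) (f m)) * (real (m + 1) / real (n + m + 2))"
      by (simp only: add.commute[of m n])
  qed
  also have "\<dots> = bmoa_pairing (\<lambda>k. adj (c k)) N M h f" by (simp only: bmoa_pairing_def)
  finally have "H = bmoa_pairing c M N f h + bmoa_pairing (\<lambda>k. adj (c k)) N M h f" .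
  also have "\<dots> \<le> a / sqrt pi * sqrt F * sqrt H + b / sqrt pi * sqrt H * sqrt F"
    unfolding F_def H_def by (intro add_mono bmoa_pairing_le[OF P a] bmoa_pairing_le[OF sharp_has_powser[OF P] b])
  also have "\<dots> = ((a + b) / sqrt pi * sqrt F) * sqrt H" by (simp add: add_divide_distrib algebra_simps)
  finally have le: "sqrt H * sqrt H \<le> ((a + b) / sqrt pi * sqrt F) * sqrt H" using H0 by simp
  have "sqrt H \<le> (a + b) / sqrt pi * sqrt F"
  proof (cases "H = 0")
    case True
    then show ?thesis using a b F0 by simp
  next
    case False
    then have "0 < sqrt H" using H0 by simp
    with le show ?thesis by (simp only: mult_le_cancel_right_pos)
  qed
  then have "(sqrt H)\<^sup>2 \<le> ((a + b) / sqrt pi * sqrt F)\<^sup>2" using H0 by (intro power_mono) auto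
  then have "H \<le> ((a + b) / sqrt pi)\<^sup>2 * F"
    using H0 F0 by (simp only: power_mult_distrib[of "_ / _"] real_sqrt_pow2)
  then show ?thesis by (simp only: H_def h_def F_def)
qed

lemma hankel_norm_le_BMOA:
  fixes \<phi> :: "complex \<Rightarrow> ('h::chilbert_space, 'h) cblinfun"
  assumes "\<phi> \<in> Hol" "BMOA_C_norm \<phi> < \<infinity>" "BMOA_C_norm (sharp \<phi>) < \<infinity>"
  shows "hankel_norm \<phi> \<le> ennreal (1 / sqrt pi) * (BMOA_C_norm \<phi> + BMOA_C_norm (sharp \<phi>))"
proof -
  have P: "has_powser \<phi> (taylor_coeff \<phi>) 1"
    using assms(1) by (intro cholomorphic_has_powser_cblinfun) (auto simp: Hol_def)
  obtain a where a: "BMOA_C_norm \<phi> = ennreal a" "0 \<le> a"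
    using assms(2) by (cases "BMOA_C_norm \<phi>") auto
  obtain b where b: "BMOA_C_norm (sharp \<phi>) = ennreal b" "0 \<le> b"
    using assms(3) by (cases "BMOA_C_norm (sharp \<phi>)") auto
  have "hankel_norm \<phi> \<le> ennreal ((a + b) / sqrt pi)"
    using a b by (intro hankel_norm_le[OF P _ hankel_section_le[OF P a b]]) simp
  also have "\<dots> = ennreal (1 / sqrt pi) * (ennreal a + ennreal b)"
    using a b by (simp add: ennreal_plus[symmetric] ennreal_mult[symmetric] del: ennreal_plus)
  finally show ?thesis by (simp only: a b)
qed

section \<open>A bounded Hankel operator with lacunary operator-valued symbol\<close>

text \<open>One Gram-Schmidt step: finitely many vectors cannot span, so some \<open>v\<close>
  differs from its projection onto their span.\<close>

lemma orthonormal_extend: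
  fixes e :: "nat \<Rightarrow> 'h::chilbert_space"
  assumes inf: "\<nexists>B :: 'h set. finite B \<and> module.span (*\<^sub>C) B = UNIV"
    and e: "\<And>i j. i < n \<Longrightarrow> j < n \<Longrightarrow> cinner (e i) (e j) = (if i = j then 1 else 0)"
  shows "\<exists>x. cinner x x = 1 \<and> (\<forall>i<n. cinner x (e i) = 0)"
proof -
  interpret V: vector_space "scaleC :: complex \<Rightarrow> 'h \<Rightarrow> 'h" by (rule vector_space_scaleC)
  have "V.span (e ` {..<n}) \<noteq> UNIV" using inf by auto
  then obtain v where v: "v \<notin> V.span (e ` {..<n})" by blast
  define p where "p = (\<Sum>i<n. cinner v (e i) *\<^sub>C e i)"
  have "p \<in> V.span (e ` {..<n})"
    unfolding p_def by (intro V.span_sum V.span_scale V.span_base) auto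
  then have vp: "v - p \<noteq> 0" using v by auto
  have orth: "cinner (v - p) (e j) = 0" if "j < n" for j
  proof -
    have "cinner p (e j) = (\<Sum>i<n. cinner v (e i) * cinner (e i) (e j))"
      by (simp add: p_def cinner.sum_left)
    also have "\<dots> = (\<Sum>i<n. cinner v (e i) * (if i = j then 1 else 0))"
      using e that by (intro sum.cong) auto
    also have "\<dots> = cinner v (e j)" using that by (simp add: if_distrib[of "\<lambda>a. _ * a"] cong: if_cong)
    finally show ?thesis by (simp add: cinner_diff_left)
  qed
  define x where "x = of_real (inverse (norm (v - p))) *\<^sub>C (v - p)"
  have "norm x = 1" using vp by (simp add: x_def del: of_real_inverse)
  then have "cinner x x = 1" by (simp add: cinner_self)
  moreover have "cinner x (e i) = 0" if "i < n" for i using orth[OF that] by (simp add: x_def)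
  ultimately show ?thesis by blast
qed

text \<open>Each choice step yields only a function whose first \<open>n\<close> values are
  orthonormal. Later steps leave these values alone, so the diagonal \<open>E (Suc i) i\<close> is
  the required sequence.\<close>

lemma orthonormal_sequence:
  assumes "\<nexists>B :: 'h::chilbert_space set. finite B \<and> module.span (*\<^sub>C) B = UNIV"
  obtains e :: "nat \<Rightarrow> 'h::chilbert_space" where "\<And>i j. cinner (e i) (e j) = (if i = j then 1 else 0)"
proof -
  define P where "P n e \<longleftrightarrow> (\<forall>i<n. \<forall>j<n. cinner (e i) (e j) = (if i = j then 1 else 0))" for n and e :: "nat \<Rightarrow> 'h"
  have "\<exists>E. \<forall>n. P n (E n) \<and> (\<forall>i<n. E (Suc n) i = E n i)"
  proof (rule dependent_nat_choice)
    show "\<exists>e. P 0 e" by (simp add: P_def)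
    fix e n assume P: "P n e"
    then obtain x where x: "cinner x x = 1" "\<forall>i<n. cinner x (e i) = 0"
      using orthonormal_extend[OF assms, of n e] by (auto simp: P_def)
    have "cinner (e i) x = 0" if "i < n" for i
      using x(2) that by (subst cinner_commute) simp
    then have "P (Suc n) (e(n := x))" using P x by (auto simp: P_def less_Suc_eq)
    then show "\<exists>e'. P (Suc n) e' \<and> (\<forall>i<n. e' i = e i)" by (intro exI[of _ "e(n := x)"]) auto
  qed
  then obtain E where E: "\<And>n. P n (E n)" "\<And>n i. i < n \<Longrightarrow> E (Suc n) i = E n i" by blast
  have stable: "E m i = E (Suc i) i" if "i < m" for i m
    using that
  proof (induction m)
    case (Suc m)
    then show ?case using E(2)[of i m] by (cases "i = m") auto
  qed simp
  show thesis
  proof (rule that)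
    fix i j
    have less: "i < Suc (max i j)" "j < Suc (max i j)" by auto
    show "cinner (E (Suc i) i) (E (Suc j) j) = (if i = j then 1 else 0)"
      using E(1)[of "Suc (max i j)", unfolded P_def, rule_format, OF less]
      by (simp only: stable[OF less(1)] stable[OF less(2)])
  qed
qed

section \<open>Coefficients of the lacunary symbol\<close>

definition rank_one :: "'h::chilbert_space \<Rightarrow> 'h \<Rightarrow> ('h, 'h) cblinfun" where
  "rank_one u v = (SOME T. \<forall>x. T *\<^sub>V x = cinner x v *\<^sub>C u)"

lemma rank_one_apply: "rank_one u v *\<^sub>V x = cinner x v *\<^sub>C u"
proof -
  have "\<exists>T :: ('a, 'a) cblinfun. \<forall>x. T *\<^sub>V x = cinner x v *\<^sub>C u"
  proof (rule bounded_clinear_cblinfunE[of "\<lambda>x. cinner x v *\<^sub>C u" "norm v * norm u"])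
    show "norm (cinner x v *\<^sub>C u) \<le> norm x * (norm v * norm u)" for x
      using mult_right_mono[OF Cauchy_Schwarz_cinner[of x v], of "norm u"] by (simp add: mult.assoc)
  qed (auto simp: cinner_add_left scaleC_add_left)
  then show ?thesis unfolding rank_one_def by (rule someI2_ex) blast
qed

lemma norm_rank_one_le: "norm (rank_one u v) \<le> norm u * norm v"
proof (rule norm_cblinfun_bound)
  show "norm (rank_one u v *\<^sub>V x) \<le> norm u * norm v * norm x" for x
    using mult_right_mono[OF Cauchy_Schwarz_cinner[of x v], of "norm u"] by (simp add: rank_one_apply mult_ac)
qed simp

lemma norm_sq_orthonormal_sum:
  fixes e :: "nat \<Rightarrow> 'h::chilbert_space"
  assumes e: "\<And>i j. cinner (e i) (e j) = (if i = j then 1 else 0)"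
  shows "(norm (\<Sum>i<n. a i *\<^sub>C e i))\<^sup>2 = (\<Sum>i<n. (cmod (a i))\<^sup>2)"
proof -
  have "cinner (\<Sum>i<n. a i *\<^sub>C e i) (\<Sum>i<n. a i *\<^sub>C e i) = (\<Sum>i<n. cnj (a i) * a i)"
    by (simp add: cinner.sum_left cinner.sum_right e if_distrib[of "\<lambda>a. _ * a"] cong: if_cong)
  also have "\<dots> = (\<Sum>i<n. a i * cnj (a i))" by (intro sum.cong refl mult.commute)
  finally have "cinner (\<Sum>i<n. a i *\<^sub>C e i) (\<Sum>i<n. a i *\<^sub>C e i) = (\<Sum>i<n. a i * cnj (a i))" .
  then have "complex_of_real ((norm (\<Sum>i<n. a i *\<^sub>C e i))\<^sup>2) = of_real (\<Sum>i<n. (cmod (a i))\<^sup>2)"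
    unfolding cinner_self by (simp add: complex_norm_square[symmetric])
  then show ?thesis by (simp only: of_real_eq_iff)
qed

lemma bessel_inequality:
  fixes e :: "nat \<Rightarrow> 'h::chilbert_space"
  assumes e: "\<And>i j. cinner (e i) (e j) = (if i = j then 1 else 0)"
  shows "(\<Sum>i<n. (cmod (cinner x (e i)))\<^sup>2) \<le> (norm x)\<^sup>2"
proof -
  define p where "p = (\<Sum>i<n. cinner x (e i) *\<^sub>C e i)"
  have "cinner x p = (\<Sum>i<n. cnj (cinner x (e i)) * cinner x (e i))"
    by (simp add: p_def cinner.sum_right)
  also have "\<dots> = of_real (\<Sum>i<n. (cmod (cinner x (e i)))\<^sup>2)"
    unfolding of_real_sum complex_norm_square by (intro sum.cong refl mult.commute)
  finally have "Re (cinner x p) = (\<Sum>i<n. (cmod (cinner x (e i)))\<^sup>2)" by simp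
  moreover have "(norm p)\<^sup>2 = (\<Sum>i<n. (cmod (cinner x (e i)))\<^sup>2)"
    unfolding p_def by (rule norm_sq_orthonormal_sum[OF e])
  ultimately show ?thesis using norm_diff_sq[of x p] zero_le_power2[of "norm (x - p)"] by linarith
qed

text \<open>The coefficients of \<open>z \<mapsto> U(z) A U(z)\<close>, where \<open>U(z)\<close> is the diagonal operator with entries
  \<open>z\<^bsup>2^i\<^esup>\<close> and \<open>A\<close> is the Hilbert matrix \<open>1 / (i - j)\<close> with zero diagonal (\<open>inverse 0 = 0\<close>).\<close>

definition lacunary_coeff :: "(nat \<Rightarrow> 'h::chilbert_space) \<Rightarrow> nat \<Rightarrow> ('h, 'h) cblinfun" where
  "lacunary_coeff e k = (\<Sum>i<Suc k. \<Sum>j<Suc k. if 2 ^ i + 2 ^ j = k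
     then of_real (inverse (real i - real j)) *\<^sub>C rank_one (e i) (e j) else 0)"

text \<open>Since i < 2^i, every pair that contributes to coefficient \<open>k\<close> lies below
  \<open>Suc k\<close>, and the range may be enlarged. A range independent of \<open>k\<close> lets
  all coefficients of a finite section be summed over common indices.\<close>

lemma lacunary_coeff_eq:
  assumes "k < L"
  shows "lacunary_coeff e k = (\<Sum>i<L. \<Sum>j<L. if 2 ^ i + 2 ^ j = k
     then of_real (inverse (real i - real j)) *\<^sub>C rank_one (e i) (e j) else 0)" (is "_ = (\<Sum>i<L. \<Sum>j<L. ?t i j)")
proof -
  have small: "i < Suc k" "j < Suc k" if "2 ^ i + 2 ^ j = k" for i j
    using that less_exp[of i] less_exp[of j] by linarith+
  have zero1: "?t i j = 0" if "\<not> i < Suc k" for i j using that small(1) by metis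
  have zero2: "?t i j = 0" if "\<not> j < Suc k" for i j using that small(2) by metis
  have "(\<Sum>i<Suc k. \<Sum>j<Suc k. ?t i j) = (\<Sum>i<Suc k. \<Sum>j<L. ?t i j)"
  proof (rule sum.cong[OF refl], rule sum.mono_neutral_left)
    show "\<forall>j\<in>{..<L} - {..<Suc k}. ?t i j = 0" for i by (intro ballI zero2) simp
  qed (use assms in auto)
  also have "\<dots> = (\<Sum>i<L. \<Sum>j<L. ?t i j)"
  proof (rule sum.mono_neutral_left)
    show "\<forall>i\<in>{..<L} - {..<Suc k}. (\<Sum>j<L. ?t i j) = 0" by (intro ballI sum.neutral zero1) simp
  qed (use assms in auto)
  finally show ?thesis by (simp only: lacunary_coeff_def)
qed

lemma abs_inverse_diff_nat_le_1: "\<bar>inverse (real i - real j)\<bar> \<le> 1"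
proof (cases "i = j")
  case False
  then have "1 \<le> \<bar>real i - real j\<bar>" by linarith
  then show ?thesis by (simp add: inverse_le_1_iff)
qed simp

text \<open>A crude count of (k + 1)^2 terms of norm at most 1: polynomial growth is enough for
  convergence on the unit disc.\<close>

lemma norm_lacunary_coeff_le:
  assumes "\<And>i. norm (e i) = 1"
  shows "norm (lacunary_coeff e k) \<le> real (Suc k) * real (Suc k)"
proof -
  have "norm (lacunary_coeff e k) \<le> (\<Sum>i<Suc k. \<Sum>j<Suc k. 1)"
    unfolding lacunary_coeff_def
  proof (intro sum_norm_le)
    fix i j
    have "norm (of_real (inverse (real i - real j)) *\<^sub>C rank_one (e i) (e j)) \<le> 1 * (1 * 1)"
      unfolding norm_scaleC norm_of_real
      by (intro mult_mono abs_inverse_diff_nat_le_1 order_trans[OF norm_rank_one_le]) (simp_all add: assms)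
    then show "norm (if 2 ^ i + 2 ^ j = k then of_real (inverse (real i - real j)) *\<^sub>C rank_one (e i) (e j) else 0) \<le> 1"
      by simp
  qed
  then show ?thesis by simp
qed

lemma summable_lacunary_coeff:
  assumes "\<And>i. norm (e i) = 1" and r: "0 \<le> r" "r < 1"
  shows "summable (\<lambda>k. norm (lacunary_coeff e k) * r ^ k)"
proof -
  obtain s where s: "r < s" "s < 1" using dense r by blast
  obtain t where t: "s < t" "t < 1" using dense s by blast
  \<comment> \<open>Differentiating the geometric series twice produces the quadratic growth, at the
    cost of two intermediate radii.\<close>
  have "summable (\<lambda>n. 1 * t ^ n)" using t s r by (simp add: summable_geometric)
  then have "summable (\<lambda>n. real (Suc n) * 1 * s ^ n)"
    by (intro summable_deriv_coeffs[of "\<lambda>n. 1" t]) (use t s r in auto)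
  then have "summable (\<lambda>n. real (Suc n) * s ^ n)" by (simp only: mult_1_right)
  then have "summable (\<lambda>n. real (Suc n) * real (Suc (Suc n)) * r ^ n)"
    by (intro summable_deriv_coeffs[of "\<lambda>n. real (Suc n)" s]) (use s r in auto)
  then show ?thesis
  proof (rule summable_comparison_test'[of _ 0])
    fix n
    have "norm (lacunary_coeff e n) \<le> real (Suc n) * real (Suc n)" by (rule norm_lacunary_coeff_le) (rule assms(1))
    also have "\<dots> \<le> real (Suc n) * real (Suc (Suc n))" by (intro mult_left_mono) auto
    finally show "norm (norm (lacunary_coeff e n) * r ^ n) \<le> real (Suc n) * real (Suc (Suc n)) * r ^ n"
      using mult_right_mono r by fastforce
  qed
qed

text \<open>Solving the exponent equation for 2^j in the integers shows that \<open>n\<close> and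
  \<open>i\<close> enter the innermost sum only through n - 2^i, which may be negative. For a fixed
  difference the sum over j is a row of the Hilbert matrix applied to a vector.\<close>

lemma lacunary_hankel_row:
  fixes e :: "nat \<Rightarrow> 'h::chilbert_space"
  assumes L: "M + n < L"
  shows "(\<Sum>m<M. lacunary_coeff e (m + n) *\<^sub>V f m) =
    (\<Sum>i<L. (\<Sum>j<L. of_real (inverse (real i - real j)) *
      (\<Sum>m<M. if (2::int) ^ j = int m + (int n - 2 ^ i) then cinner (f m) (e j) else 0)) *\<^sub>C e i)"
proof -
  have iff: "2 ^ i + 2 ^ j = m + n \<longleftrightarrow> (2::int) ^ j = int m + (int n - 2 ^ i)" for i j m :: nat
  proof -
    have "2 ^ i + 2 ^ j = m + n \<longleftrightarrow> int (2 ^ i + 2 ^ j) = int (m + n)" by (simp only: of_nat_eq_iff)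
    then show ?thesis by auto
  qed
  have "(\<Sum>m<M. lacunary_coeff e (m + n) *\<^sub>V f m) = (\<Sum>m<M. \<Sum>i<L. \<Sum>j<L.
      (of_real (inverse (real i - real j)) * (if (2::int) ^ j = int m + (int n - 2 ^ i) then cinner (f m) (e j) else 0)) *\<^sub>C e i)"
  proof (intro sum.cong refl)
    fix m assume "m \<in> {..<M}"
    then have mn: "m + n < L" using L by simp
    show "lacunary_coeff e (m + n) *\<^sub>V f m = (\<Sum>i<L. \<Sum>j<L.
      (of_real (inverse (real i - real j)) * (if (2::int) ^ j = int m + (int n - 2 ^ i) then cinner (f m) (e j) else 0)) *\<^sub>C e i)"
      unfolding lacunary_coeff_eq[OF mn] cblinfun.sum_left
      by (intro sum.cong refl)
        (auto simp: iff rank_one_apply cblinfun_apply_scaleC cblinfun.zero_left scaleC.zero_left simp del: of_real_inverse)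
  qed
  also have "\<dots> = (\<Sum>i<L. \<Sum>j<L. \<Sum>m<M.
      (of_real (inverse (real i - real j)) * (if (2::int) ^ j = int m + (int n - 2 ^ i) then cinner (f m) (e j) else 0)) *\<^sub>C e i)"
    by (subst sum.swap) (intro sum.cong refl sum.swap)
  also have "\<dots> = (\<Sum>i<L. (\<Sum>j<L. of_real (inverse (real i - real j)) *
      (\<Sum>m<M. if (2::int) ^ j = int m + (int n - 2 ^ i) then cinner (f m) (e j) else 0)) *\<^sub>C e i)"
    by (simp only: scaleC.sum_left sum_distrib_left)
  finally show ?thesis .
qed

text \<open>Shifting row \<open>n\<close> of component \<open>i\<close> by \<open>2^i\<close> turns the Hankel matrix into copies of \<open>A\<close>.\<close>

lemma lacunary_section_le:
  fixes e :: "nat \<Rightarrow> 'h::chilbert_space"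
  assumes e: "\<And>i j. cinner (e i) (e j) = (if i = j then 1 else 0)"
  shows "(\<Sum>n<N. (norm (\<Sum>m<M. lacunary_coeff e (m + n) *\<^sub>V f m))\<^sup>2) \<le> pi\<^sup>2 * (\<Sum>m<M. (norm (f m))\<^sup>2)"
proof -
  define L where "L = M + N + 1"
  \<comment> \<open>For a fixed shift \<open>l\<close> this is the vector that the Hilbert matrix
    acts on: entry \<open>j\<close> is the component along \<open>e j\<close> of \<open>f m\<close>
    at m = 2^j - l, or 0 if that index is out of range.\<close>
  define F where "F l j = (\<Sum>m<M. if (2::int) ^ j = int m + l then cinner (f m) (e j) else 0)" for l j
  define a where "a l i = (cmod (\<Sum>j<L. of_real (inverse (real i - real j)) * F l j))\<^sup>2" for l i
  \<comment> \<open>All shifts n - 2^i with n < N and i < L lie in this interval. Enlarging to it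
    gives every \<open>i\<close> the same set of shifts, so the matrix bound applies for each
    \<open>l\<close> separately.\<close>
  define R where "R = {- (2 ^ L) .. int N}"
  have "(\<Sum>n<N. (norm (\<Sum>m<M. lacunary_coeff e (m + n) *\<^sub>V f m))\<^sup>2) = (\<Sum>n<N. \<Sum>i<L. a (int n - 2 ^ i) i)"
  proof (intro sum.cong refl)
    fix n assume "n \<in> {..<N}"
    then have "M + n < L" by (simp add: L_def)
    then show "(norm (\<Sum>m<M. lacunary_coeff e (m + n) *\<^sub>V f m))\<^sup>2 = (\<Sum>i<L. a (int n - 2 ^ i) i)"
      unfolding a_def F_def by (simp only: lacunary_hankel_row norm_sq_orthonormal_sum[OF e])
  qed
  also have "\<dots> = (\<Sum>i<L. \<Sum>n<N. a (int n - 2 ^ i) i)" by (rule sum.swap)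
  also have "\<dots> \<le> (\<Sum>i<L. \<Sum>l\<in>R. a l i)"
  proof (rule sum_mono)
    fix i assume "i \<in> {..<L}"
    then have "(2::int) ^ i \<le> 2 ^ L" by (intro power_increasing) auto
    moreover have "(0::int) \<le> 2 ^ i" by simp
    ultimately have "- (2 ^ L) \<le> int n - 2 ^ i" "n < N \<Longrightarrow> int n - 2 ^ i \<le> int N" for n by linarith+
    then have sub: "(\<lambda>n. int n - 2 ^ i) ` {..<N} \<subseteq> R"
      unfolding R_def by auto
    have "(\<Sum>n<N. a (int n - 2 ^ i) i) = (\<Sum>l\<in>(\<lambda>n. int n - 2 ^ i) ` {..<N}. a l i)"
      by (subst sum.reindex) (auto simp: inj_on_def)
    also have "\<dots> \<le> (\<Sum>l\<in>R. a l i)"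
      by (rule sum_mono2[OF _ sub]) (auto simp: R_def a_def)
    finally show "(\<Sum>n<N. a (int n - 2 ^ i) i) \<le> (\<Sum>l\<in>R. a l i)" .
  qed
  also have "\<dots> = (\<Sum>l\<in>R. \<Sum>i<L. a l i)" by (rule sum.swap)
  also have "\<dots> \<le> (\<Sum>l\<in>R. pi\<^sup>2 * (\<Sum>j<L. (cmod (F l j))\<^sup>2))"
    unfolding a_def by (intro sum_mono hilbert_matrix_bound)
  also have "\<dots> = pi\<^sup>2 * (\<Sum>j<L. \<Sum>l\<in>R. (cmod (F l j))\<^sup>2)"
    by (subst sum.swap) (simp only: sum_distrib_left)
  also have "\<dots> \<le> pi\<^sup>2 * (\<Sum>j<L. \<Sum>m<M. (cmod (cinner (f m) (e j)))\<^sup>2)"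
  proof (intro mult_left_mono sum_mono)
    fix j
    \<comment> \<open>For given \<open>l\<close> and \<open>j\<close> at most one m solves the
      equation, so the square of the sum is the sum of squares. Conversely each m meets at most one
      \<open>l\<close>, so summing over \<open>R\<close> counts nothing twice.\<close>
    have "(cmod (F l j))\<^sup>2 = (\<Sum>m<M. if l = 2 ^ j - int m then (cmod (cinner (f m) (e j)))\<^sup>2 else 0)" for l
    proof (cases "\<exists>m<M. l = 2 ^ j - int m")
      case True
      then obtain m0 where m0: "m0 < M" "l = 2 ^ j - int m0" by blast
      have "(2 ^ j = int m + l) = (m = m0)" "(l = 2 ^ j - int m) = (m = m0)" for m using m0(2) by auto
      then show ?thesis using m0 by (simp add: F_def)
    next
      case False
      then have "F l j = 0" unfolding F_def by (intro sum.neutral) auto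
      moreover have "(\<Sum>m<M. if l = 2 ^ j - int m then (cmod (cinner (f m) (e j)))\<^sup>2 else 0) = 0"
        using False by (intro sum.neutral) auto
      ultimately show ?thesis by simp
    qed
    then have "(\<Sum>l\<in>R. (cmod (F l j))\<^sup>2) = (\<Sum>l\<in>R. \<Sum>m<M. if l = 2 ^ j - int m then (cmod (cinner (f m) (e j)))\<^sup>2 else 0)"
      by (simp only:)
    also have "\<dots> = (\<Sum>m<M. \<Sum>l\<in>R. if l = 2 ^ j - int m then (cmod (cinner (f m) (e j)))\<^sup>2 else 0)"
      by (rule sum.swap)
    also have "\<dots> \<le> (\<Sum>m<M. (cmod (cinner (f m) (e j)))\<^sup>2)"
      by (intro sum_mono) (simp add: R_def)
    finally show "(\<Sum>l\<in>R. (cmod (F l j))\<^sup>2) \<le> (\<Sum>m<M. (cmod (cinner (f m) (e j)))\<^sup>2)" .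
  qed simp
  also have "\<dots> = pi\<^sup>2 * (\<Sum>m<M. \<Sum>j<L. (cmod (cinner (f m) (e j)))\<^sup>2)" by (subst sum.swap) simp
  also have "\<dots> \<le> pi\<^sup>2 * (\<Sum>m<M. (norm (f m))\<^sup>2)"
    by (intro mult_left_mono sum_mono bessel_inequality[OF e]) simp
  finally show ?thesis .
qed

section \<open>The symbol is not in the Carleson class\<close>

text \<open>A row in the first half of a matrix of size 2 I has entries at distances 1 to I right of
  the diagonal; doubling the size makes this hold for I rows at once.\<close>

lemma harm_le_hilbert_matrix_row:
  assumes "i < I"
  shows "harm I \<le> (\<Sum>j<2 * I. \<bar>inverse (real j - real i)\<bar>)"
proof -
  have "harm I = (\<Sum>d=1..I. \<bar>inverse (real (d + i) - real i)\<bar>)"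
    by (simp add: harm_def)
  also have "\<dots> = (\<Sum>j\<in>(\<lambda>d. d + i) ` {1..I}. \<bar>inverse (real j - real i)\<bar>)"
    by (subst sum.reindex) (auto simp: inj_on_def)
  also have "\<dots> \<le> (\<Sum>j<2 * I. \<bar>inverse (real j - real i)\<bar>)"
    by (rule sum_mono2) (use assms in auto)
  finally show ?thesis .
qed

text \<open>With x = 2^i and y = 2^j the difference is (y - x) / (x + y + 2). Under y \<ge> 2x and x
  \<ge> 1 it is smallest at x = 1, y = 2, where it equals 1 / 5.\<close>

lemma dyadic_weight_diff_ge:
  assumes "i < j"
  shows "1 / 5 \<le> (2 ^ j + 1) / (2 ^ i + 2 ^ j + 2) - (2 ^ i + 1) / (2 ^ j + 2 ^ i + 2 :: real)"
proof -
  have "(2::real) ^ Suc i \<le> 2 ^ j" using assms by (intro power_increasing) auto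
  moreover have "(1::real) \<le> 2 ^ i" by simp
  moreover have "1 / 5 \<le> (y + 1) / (x + y + 2) - (x + 1) / (y + x + 2)" if "2 * x \<le> y" "1 \<le> x" for x y :: real
  proof -
    have eq: "(y + 1) / (x + y + 2) - (x + 1) / (y + x + 2) = (y - x) / (x + y + 2)"
      by (simp add: diff_divide_distrib[symmetric] add.commute)
    have pos: "0 < x + y + 2" using that by linarith
    have "x + y + 2 \<le> 5 * (y - x)" using that by (simp add: algebra_simps)
    then show ?thesis unfolding eq pos_le_divide_eq[OF pos] by simp
  qed
  ultimately show ?thesis by simp
qed

text \<open>The weights behave like a triangular truncation, so the antisymmetric Hilbert matrix is turned
  into one whose entries essentially all have the same sign.\<close>

lemma weighted_hilbert_matrix_ge:
  "real I * harm I / 10 \<le> (\<Sum>i<2 * I. \<Sum>j<2 * I. inverse (real j - real i) * ((2 ^ j + 1) / (2 ^ i + 2 ^ j + 2)))"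
proof -
  define w where "w i j = (2 ^ j + 1) / (2 ^ i + 2 ^ j + 2 :: real)" for i j :: nat
  define X where "X = (\<Sum>i<2 * I. \<Sum>j<2 * I. inverse (real j - real i) * w i j)"
  have neg: "inverse (real i - real j) = - inverse (real j - real i)" for i j
    by (metis inverse_minus_eq minus_diff_eq)
  have "X = (\<Sum>i<2 * I. \<Sum>j<2 * I. inverse (real i - real j) * w j i)"
    unfolding X_def by (rule sum.swap)
  \<comment> \<open>Adding the transpose replaces the weight by an antisymmetric one; its product
    with the antisymmetric matrix is nonnegative entry by entry. The factor 2 turns 1 / 5 into 1 /
    10.\<close>
  then have "2 * X = (\<Sum>i<2 * I. \<Sum>j<2 * I. inverse (real j - real i) * w i j + inverse (real i - real j) * w j i)"
    by (simp only: sum.distrib X_def[symmetric])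
  also have "\<dots> = (\<Sum>i<2 * I. \<Sum>j<2 * I. inverse (real j - real i) * (w i j - w j i))"
    by (intro sum.cong refl) (subst neg, simp only: right_diff_distrib mult_minus_left add_uminus_conv_diff)
  also have "\<dots> \<ge> (\<Sum>i<2 * I. \<Sum>j<2 * I. \<bar>inverse (real j - real i)\<bar> / 5)"
  proof (intro sum_mono)
    fix i j :: nat
    consider "i < j" | "i = j" | "j < i" by linarith
    then show "\<bar>inverse (real j - real i)\<bar> / 5 \<le> inverse (real j - real i) * (w i j - w j i)"
    proof cases
      case 1
      have "inverse (real j - real i) * (1 / 5) \<le> inverse (real j - real i) * (w i j - w j i)"
        unfolding w_def using 1 by (intro mult_left_mono dyadic_weight_diff_ge) auto
      then show ?thesis using 1 by simp
    next
      case 3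
      have "inverse (real i - real j) * (1 / 5) \<le> inverse (real i - real j) * (w j i - w i j)"
        unfolding w_def using 3 by (intro mult_left_mono dyadic_weight_diff_ge) auto
      moreover have "inverse (real j - real i) * (w i j - w j i) = inverse (real i - real j) * (w j i - w i j)"
        by (subst neg) (simp only: mult_minus_left mult_minus_right[symmetric] minus_diff_eq)
      moreover have "\<bar>inverse (real j - real i)\<bar> = inverse (real i - real j)"
        unfolding neg[of j i] using 3 by simp
      ultimately show ?thesis by simp
    qed simp
  qed
  finally have "(\<Sum>i<2 * I. \<Sum>j<2 * I. \<bar>inverse (real j - real i)\<bar> / 5) \<le> 2 * X" .
  moreover have "(\<Sum>i<I. harm I / 5) \<le> (\<Sum>i<2 * I. \<Sum>j<2 * I. \<bar>inverse (real j - real i)\<bar> / 5)"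
  proof -
    have "(\<Sum>i<I. harm I / 5) \<le> (\<Sum>i<I. \<Sum>j<2 * I. \<bar>inverse (real j - real i)\<bar> / 5)"
      unfolding sum_divide_distrib[symmetric]
      by (intro sum_mono divide_right_mono harm_le_hilbert_matrix_row) auto
    also have "\<dots> \<le> (\<Sum>i<2 * I. \<Sum>j<2 * I. \<bar>inverse (real j - real i)\<bar> / 5)"
      by (rule sum_mono2) (auto intro: sum_nonneg)
    finally show ?thesis .
  qed
  ultimately have "real I * (harm I / 5) \<le> 2 * X" by simp
  then show ?thesis by (simp add: X_def w_def)
qed

text \<open>The coefficient also contains the term of the opposite ordered pair; testing with
  \<open>e i\<close> and \<open>e j\<close> isolates \<open>rank_one (e j) (e i)\<close>, which is
  why j - i appears and not i - j.\<close>

lemma lacunary_coeff_entry: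
  fixes e :: "nat \<Rightarrow> 'h::chilbert_space"
  assumes e: "\<And>i j. cinner (e i) (e j) = (if i = j then 1 else 0)"
  shows "cinner (lacunary_coeff e (2 ^ i + 2 ^ j) *\<^sub>V e i) (e j) = of_real (inverse (real j - real i))"
proof -
  define L where "L = Suc (2 ^ i + 2 ^ j)"
  have L: "2 ^ i + 2 ^ j < L" by (simp add: L_def)
  have ij: "i < L" "j < L" using less_exp[of i] less_exp[of j] L by linarith+
  have "cinner (lacunary_coeff e (2 ^ i + 2 ^ j) *\<^sub>V e i) (e j) =
    (\<Sum>k<L. \<Sum>l<L. if k = j \<and> l = i then of_real (inverse (real j - real i)) else 0)"
    unfolding lacunary_coeff_eq[OF L] cblinfun.sum_left cinner.sum_left
    by (intro sum.cong refl)
      (auto simp: rank_one_apply cblinfun_apply_scaleC cblinfun.zero_left cinner.zero_left e add.commute simp del: of_real_inverse)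
  also have "\<dots> = (\<Sum>k<L. if k = j then (\<Sum>l<L. if l = i then of_real (inverse (real j - real i)) else 0) else 0)"
    by (intro sum.cong refl) auto
  also have "\<dots> = of_real (inverse (real j - real i))" using ij by simp
  finally show ?thesis .
qed

text \<open>The test vector has \<open>e i\<close> at degree 2^i and 0 elsewhere and is used in both
  slots: all other degrees drop out, and the form sums the weighted Hilbert matrix over all its
  entries.\<close>

lemma bmoa_pairing_lacunary:
  fixes e :: "nat \<Rightarrow> 'h::chilbert_space"
  assumes e: "\<And>i j. cinner (e i) (e j) = (if i = j then 1 else 0)"
  obtains f where "(\<Sum>m<2 ^ I. (norm (f m))\<^sup>2) = real I"
    "bmoa_pairing (lacunary_coeff e) (2 ^ I) (2 ^ I) f f =
      (\<Sum>i<I. \<Sum>j<I. inverse (real j - real i) * ((2 ^ j + 1) / (2 ^ i + 2 ^ j + 2)))"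
proof -
  define S where "S = (\<lambda>i. 2 ^ i :: nat) ` {..<I}"
  define f where "f m = (if m \<in> S then e (the_inv_into {..<I} (\<lambda>i. 2 ^ i) m) else 0)" for m
  have inj: "inj_on (\<lambda>i. 2 ^ i :: nat) {..<I}" by (auto simp: inj_on_def)
  have f2: "f (2 ^ i) = e i" if "i < I" for i
    using the_inv_into_f_f[OF inj, of i] that by (simp add: f_def S_def)
  have S: "S \<subseteq> {..<2 ^ I}" by (auto simp: S_def)
  have sum2: "(\<Sum>m<2 ^ I. H m) = (\<Sum>i<I. H (2 ^ i))" if "\<And>m. f m = 0 \<Longrightarrow> H m = 0" for H :: "nat \<Rightarrow> real"
  proof -
    have "(\<Sum>m<2 ^ I. H m) = (\<Sum>m\<in>S. H m)"
      by (rule sum.mono_neutral_right[OF _ S]) (use that in \<open>auto simp: f_def\<close>)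
    then show ?thesis unfolding S_def by (simp add: sum.reindex[OF inj])
  qed
  have ne: "norm (e i) = 1" for i
    using e[of i i] by (simp add: norm_eq_sqrt_cinner)
  show thesis
  proof (rule that)
    have "(\<Sum>m<2 ^ I. (norm (f m))\<^sup>2) = (\<Sum>i<I. (norm (f (2 ^ i)))\<^sup>2)" by (rule sum2) simp
    also have "\<dots> = (\<Sum>i<I. 1)" by (intro sum.cong) (simp_all add: f2 ne)
    finally show "(\<Sum>m<2 ^ I. (norm (f m))\<^sup>2) = real I" by simp
    have "bmoa_pairing (lacunary_coeff e) (2 ^ I) (2 ^ I) f f =
      (\<Sum>i<I. \<Sum>n<2 ^ I. Re (cinner (lacunary_coeff e (2 ^ i + n) *\<^sub>V f (2 ^ i)) (f n)) * (real (n + 1) / real (2 ^ i + n + 2)))"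
      unfolding bmoa_pairing_def by (rule sum2) (simp add: cblinfun.zero_right cinner.zero_left)
    also have "\<dots> = (\<Sum>i<I. \<Sum>j<I. Re (cinner (lacunary_coeff e (2 ^ i + 2 ^ j) *\<^sub>V f (2 ^ i)) (f (2 ^ j))) * (real (2 ^ j + 1) / real (2 ^ i + 2 ^ j + 2)))"
      by (intro sum.cong refl sum2) (simp add: cinner.zero_right)
    also have "\<dots> = (\<Sum>i<I. \<Sum>j<I. inverse (real j - real i) * ((2 ^ j + 1) / (2 ^ i + 2 ^ j + 2)))"
      by (intro sum.cong refl) (simp add: f2 lacunary_coeff_entry[OF e] add_ac del: of_real_inverse of_real_diff)
    finally show "bmoa_pairing (lacunary_coeff e) (2 ^ I) (2 ^ I) f f =
      (\<Sum>i<I. \<Sum>j<I. inverse (real j - real i) * ((2 ^ j + 1) / (2 ^ i + 2 ^ j + 2)))" .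
  qed
qed

lemma bounded_hankel_unbounded_BMOA:
  assumes "\<nexists>B :: 'h::chilbert_space set. finite B \<and> module.span (*\<^sub>C) B = UNIV"
  shows "\<exists>\<phi> :: complex \<Rightarrow> ('h::chilbert_space, 'h) cblinfun. \<phi> \<in> Hol \<and> hankel_norm \<phi> < \<infinity> \<and> BMOA_C_norm \<phi> = \<infinity>"
proof -
  obtain e :: "nat \<Rightarrow> 'h" where e: "\<And>i j. cinner (e i) (e j) = (if i = j then 1 else 0)"
    by (rule orthonormal_sequence[OF assms]) blast
  have ne: "norm (e i) = 1" for i
    using e[of i i] by (simp add: norm_eq_sqrt_cinner)
  define \<phi> where "\<phi> z = (\<Sum>n. z ^ n *\<^sub>C lacunary_coeff e n)" for z
  have P: "has_powser \<phi> (lacunary_coeff e) 1"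
    unfolding has_powser_def using summable_lacunary_coeff[of e, OF ne] by (simp add: \<phi>_def)
  have "hankel_norm \<phi> \<le> ennreal pi"
    by (rule hankel_norm_le[OF P]) (simp_all add: lacunary_section_le[OF e])
  then have "hankel_norm \<phi> < \<infinity>" by (simp add: le_less_trans)
  moreover have "BMOA_C_norm \<phi> = \<infinity>"
  proof (rule ccontr)
    assume "BMOA_C_norm \<phi> \<noteq> \<infinity>"
    then obtain a where a: "BMOA_C_norm \<phi> = ennreal a" "0 \<le> a"
      by (cases "BMOA_C_norm \<phi>") auto
    \<comment> \<open>The form is at least I times the harmonic number over 10, while the two norms
      of the test vector multiply to 2 I; dividing by I leaves the constant 20.\<close>
    have bound: "harm I \<le> 20 * (a / sqrt pi)" if I: "0 < I" for I
    proof -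
      obtain f where f: "(\<Sum>m<2 ^ (2 * I). (norm (f m))\<^sup>2) = real (2 * I)"
        "bmoa_pairing (lacunary_coeff e) (2 ^ (2 * I)) (2 ^ (2 * I)) f f =
          (\<Sum>i<2 * I. \<Sum>j<2 * I. inverse (real j - real i) * ((2 ^ j + 1) / (2 ^ i + 2 ^ j + 2)))"
        by (rule bmoa_pairing_lacunary[OF e])
      have "real I * harm I / 10 \<le> a / sqrt pi * sqrt (real (2 * I)) * sqrt (real (2 * I))"
        using weighted_hilbert_matrix_ge[of I] bmoa_pairing_le[OF P a, of "2 ^ (2 * I)" "2 ^ (2 * I)" f f]
        unfolding f by (rule order_trans)
      also have "\<dots> = a / sqrt pi * real (2 * I)" by (simp only: mult.assoc real_sqrt_mult_self abs_of_nat)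
      finally have "real I * harm I \<le> real I * (20 * (a / sqrt pi))" by (simp add: mult_ac)
      then show ?thesis using I by (simp only: mult_le_cancel_left_pos of_nat_0_less_iff)
    qed
    obtain I where I: "exp (20 * (a / sqrt pi)) < real I" using reals_Archimedean2 by blast
    then have I0: "0 < real I" using exp_gt_zero less_trans by blast
    have "ln (exp (20 * (a / sqrt pi))) < ln (real I + 1)"
      using I I0 by (subst ln_less_cancel_iff) auto
    then have "20 * (a / sqrt pi) < ln (real I + 1)" by (simp only: ln_exp)
    also have "\<dots> \<le> harm I" by (rule ln_le_harm)
    finally show False using bound[of I] I0 by simp
  qed
  ultimately show ?thesis using has_powser_Hol[OF P] by blast
qed

theorem corollary1p10:
  assumes separable: "separable_space (euclidean :: 'h::chilbert_space topology)"
  shows "(\<forall>\<phi> :: complex \<Rightarrow> ('h, 'h) cblinfun. \<phi> \<in> Hol \<and> BMOA_C_norm \<phi> < \<infinity> \<and> BMOA_C_norm (sharp \<phi>) < \<infinity>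
            \<longrightarrow> hankel_norm \<phi> < \<infinity>)
       \<and> (\<exists>C::real. C > 0 \<and>
            (\<forall>\<phi> :: complex \<Rightarrow> ('h, 'h) cblinfun. \<phi> \<in> Hol \<and> BMOA_C_norm \<phi> < \<infinity> \<and> BMOA_C_norm (sharp \<phi>) < \<infinity>
               \<longrightarrow> hankel_norm \<phi> \<le> ennreal C * (BMOA_C_norm \<phi> + BMOA_C_norm (sharp \<phi>))))
       \<and> ((\<nexists>B :: 'h set. finite B \<and> module.span (*\<^sub>C) B = UNIV)
            \<longrightarrow> (\<exists>\<phi> :: complex \<Rightarrow> ('h, 'h) cblinfun. \<phi> \<in> Hol \<and> hankel_norm \<phi> < \<infinity>
                  \<and> \<not> (BMOA_C_norm \<phi> < \<infinity> \<and> BMOA_C_norm (sharp \<phi>) < \<infinity>)))"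
proof (intro conjI allI impI)
  fix \<phi> :: "complex \<Rightarrow> ('h, 'h) cblinfun"
  assume "\<phi> \<in> Hol \<and> BMOA_C_norm \<phi> < \<infinity> \<and> BMOA_C_norm (sharp \<phi>) < \<infinity>"
  then have fin: "BMOA_C_norm \<phi> < \<infinity>" "BMOA_C_norm (sharp \<phi>) < \<infinity>"
    and le: "hankel_norm \<phi> \<le> ennreal (1 / sqrt pi) * (BMOA_C_norm \<phi> + BMOA_C_norm (sharp \<phi>))"
    by (auto intro: hankel_norm_le_BMOA)
  have "ennreal (1 / sqrt pi) * (BMOA_C_norm \<phi> + BMOA_C_norm (sharp \<phi>)) < \<infinity>"
    using fin by (simp add: ennreal_mult_less_top)
  with le show "hankel_norm \<phi> < \<infinity>" by (rule le_less_trans)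
next
  show "\<exists>C::real. C > 0 \<and>
      (\<forall>\<phi> :: complex \<Rightarrow> ('h, 'h) cblinfun. \<phi> \<in> Hol \<and> BMOA_C_norm \<phi> < \<infinity> \<and> BMOA_C_norm (sharp \<phi>) < \<infinity>
         \<longrightarrow> hankel_norm \<phi> \<le> ennreal C * (BMOA_C_norm \<phi> + BMOA_C_norm (sharp \<phi>)))"
    by (intro exI[of _ "1 / sqrt pi"]) (auto intro: hankel_norm_le_BMOA)
next
  assume "\<nexists>B :: 'h set. finite B \<and> module.span (*\<^sub>C) B = UNIV"
  from bounded_hankel_unbounded_BMOA[OF this]
  show "\<exists>\<phi> :: complex \<Rightarrow> ('h, 'h) cblinfun. \<phi> \<in> Hol \<and> hankel_norm \<phi> < \<infinity>
      \<and> \<not> (BMOA_C_norm \<phi> < \<infinity> \<and> BMOA_C_norm (sharp \<phi>) < \<infinity>)"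
    by auto
qed

end
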